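(* Let $k$ be a field of characteristic zero and let $f: k[x,y] \to k[x,y]$, $(x,y) \mapsto (p,q)$, be a $k$-algebra endomorphism with $\operatorname{Jac}(p,q) \in k^{\times}$. Let $n=\deg_y(p)$, $r=\deg_y(q)$, let $a_n, c_r \in k[x]\setminus\{0\}$ be the coefficients of $y^n$ in $p$ and of $y^r$ in $q$ respectively, and put $u=\deg_x(a_n)$, $v=\deg_x(c_r)$, $A=\gcd(n,u)$, $C=\gcd(r,v)$. Write $n=A\tilde{n}$, $u=A\tilde{u}$, $r=C\tilde{r}$, $v=C\tilde{v}$. Assume that $uv \neq 0$, $\tilde{u}=\tilde{v}$ and $\tilde{n}=\tilde{r}$. If at least one of $A, C$ belongs to $\{1,4\} \cup P$, or $\gcd(A,C) \in \{1,2\}$, then $f$ is an automorphism of $k[x,y]$.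
   Context: $P$ denotes the set of prime numbers. $\operatorname{Jac}(p,q)=p_xq_y-p_yq_x$ is the Jacobian determinant. $f$ is the $k$-algebra endomorphism with $f(x)=p$, $f(y)=q$. The polynomials are written $p=a_ny^n+\cdots+a_1y+a_0$ and $q=c_ry^r+\cdots+c_1y+c_0$ with $a_i,c_i \in k[x]$, $a_n\neq 0$, $c_r \neq 0$, $n=\deg_y(p)$, $r=\deg_y(q)$. $\mathbb{N}$ includes $0$, and $\gcd(t,0)=t$. Since the Jacobian is nonzero, neither $p$ nor $q$ is constant, so $A$ and $C$ are positive and $\tilde n,\tilde u,\tilde r,\tilde v$ are well defined, with $\gcd(\tilde{n},\tilde{u})=1$ and $\gcd(\tilde{r},\tilde{v})=1$. *)

theory Defs
  imports "HOL-Computational_Algebra.Computational_Algebra"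
begin

text \<open>
  The ring \<open>k[x,y]\<close> is represented as \<open>k[x][y]\<close>, i.e. by the type \<open>'k poly poly\<close>: the outer
  variable is \<open>y\<close> and the coefficients are polynomials in \<open>x\<close>. Hence \<^const>\<open>degree\<close> is the
  degree in \<open>y\<close>, and \<^const>\<open>lead_coeff\<close> is the coefficient, in \<open>k[x]\<close>, of the highest
  power of \<open>y\<close>.
\<close>

type_synonym 'k poly_xy = "'k poly poly"

definition const_xy :: "'k::field_char_0 \<Rightarrow> 'k poly_xy" where
  "const_xy c = [:[:c:]:]"

definition var_x :: "'k::field_char_0 poly_xy" where
  "var_x = [:[:0, 1:]:]"

definition var_y :: "'k::field_char_0 poly_xy" where
  "var_y = [:0, 1:]"

definition deriv_x :: "'k::field_char_0 poly_xy \<Rightarrow> 'k poly_xy" where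
  "deriv_x p = map_poly pderiv p"

definition deriv_y :: "'k::field_char_0 poly_xy \<Rightarrow> 'k poly_xy" where
  "deriv_y p = pderiv p"

definition Jac :: "'k::field_char_0 poly_xy \<Rightarrow> 'k poly_xy \<Rightarrow> 'k poly_xy" where
  "Jac p q = deriv_x p * deriv_y q - deriv_y p * deriv_x q"

text \<open>Preservation of \<open>1\<close> and of scalar multiplication follows from fixing the constants.\<close>

definition algebra_endomorphism :: "('k::field_char_0 poly_xy \<Rightarrow> 'k poly_xy) \<Rightarrow> bool" where
  "algebra_endomorphism f \<longleftrightarrow>
     (\<forall>g h. f (g + h) = f g + f h) \<and>
     (\<forall>g h. f (g * h) = f g * f h) \<and>
     (\<forall>c. f (const_xy c) = const_xy c)"

definition algebra_automorphism :: "('k::field_char_0 poly_xy \<Rightarrow> 'k poly_xy) \<Rightarrow> bool" where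
  "algebra_automorphism f \<longleftrightarrow> algebra_endomorphism f \<and> bij f"

end

theory Submission
  imports "HOL-Algebra.Algebraic_Closure_Type" "HOL-Number_Theory.Cong" Defs
begin

unbundle fps_syntax
no_notation var ("X\<index>")
hide_const (open) up_ring.coeff up_ring.monom module.smult Polynomials.degree
  Polynomials.lead_coeff Coset.order Divisibility.prime

text \<open>
  The hypotheses contradict each other, and the proof derives this contradiction. The components of
  an automorphism have triangular Newton polygons with all vertices on the axes, which \<open>u v \<noteq> 0\<close>
  excludes; what has to be shown is that no pair with a nonzero constant Jacobian has the corners
  \<open>(u, n) = A (u', n')\<close> and \<open>(v, r) = C (u', n')\<close> when \<open>A\<close> and \<open>C\<close> satisfy the arithmetic condition.

  \<^bold>\<open>Leading forms.\<close> Let \<open>x\<^sup>i y\<^sup>j\<close> have weight \<open>i - e j\<close>, for a rational \<open>e\<close>. The part of highest weight \<open>v\<close>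
  of \<open>P\<close> is \<open>x\<^sup>v p(\<zeta>)\<close> with \<open>\<zeta> = y x\<^sup>e\<close>, so it is a univariate polynomial \<open>p\<close>. If \<open>P\<close> and \<open>Q\<close> have
  constant Jacobian, then their leading forms \<open>p\<close> and \<open>q\<close>, of weights \<open>v\<close> and \<open>w\<close>, either commute,
  that is \<open>v p q' = w p' q\<close>, or \<open>v + w = 1 - e\<close>. Increasing \<open>e\<close> turns the direction clockwise around
  the polygon, starting at the top corner. As long as the forms commute, they are powers
  \<open>r^A\<close> and \<open>r^C\<close> of one polynomial \<open>r\<close>, where \<open>A\<close> and \<open>C\<close> are now divided by their gcd \<open>d\<close>
  (\<open>commuting_common_power\<close>).

  \<^bold>\<open>What an edge looks like.\<close> Starting from \<open>Q^A\<close>, subtract multiples of monomials \<open>P\<^sup>i Q\<^sup>j\<close> to lower the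
  leading term. Every integer above the Frobenius number \<open>A C - A - C\<close> has the form \<open>A i + C j\<close>, so this
  stops only at a \<open>G\<close> whose leading term is no power of that of \<open>r\<close> or fails to commute with \<open>r\<close>
  (\<open>ex_reduced_combination\<close>). If its leading form \<open>g\<close> does not commute with \<open>r\<close>, it solves a differential
  equation \<open>w r g' - v r' g = c r^N\<close>, which fixes the order of \<open>g\<close> at each root of \<open>r\<close> and bounds the number of
  these roots by a degree (\<open>order_solution\<close>, \<open>card_roots_solution\<close>). If \<open>d = 1\<close>, then \<open>r\<close> has a
  single root \<open>z\<close> (\<open>primitive_edge_one_root\<close>), \<open>e\<close> is an integer, and \<open>y \<mapsto> y + z x^(-e)\<close> removes the edge.
  If \<open>d = 2\<close>, there is one other possibility: \<open>k w = 2 (1 - e)\<close> for an odd \<open>k\<close>, and some root of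
  \<open>r\<close> has a multiplicity \<open>m > 2 / k\<close> (\<open>doubled_edge_roots\<close>, \<open>ex_large_root\<close>).

  \<^bold>\<open>The contradiction.\<close> A corner on or above the diagonal cannot stay dominant up to \<open>e = 1\<close>, because
  there the weights of \<open>P\<close> and \<open>Q\<close> would be at most \<open>0\<close> and the Jacobian would vanish; hence there is a next edge
  with \<open>e < 1\<close> (\<open>ex_next_edge\<close>). The same holds in the coordinates centred at a root of multiplicity
  \<open>m > 2 / k\<close>, because there the new corner is again above the diagonal. On the new edge three
  things can happen, and all fail since \<open>0 < e < 1\<close>: a noncommuting pair of forms would give \<open>P\<close> or \<open>Q\<close> a weight that is
  an integer strictly between \<open>0\<close> and \<open>1\<close>; a single root would make \<open>e\<close> such an integer; and a reduced
  combination would be a fractional power of the new leading form although the previous edge forces an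
  integral power (\<open>no_edge_with_large_root_at_0\<close>). The coordinates centred at the root have integral
  exponents: either the root is \<open>0\<close>, or \<open>e\<close> is \<open>0\<close> or \<open>1/2\<close> (\<open>half_integral_cases\<close>), and in the last
  case one substitutes \<open>x = X\<^sup>2\<close>. This is \<open>no_laurent_pair\<close>.

  \<^bold>\<open>Reductions.\<close> The corner is on or above the diagonal after exchanging \<open>x\<close> and \<open>y\<close> if necessary
  (\<open>no_jacobian_pair\<close>). If the original \<open>A\<close> is \<open>4\<close> or a prime and \<open>gcd A C > 2\<close>, then \<open>A\<close> divides \<open>C\<close>, and
  subtracting a multiple of \<open>p^(C/A)\<close> from \<open>q\<close> replaces \<open>C\<close> by a smaller number
  (\<open>no_jacobian_pair_prime_or_4\<close>).
\<close>

section \<open>Weights and leading forms\<close>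

text \<open>
  Laurent series are written in the uniformizer \<open>1/x\<close>, so that the series that occur have finitely
  many positive powers of \<open>x\<close>; hence the sign in \<open>mon\<close>, the coefficient of \<open>x\<^sup>i y\<^sup>j\<close>.
\<close>
definition mon :: "'a::zero fls poly \<Rightarrow> int \<Rightarrow> nat \<Rightarrow> 'a" where
  "mon P i j = coeff P j $$ (-i)"

abbreviation wt :: "rat \<Rightarrow> int \<Rightarrow> nat \<Rightarrow> rat" where
  "wt e i j \<equiv> of_int i - e * of_nat j"

definition wt_le :: "rat \<Rightarrow> rat \<Rightarrow> 'a::zero fls poly \<Rightarrow> bool" where
  "wt_le e v P \<longleftrightarrow> (\<forall>i j. mon P i j \<noteq> 0 \<longrightarrow> wt e i j \<le> v)"

text \<open>
  The component of weight \<open>v\<close>, written as a polynomial in \<open>\<zeta> = y x\<^sup>e\<close>: the coefficient of \<open>\<zeta>\<^sup>j\<close> is that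
  of \<open>x^(v + e j) y\<^sup>j\<close>, which is \<open>0\<close> unless the exponent \<open>v + e j\<close> is an integer.
\<close>
definition lform :: "rat \<Rightarrow> rat \<Rightarrow> 'a::comm_monoid_add fls poly \<Rightarrow> 'a poly" where
  "lform e v P = (\<Sum>j\<le>degree P. monom (if v + e * of_nat j \<in> \<int> then mon P \<lfloor>v + e * of_nat j\<rfloor> j else 0) j)"

lemma mon_simps [simp]:
  "mon 0 i j = 0"
  "mon (P + Q) i j = mon P i j + mon Q i j"
  "mon (P' - Q') i j = mon P' i j - mon Q' i j"
  "mon (smult (fls_const c) R) i j = c * mon R i j"
  for P Q :: "'a::comm_monoid_add fls poly" and P' Q' :: "'b::ab_group_add fls poly"
    and R :: "'c::comm_ring_1 fls poly"
  by (simp_all add: mon_def)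

lemma coeff_lform:
  "coeff (lform e v P) j = (if v + e * of_nat j \<in> \<int> then mon P \<lfloor>v + e * of_nat j\<rfloor> j else 0)"
proof -
  have "coeff (lform e v P) j = (\<Sum>i\<le>degree P. if i = j then (if v + e * of_nat i \<in> \<int> then mon P \<lfloor>v + e * of_nat i\<rfloor> i else 0) else 0)"
    unfolding lform_def by (simp add: coeff_sum)
  also have "\<dots> = (if j \<le> degree P then (if v + e * of_nat j \<in> \<int> then mon P \<lfloor>v + e * of_nat j\<rfloor> j else 0) else 0)"
    by (subst sum.delta) auto
  also have "\<dots> = (if v + e * of_nat j \<in> \<int> then mon P \<lfloor>v + e * of_nat j\<rfloor> j else 0)"
    by (auto simp: mon_def coeff_eq_0)
  finally show ?thesis .
qed

lemma coeff_lform_mon: "coeff (lform e (wt e i j) P) j = mon P i j"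
  by (simp add: coeff_lform)

lemma coeff_lform_nonzero:
  assumes "coeff (lform e v P) j \<noteq> 0"
  obtains i where "of_int i = v + e * of_nat j" "mon P i j = coeff (lform e v P) j"
  using assms by (auto simp: coeff_lform elim!: Ints_cases split: if_splits)

lemma lform_simps [simp]:
  "lform e v 0 = 0"
  "lform e v (P + Q) = lform e v P + lform e v Q"
  "lform e v (P' - Q') = lform e v P' - lform e v Q'"
  "lform e v (smult (fls_const c) R) = smult c (lform e v R)"
  for P Q :: "'a::comm_monoid_add fls poly" and P' Q' :: "'b::ab_group_add fls poly"
    and R :: "'c::comm_ring_1 fls poly"
  by (intro poly_eqI; simp add: coeff_lform)+

lemma degree_lform: "degree (lform e v P) \<le> degree P"
  by (rule degree_le) (auto simp: coeff_lform mon_def coeff_eq_0)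

lemma wt_leD: "wt_le e v P \<Longrightarrow> mon P i j \<noteq> 0 \<Longrightarrow> wt e i j \<le> v"
  by (auto simp: wt_le_def)

lemma wt_le_0 [simp]: "wt_le e v 0"
  by (simp add: wt_le_def)

lemma wt_le_mono: "wt_le e v P \<Longrightarrow> v \<le> w \<Longrightarrow> wt_le e w P"
  by (force simp: wt_le_def)

lemma wt_le_add: "wt_le e v P \<Longrightarrow> wt_le e v Q \<Longrightarrow> wt_le e v (P + Q)"
  for P :: "'a::comm_monoid_add fls poly"
  unfolding wt_le_def mon_simps by (metis add_0_left add_0_right)

lemma wt_le_diff: "wt_le e v P \<Longrightarrow> wt_le e v Q \<Longrightarrow> wt_le e v (P - Q)"
  for P :: "'a::ab_group_add fls poly"
  unfolding wt_le_def mon_simps by (metis diff_0_right diff_self diff_zero)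

lemma wt_le_smult: "wt_le e v P \<Longrightarrow> wt_le e v (smult (fls_const c) P)"
  for P :: "'a::comm_ring_1 fls poly"
  unfolding wt_le_def mon_simps by (metis mult_zero_right)

lemma wt_le_sum: "(\<And>k. k \<in> K \<Longrightarrow> wt_le e v (F k)) \<Longrightarrow> wt_le e v (\<Sum>k\<in>K. F k)"
  for F :: "'i \<Rightarrow> 'a::comm_monoid_add fls poly"
  by (induction K rule: infinite_finite_induct) (auto intro: wt_le_add)

lemma lform_sum: "lform e v (\<Sum>k\<in>K. F k) = (\<Sum>k\<in>K. lform e v (F k))"
  for F :: "'i \<Rightarrow> 'a::comm_monoid_add fls poly"
  by (induction K rule: infinite_finite_induct) auto

lemma lform_eq_0: "wt_le e v P \<Longrightarrow> v < w \<Longrightarrow> lform e w P = 0"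
proof (rule poly_eqI, rule ccontr)
  fix j assume *: "wt_le e v P" "v < w" "coeff (lform e w P) j \<noteq> coeff 0 j"
  then obtain i where "of_int i = w + e * of_nat j" "mon P i j \<noteq> 0"
    by (metis coeff_lform_nonzero coeff_0)
  with wt_leD[OF *(1)] *(2) show False by fastforce
qed

lemma wt_le_if_lform_nonzero: "wt_le e v P \<Longrightarrow> lform e w P \<noteq> 0 \<Longrightarrow> w \<le> v"
  using lform_eq_0 by (metis not_le)

lemma mon_nonzero_le_degree: "mon P i j \<noteq> 0 \<Longrightarrow> j \<le> degree P"
  by (auto simp: mon_def intro: le_degree)

lemma mon_nonzero_le_subdegree: "mon P i j \<noteq> 0 \<Longrightarrow> i \<le> - fls_subdegree (coeff P j)"
  unfolding mon_def by (metis fls_eq0_below_subdegree linorder_not_less neg_le_iff_le add.inverse_inverse)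

lemma mon_subdegree: "coeff P j \<noteq> 0 \<Longrightarrow> mon P (- fls_subdegree (coeff P j)) j \<noteq> 0"
  by (simp add: mon_def)

lemma ex_weight:
  assumes "P \<noteq> 0"
  obtains v where "wt_le e v P" "lform e v P \<noteq> 0"
proof -
  define K where "K = {j. j \<le> degree P \<and> coeff P j \<noteq> 0}"
  define h where "h j = of_int (- fls_subdegree (coeff P j)) - e * of_nat j" for j
  have K: "finite K" "degree P \<in> K" using assms by (auto simp: K_def)
  have "Max (h ` K) \<in> h ` K" using K by (intro Max_in) auto
  then obtain j where j: "j \<in> K" "Max (h ` K) = h j" by auto
  have "wt_le e (h j) P"
    unfolding wt_le_def
  proof (intro allI impI)
    fix i j' assume *: "mon P i j' \<noteq> 0"
    hence "coeff P j' \<noteq> 0" by (auto simp: mon_def)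
    hence "j' \<in> K" using * by (auto simp: K_def mon_nonzero_le_degree)
    hence "h j' \<le> h j" using K j by (metis Max_ge finite_imageI imageI)
    moreover have "of_int i \<le> (of_int (- fls_subdegree (coeff P j')) :: rat)"
      using mon_nonzero_le_subdegree[OF *] by (simp only: of_int_le_iff)
    ultimately show "wt e i j' \<le> h j" by (simp add: h_def)
  qed
  moreover have "coeff (lform e (h j) P) j \<noteq> 0"
    unfolding h_def coeff_lform_mon using j by (intro mon_subdegree) (auto simp: K_def)
  ultimately show ?thesis using that[of "h j"] by fastforce
qed

lemma fls_mult_nth_lower:
  fixes a b :: "'a::comm_ring_1 fls"
  assumes "\<And>n. n < A \<Longrightarrow> a $$ n = 0" "\<And>n. n < B \<Longrightarrow> b $$ n = 0"
  shows "(a * b) $$ (A + B) = a $$ A * b $$ B" "n < A + B \<Longrightarrow> (a * b) $$ n = 0"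
proof -
  show eq: "(a * b) $$ (A + B) = a $$ A * b $$ B"
  proof (cases "a = 0 \<or> b = 0")
    case False
    hence sub: "A \<le> fls_subdegree a" "B \<le> fls_subdegree b"
      using assms by (auto intro!: fls_subdegree_geI)
    show ?thesis
    proof (cases "A = fls_subdegree a \<and> B = fls_subdegree b")
      case True thus ?thesis by simp
    next
      case False
      hence "A + B < fls_subdegree a + fls_subdegree b" "a $$ A = 0 \<or> b $$ B = 0"
        using sub by auto
      thus ?thesis by (auto simp: fls_times_nth_eq0)
    qed
  qed auto
  show "n < A + B \<Longrightarrow> (a * b) $$ n = 0"
  proof (cases "a = 0 \<or> b = 0")
    case False
    hence "A \<le> fls_subdegree a" "B \<le> fls_subdegree b"
      using assms by (auto intro!: fls_subdegree_geI)
    thus "n < A + B \<Longrightarrow> (a * b) $$ n = 0" by (auto simp: fls_times_nth_eq0)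
  qed auto
qed

text \<open>
  A product of two coefficients contributes to the top weight \<open>v + w\<close> only through their two extreme
  terms. When \<open>v + e j\<close> is not an integer, the first factor has no term of weight exactly \<open>v\<close>, and the
  product stays strictly below \<open>v + w\<close>.
\<close>
lemma wt_le_mult_aux:
  fixes P Q :: "'a::comm_ring_1 fls poly"
  assumes "wt_le e v P" "wt_le e w Q" "v + w \<le> wt e i (j + k)"
  shows "(coeff P j * coeff Q k) $$ (-i) =
    (if of_int i = v + w + e * of_nat (j + k) then coeff (lform e v P) j * coeff (lform e w Q) k else 0)"
proof -
  define I where "I = \<lfloor>v + e * of_nat j\<rfloor>"
  define K where "K = \<lfloor>w + e * of_nat k\<rfloor>"
  have a: "coeff P j $$ n = 0" if "n < - I" for n
  proof (rule ccontr)
    assume "coeff P j $$ n \<noteq> 0"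
    hence "wt e (-n) j \<le> v" using wt_leD[OF assms(1), of "-n" j] by (simp add: mon_def)
    hence "- n \<le> I" unfolding I_def by (simp add: le_floor_iff algebra_simps)
    with that show False by simp
  qed
  have b: "coeff Q k $$ n = 0" if "n < - K" for n
  proof (rule ccontr)
    assume "coeff Q k $$ n \<noteq> 0"
    hence "wt e (-n) k \<le> w" using wt_leD[OF assms(2), of "-n" k] by (simp add: mon_def)
    hence "- n \<le> K" unfolding K_def by (simp add: le_floor_iff algebra_simps)
    with that show False by simp
  qed
  have c: "(coeff P j * coeff Q k) $$ n = 0" if "n < - I + - K" for n
    using that a b by (intro fls_mult_nth_lower(2)[where A = "-I" and B = "-K"]) auto
  have le: "of_int I \<le> v + e * of_nat j" "of_int K \<le> w + e * of_nat k"
    unfolding I_def K_def by (rule of_int_floor_le)+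
  have "of_int (I + K) \<le> (of_int i :: rat)"
    using le assms(3) by (simp add: algebra_simps)
  hence IK: "I + K \<le> i" by (simp only: of_int_le_iff)
  show ?thesis
  proof (cases "of_int i = v + w + e * of_nat (j + k)")
    case i: True
    show ?thesis
    proof (cases "v + e * of_nat j \<in> \<int>")
      case True
      hence eI: "of_int I = v + e * of_nat j" by (simp add: I_def)
      have "w + e * of_nat k = of_int (i - I)" using i eI by (simp add: algebra_simps)
      hence K: "w + e * of_nat k \<in> \<int>" "K = i - I" by (auto simp: K_def)
      have "(coeff P j * coeff Q k) $$ (-I + - K) = coeff P j $$ (-I) * coeff Q k $$ (-K)"
        using a b by (intro fls_mult_nth_lower(1)) auto
      moreover have "coeff (lform e v P) j = coeff P j $$ (-I)" "coeff (lform e w Q) k = coeff Q k $$ (-K)"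
        using True K by (simp_all add: coeff_lform mon_def I_def K_def)
      ultimately show ?thesis using i K by simp
    next
      case False
      hence "of_int I \<noteq> v + e * of_nat j" by (metis Ints_of_int)
      hence "of_int (I + K) < (of_int i :: rat)" using le i by (simp add: algebra_simps)
      hence "- i < - I + - K" by (simp only: of_int_less_iff)
      hence "(coeff P j * coeff Q k) $$ (-i) = 0" by (rule c)
      thus ?thesis using False by (simp add: coeff_lform)
    qed
  next
    case False
    hence "of_int (I + K) < (of_int i :: rat)" using le assms(3) by (simp add: algebra_simps)
    hence "- i < - I + - K" by (simp only: of_int_less_iff)
    hence "(coeff P j * coeff Q k) $$ (-i) = 0" by (rule c)
    thus ?thesis using False by simp
  qed
qed

lemma fls_nth_sum: "(\<Sum>k\<in>K. f k) $$ n = (\<Sum>k\<in>K. f k $$ n)"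
  by (induction K rule: infinite_finite_induct) auto

lemma mon_mult: "mon (P * Q) i n = (\<Sum>j\<le>n. (coeff P j * coeff Q (n - j)) $$ (-i))"
  by (simp add: mon_def coeff_mult fls_nth_sum)

lemma
  fixes P Q :: "'a::comm_ring_1 fls poly"
  assumes "wt_le e v P" "wt_le e w Q"
  shows wt_le_mult: "wt_le e (v + w) (P * Q)"
    and lform_mult: "lform e (v + w) (P * Q) = lform e v P * lform e w Q"
proof -
  show "wt_le e (v + w) (P * Q)"
    unfolding wt_le_def
  proof (intro allI impI, rule ccontr)
    fix i n assume nz: "mon (P * Q) i n \<noteq> 0" and gt: "\<not> wt e i n \<le> v + w"
    have "mon (P * Q) i n = 0"
      unfolding mon_mult
    proof (rule sum.neutral, rule ballI)
      fix j assume "j \<in> {..n}"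
      thus "(coeff P j * coeff Q (n - j)) $$ (-i) = 0"
        using wt_le_mult_aux[OF assms, of i j "n - j"] gt by auto
    qed
    with nz show False by simp
  qed
  show "lform e (v + w) (P * Q) = lform e v P * lform e w Q"
  proof (rule poly_eqI)
    fix n
    show "coeff (lform e (v + w) (P * Q)) n = coeff (lform e v P * lform e w Q) n"
    proof (cases "v + w + e * of_nat n \<in> \<int>")
      case True
      then obtain i where i: "v + w + e * of_nat n = of_int i" by (auto elim: Ints_cases)
      have "coeff (lform e (v + w) (P * Q)) n = mon (P * Q) i n"
        using i by (simp add: coeff_lform)
      also have "\<dots> = (\<Sum>j\<le>n. coeff (lform e v P) j * coeff (lform e w Q) (n - j))"
        unfolding mon_mult
      proof (rule sum.cong)
        fix j assume "j \<in> {..n}"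
        thus "(coeff P j * coeff Q (n - j)) $$ (-i) = coeff (lform e v P) j * coeff (lform e w Q) (n - j)"
          using wt_le_mult_aux[OF assms, of i j "n - j"] i by (simp add: algebra_simps)
      qed simp
      finally show ?thesis by (simp add: coeff_mult)
    next
      case False
      have "coeff (lform e v P) j * coeff (lform e w Q) (n - j) = 0" if "j \<le> n" for j
      proof (rule ccontr)
        assume "\<not> ?thesis"
        hence "v + e * of_nat j \<in> \<int>" "w + e * of_nat (n - j) \<in> \<int>"
          by (auto simp: coeff_lform split: if_splits)
        hence "(v + e * of_nat j) + (w + e * of_nat (n - j)) \<in> \<int>" by (rule Ints_add)
        also have "(v + e * of_nat j) + (w + e * of_nat (n - j)) = v + w + e * of_nat n"
          using that by (simp add: of_nat_diff algebra_simps)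
        finally show False using False by simp
      qed
      thus ?thesis using False by (simp add: coeff_mult coeff_lform)
    qed
  qed
qed

lemma mon_const: "mon [:a:] i j = (if j = 0 then a $$ (-i) else 0)"
  by (cases j) (auto simp: mon_def)

lemma wt_le_one: "wt_le e 0 (1 :: 'a::comm_ring_1 fls poly)"
  and lform_one: "lform e 0 (1 :: 'a::comm_ring_1 fls poly) = 1"
proof -
  show "wt_le e 0 (1 :: 'a::comm_ring_1 fls poly)"
    by (auto simp: wt_le_def one_pCons mon_const split: if_splits)
  show "lform e 0 (1 :: 'a::comm_ring_1 fls poly) = 1"
    by (rule poly_eqI) (auto simp: coeff_lform one_pCons mon_const coeff_pCons split: nat.splits)
qed

lemma
  fixes P :: "'a::comm_ring_1 fls poly"
  assumes "wt_le e v P"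
  shows wt_le_power: "wt_le e (of_nat n * v) (P ^ n)"
    and lform_power: "lform e (of_nat n * v) (P ^ n) = lform e v P ^ n"
proof (induction n)
  case (Suc n)
  have *: "of_nat (Suc n) * v = v + of_nat n * v" by (simp add: algebra_simps)
  { case 1 show ?case unfolding * power_Suc using wt_le_mult[OF assms Suc(1)] . }
  { case 2 show ?case unfolding * power_Suc lform_mult[OF assms Suc(1)] Suc(2) .. }
qed (simp_all add: wt_le_one lform_one)

section \<open>The Jacobian of Laurent polynomials\<close>

text \<open>
  The derivation \<open>x d/dx\<close>; it preserves weights, which \<open>d/dx\<close> does not.
\<close>
definition fls_xd :: "'a::comm_ring_1 fls \<Rightarrow> 'a fls" where
  "fls_xd a = - (fls_X * fls_deriv a)"

definition xd :: "'a::comm_ring_1 fls poly \<Rightarrow> 'a fls poly" where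
  "xd P = map_poly fls_xd P"

text \<open>
  This is \<open>x\<close> times the Jacobian determinant. A pair with constant Jacobian \<open>c\<close> is therefore
  characterised below by \<open>jac P Q = c x\<close>.
\<close>
definition jac :: "'a::idom fls poly \<Rightarrow> 'a fls poly \<Rightarrow> 'a fls poly" where
  "jac P Q = xd P * pderiv Q - pderiv P * xd Q"

abbreviation keller :: "'a::idom fls poly \<Rightarrow> 'a fls poly \<Rightarrow> 'a \<Rightarrow> bool" where
  "keller P Q c \<equiv> jac P Q = [:fls_const c * fls_X_inv:]"

lemma fls_xd_nth: "fls_xd a $$ n = - of_int n * a $$ n"
  by (simp add: fls_xd_def fls_X_times_conv_shift)

lemma fls_xd_simps [simp]: "fls_xd 0 = 0" "fls_xd (a + b) = fls_xd a + fls_xd b"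
  "fls_xd (fls_const c) = 0"
  by (simp_all add: fls_xd_def algebra_simps)

lemma fls_xd_mult: "fls_xd (a * b) = a * fls_xd b + fls_xd a * b"
  by (simp add: fls_xd_def algebra_simps)

lemma fls_xd_sum: "fls_xd (\<Sum>k\<in>K. f k) = (\<Sum>k\<in>K. fls_xd (f k))"
  by (induction K rule: infinite_finite_induct) auto

lemma coeff_xd: "coeff (xd P) j = fls_xd (coeff P j)"
  by (simp add: xd_def coeff_map_poly)

lemma xd_simps [simp]: "xd 0 = 0" "xd (P + Q) = xd P + xd Q" "xd (P - Q) = xd P - xd Q"
  "xd [:a:] = [:fls_xd a:]" "xd (pCons a P) = pCons (fls_xd a) (xd P)"
  by (intro poly_eqI; simp add: coeff_xd coeff_pCons fls_xd_def algebra_simps split: nat.splits)+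

lemma xd_mult: "xd (P * Q) = P * xd Q + xd P * Q"
proof (rule poly_eqI)
  fix n
  have "coeff (xd (P * Q)) n = (\<Sum>i\<le>n. fls_xd (coeff P i * coeff Q (n - i)))"
    by (simp add: coeff_xd coeff_mult fls_xd_sum)
  also have "\<dots> = coeff (P * xd Q + xd P * Q) n"
    by (simp add: fls_xd_mult coeff_mult coeff_xd sum.distrib)
  finally show "coeff (xd (P * Q)) n = coeff (P * xd Q + xd P * Q) n" .
qed

lemma jac_diff_right: "jac P (Q - R) = jac P Q - jac P R"
  for P :: "'a::idom fls poly"
  by (simp add: jac_def pderiv_diff algebra_simps)

lemma jac_mult_right: "jac P (Q * R) = Q * jac P R + jac P Q * R"
  for P :: "'a::idom fls poly"
  by (simp add: jac_def pderiv_mult xd_mult algebra_simps)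

lemma jac_self [simp]: "jac P P = 0"
  by (simp add: jac_def)

lemma jac_one [simp]: "jac P 1 = 0"
  by (simp add: jac_def one_pCons pderiv_pCons flip: fls_const_1)

lemma jac_smult_right: "jac P (smult (fls_const c) Q) = smult (fls_const c) (jac P Q)"
  for P :: "'a::idom fls poly"
  using jac_mult_right[of P "[:fls_const c:]" Q] by (simp add: jac_def)

lemma jac_power_right: "jac P (Q ^ n) = of_nat n * Q ^ (n - 1) * jac P Q"
  for P :: "'a::idom fls poly"
proof (induction n)
  case (Suc n)
  show ?case
  proof (cases n)
    case (Suc m)
    have "jac P (Q ^ Suc n) = Q * (of_nat n * Q ^ (n - 1) * jac P Q) + jac P Q * Q ^ n"
      by (simp add: jac_mult_right Suc.IH)
    also have "\<dots> = of_nat (Suc n) * Q ^ n * jac P Q"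
      by (simp add: Suc algebra_simps)
    finally show ?thesis by simp
  qed simp
qed simp

lemma jac_power_self [simp]: "jac P (P ^ n) = 0"
  for P :: "'a::idom fls poly"
  by (simp add: jac_power_right)

lemma mon_xd: "mon (xd P) i j = of_int i * mon P i j"
  by (simp add: mon_def coeff_xd fls_xd_nth)

lemma mon_pderiv: "mon (pderiv P) i j = of_nat (Suc j) * mon P i (Suc j)"
  for P :: "'a::idom fls poly"
  by (simp add: mon_def coeff_pderiv fls_of_nat del: of_nat_Suc)

lemma wt_le_xd: "wt_le e v P \<Longrightarrow> wt_le e v (xd P)"
  unfolding wt_le_def mon_xd by (metis mult_zero_right)

lemma wt_le_pderiv: "wt_le e v P \<Longrightarrow> wt_le e (v + e) (pderiv P)"
  for P :: "'a::idom fls poly"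
  unfolding wt_le_def
proof (intro allI impI)
  fix i j assume *: "\<forall>i j. mon P i j \<noteq> 0 \<longrightarrow> wt e i j \<le> v" "mon (pderiv P) i j \<noteq> 0"
  hence "mon P i (Suc j) \<noteq> 0" by (auto simp: mon_pderiv)
  hence "wt e i (Suc j) \<le> v" using *(1) by blast
  thus "wt e i j \<le> v + e" by (simp add: algebra_simps)
qed

lemma lform_pderiv: "lform e (v + e) (pderiv P) = pderiv (lform e v P)"
  for P :: "'a::idom fls poly"
  by (rule poly_eqI) (simp add: coeff_lform coeff_pderiv mon_pderiv algebra_simps)

lemma lform_xd: "lform e v (xd P) = smult (of_rat v) (lform e v P) + smult (of_rat e) (pCons 0 (pderiv (lform e v P)))"
  for P :: "'a::field_char_0 fls poly"
proof (rule poly_eqI)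
  fix j
  have c: "coeff (pCons 0 (pderiv p)) j = of_nat j * coeff p j" for p :: "'a poly"
    by (cases j) (simp_all add: coeff_pderiv)
  show "coeff (lform e v (xd P)) j = coeff (smult (of_rat v) (lform e v P) + smult (of_rat e) (pCons 0 (pderiv (lform e v P)))) j"
  proof (cases "v + e * of_nat j \<in> \<int>")
    case True
    then obtain i where i: "v + e * of_nat j = of_int i" by (auto elim: Ints_cases)
    have "of_int i = (of_rat (of_int i) :: 'a)" by simp
    also have "\<dots> = of_rat v + of_rat e * of_nat j"
      unfolding i[symmetric] by (simp add: of_rat_add of_rat_mult)
    finally have "of_int i = (of_rat v + of_rat e * of_nat j :: 'a)" .
    thus ?thesis using i unfolding coeff_add coeff_smult c
      by (simp add: coeff_lform mon_xd algebra_simps)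
  next
    case False
    thus ?thesis unfolding coeff_add coeff_smult c by (simp add: coeff_lform)
  qed
qed

text \<open>
  The expression that \<open>jac\<close> induces on leading forms \<open>p\<close> and \<open>q\<close> of weights \<open>v\<close> and \<open>w\<close>. It vanishes
  exactly when \<open>q\<^sup>v\<close> and \<open>p\<^sup>w\<close> are proportional, as far as these powers make sense.
\<close>
definition wron :: "rat \<Rightarrow> rat \<Rightarrow> 'a::field_char_0 poly \<Rightarrow> 'a poly \<Rightarrow> 'a poly" where
  "wron v w p q = smult (of_rat v) (p * pderiv q) - smult (of_rat w) (pderiv p * q)"

lemma
  fixes P Q :: "'a::field_char_0 fls poly"
  assumes "wt_le e v P" "wt_le e w Q"
  shows wt_le_jac: "wt_le e (v + w + e) (jac P Q)"
    and lform_jac: "lform e (v + w + e) (jac P Q) = wron v w (lform e v P) (lform e w Q)"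
proof -
  note 1 = wt_le_xd[OF assms(1)] wt_le_pderiv[OF assms(2)]
  note 2 = wt_le_pderiv[OF assms(1)] wt_le_xd[OF assms(2)]
  show "wt_le e (v + w + e) (jac P Q)"
    unfolding jac_def using wt_le_mult[OF 1] wt_le_mult[OF 2]
    by (intro wt_le_diff) (simp_all add: algebra_simps)
  have "lform e (v + w + e) (xd P * pderiv Q) = lform e v (xd P) * pderiv (lform e w Q)"
    using lform_mult[OF 1] by (simp add: lform_pderiv add.assoc)
  moreover have "lform e (v + w + e) (pderiv P * xd Q) = pderiv (lform e v P) * lform e w (xd Q)"
    using lform_mult[OF 2] lform_pderiv[of e v P] by (simp add: algebra_simps)
  ultimately show "lform e (v + w + e) (jac P Q) = wron v w (lform e v P) (lform e w Q)"
    by (simp add: jac_def wron_def lform_xd algebra_simps)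
qed

lemma wt_le_const_x: "wt_le e 1 [:fls_const c * fls_X_inv:]"
  and lform_const_x: "lform e 1 [:fls_const c * fls_X_inv:] = [:c:]"
  for c :: "'a::comm_ring_1"
proof -
  have m: "mon [:fls_const c * fls_X_inv:] i j = (if j = 0 \<and> i = 1 then c else 0)" for i j
    by (auto simp: mon_const)
  show "wt_le e 1 [:fls_const c * fls_X_inv:]" by (auto simp: wt_le_def m split: if_splits)
  show "lform e 1 [:fls_const c * fls_X_inv:] = [:c:]"
    by (rule poly_eqI) (auto simp: coeff_lform m coeff_pCons split: nat.splits)
qed

section \<open>Wronskians of univariate polynomials\<close>

lemma wron_smult: "wron v w (smult c p) q = smult c (wron v w p q)"
  "wron v w p (smult c q) = smult c (wron v w p q)"
  by (simp_all add: wron_def pderiv_smult smult_diff_right mult_ac)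

lemma wron_diff_right: "wron v w p (q - r) = wron v w p q - wron v w p r"
  by (simp add: wron_def pderiv_diff algebra_simps smult_diff_right)

lemma wron_power_left:
  assumes "n \<ge> 1"
  shows "wron (of_nat n * v) w (p ^ n) q = smult (of_nat n) (p ^ (n - 1) * wron v w p q)"
proof -
  obtain m where n: "n = Suc m" using assms by (cases n) auto
  show ?thesis unfolding n
    by (simp add: wron_def pderiv_power_Suc of_rat_mult of_rat_add algebra_simps smult_diff_right
        smult_add_left del: of_nat_Suc power_Suc) (simp add: mult_ac)
qed

lemma wron_power_self: "wron v (of_nat n * v) p (p ^ n) = 0"
proof (cases n)
  case (Suc m)
  show ?thesis unfolding Suc
    by (simp add: wron_def pderiv_power_Suc of_rat_mult del: of_nat_Suc power_Suc) (simp add: mult_ac)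
qed (simp add: wron_def)

text \<open>
  Separates the lowest order term at \<open>z\<close>: it is governed by \<open>w s - v m\<close>, so a cancellation happens only
  if the orders \<open>m\<close> and \<open>s\<close> are in the ratio of the weights.
\<close>
lemma wron_mult_linear:
  fixes p g :: "'a::field_char_0 poly"
  assumes "l = [:-z, 1:]" "p = l ^ m * p1" "g = l ^ s * g1"
  shows "l * wron w v p g = l ^ (m + s) * (smult (of_rat (w * of_nat s - v * of_nat m)) (p1 * g1) + l * wron w v p1 g1)"
proof -
  have d: "l * pderiv (l ^ n * q) = smult (of_nat n) (l ^ n * q) + l ^ Suc n * pderiv q" for n q
  proof (cases n)
    case (Suc k)
    have "pderiv l = 1" by (simp add: assms(1) pderiv_pCons)
    thus ?thesis unfolding Suc
      by (simp add: pderiv_mult pderiv_power_Suc del: of_nat_Suc power_Suc) (simp add: algebra_simps)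
  qed (simp add: pderiv_mult)
  have "l * wron w v p g = smult (of_rat w) (p * (l * pderiv g)) - smult (of_rat v) (l * pderiv p * g)"
    by (simp add: wron_def algebra_simps)
  also have "\<dots> = l ^ (m + s) * (smult (of_rat (w * of_nat s - v * of_nat m)) (p1 * g1) + l * wron w v p1 g1)"
    unfolding assms(2,3) d
    by (simp add: wron_def of_rat_diff of_rat_mult power_add algebra_simps smult_diff_left smult_diff_right smult_add_right)
  finally show ?thesis .
qed

lemma
  fixes p g :: "'a::field_char_0 poly"
  assumes "p \<noteq> 0" "g \<noteq> 0"
  shows order_wron: "w * of_nat (order z g) \<noteq> v * of_nat (order z p) \<Longrightarrow>
      wron w v p g \<noteq> 0 \<and> order z (wron w v p g) + 1 = order z p + order z g"
    and order_wron_ge: "w * of_nat (order z g) = v * of_nat (order z p) \<Longrightarrow> wron w v p g \<noteq> 0 \<Longrightarrow>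
      order z p + order z g \<le> order z (wron w v p g)"
proof -
  define l where "l = [:-z, 1:]"
  define m where "m = order z p"
  define s where "s = order z g"
  obtain p1 where p1: "p = l ^ m * p1" "\<not> l dvd p1" using order_decomp[OF assms(1)] unfolding l_def m_def by blast
  obtain g1 where g1: "g = l ^ s * g1" "\<not> l dvd g1" using order_decomp[OF assms(2)] unfolding l_def s_def by blast
  have l0: "l \<noteq> 0" "poly l z = 0" by (auto simp: l_def)
  have ordl: "order z (l ^ k) = k" for k unfolding l_def by (rule order_power_n_n)
  have nz: "poly p1 z \<noteq> 0" "poly g1 z \<noteq> 0" using p1 g1 unfolding l_def by (simp_all add: poly_eq_0_iff_dvd)
  note eq = wron_mult_linear[OF l_def p1(1) g1(1), of w v]
  define R where "R = smult (of_rat (w * of_nat s - v * of_nat m)) (p1 * g1) + l * wron w v p1 g1"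
  have ordW: "order z (l * wron w v p g) = 1 + order z (wron w v p g)" if "wron w v p g \<noteq> 0"
    using that l0 ordl[of 1] by (subst order_mult) auto
  { assume "w * of_nat (order z g) \<noteq> v * of_nat (order z p)"
    hence "of_rat (w * of_nat s - v * of_nat m) \<noteq> (0::'a)" by (simp add: m_def s_def)
    hence R: "poly R z \<noteq> 0" unfolding R_def using nz l0 by simp
    hence R0: "R \<noteq> 0" by auto
    hence W: "wron w v p g \<noteq> 0" using eq l0 unfolding R_def[symmetric] by auto
    have "1 + order z (wron w v p g) = m + s"
      unfolding ordW[OF W, symmetric] eq R_def[symmetric]
      using R R0 l0 by (subst order_mult) (auto simp: ordl order_0I)
    thus "wron w v p g \<noteq> 0 \<and> order z (wron w v p g) + 1 = order z p + order z g"
      using W by (simp add: m_def s_def) }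
  { assume *: "w * of_nat (order z g) = v * of_nat (order z p)" and W: "wron w v p g \<noteq> 0"
    hence "of_rat (w * of_nat s - v * of_nat m) = (0::'a)" by (simp add: m_def s_def)
    hence eq': "l * wron w v p g = l ^ (m + s + 1) * wron w v p1 g1" unfolding eq by (simp add: mult_ac)
    have "1 + order z (wron w v p g) = order z (l * wron w v p g)"
      using ordW[OF W] by simp
    also note eq'
    finally have "1 + order z (wron w v p g) = order z (l ^ (m + s + 1) * wron w v p1 g1)" .
    moreover have "m + s + 1 \<le> order z (l ^ (m + s + 1) * wron w v p1 g1)"
    proof -
      have "l ^ (m + s + 1) * wron w v p1 g1 \<noteq> 0" using W l0 eq' by (metis mult_eq_0_iff)
      hence "order z (l ^ (m + s + 1)) \<le> order z (l ^ (m + s + 1) * wron w v p1 g1)"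
        by (intro dvd_imp_order_le) auto
      thus ?thesis unfolding ordl .
    qed
    ultimately show "order z p + order z g \<le> order z (wron w v p g)" by (simp add: m_def s_def) }
qed

lemma coeff_wron_top:
  assumes "degree p + degree g = Suc n"
  shows "coeff (wron w v p g) n = of_rat (w * of_nat (degree g) - v * of_nat (degree p)) * lead_coeff p * lead_coeff g"
    and "degree (wron w v p g) \<le> n"
proof -
  have c1: "coeff (f * pderiv h) n = of_nat (degree h) * lead_coeff f * lead_coeff h \<and> degree (f * pderiv h) \<le> n"
    if "degree f + degree h = Suc n" for f h :: "'a poly"
  proof (cases "degree h")
    case 0
    hence "pderiv h = 0" by (simp add: pderiv_eq_0_iff)
    thus ?thesis using 0 by simp
  next
    case (Suc k)
    hence n: "n = degree f + k" using that by simp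
    have dp: "degree (pderiv h) = k" by (simp add: degree_pderiv Suc)
    have "coeff (f * pderiv h) n = lead_coeff f * lead_coeff (pderiv h)"
      unfolding n using coeff_mult_degree_sum[of f "pderiv h"] by (simp add: dp)
    moreover have "lead_coeff (pderiv h) = of_nat (degree h) * lead_coeff h"
      unfolding dp by (simp add: coeff_pderiv Suc)
    moreover have "degree (f * pderiv h) \<le> n" using degree_mult_le[of f "pderiv h"] by (simp add: n dp)
    ultimately show ?thesis by simp
  qed
  have 1: "degree p + degree g = Suc n" "degree g + degree p = Suc n" using assms by auto
  have e: "wron w v p g = smult (of_rat w) (p * pderiv g) - smult (of_rat v) (g * pderiv p)"
    by (simp add: wron_def mult.commute)
  show "coeff (wron w v p g) n = of_rat (w * of_nat (degree g) - v * of_nat (degree p)) * lead_coeff p * lead_coeff g"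
    unfolding e using c1[OF 1(1)] c1[OF 1(2)] by (simp add: of_rat_diff of_rat_mult algebra_simps)
  show "degree (wron w v p g) \<le> n"
    unfolding e using c1[OF 1(1)] c1[OF 1(2)] by (intro degree_diff_le) auto
qed

lemma degree_wron:
  assumes "p \<noteq> 0" "g \<noteq> 0" "w * of_nat (degree g) \<noteq> v * of_nat (degree p)"
  shows "degree (wron w v p g) + 1 = degree p + degree g"
proof -
  have "degree p + degree g \<noteq> 0" using assms(3) by (intro notI) auto
  then obtain n where n: "degree p + degree g = Suc n" by (cases "degree p + degree g") auto
  have "of_rat (w * of_nat (degree g) - v * of_nat (degree p)) \<noteq> (0::'a)" using assms(3) by simp
  hence "coeff (wron w v p g) n \<noteq> 0" unfolding coeff_wron_top(1)[OF n] using assms(1,2) by simp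
  hence "n \<le> degree (wron w v p g)" by (rule le_degree)
  thus ?thesis using coeff_wron_top(2)[OF n, of w v] n by simp
qed

section \<open>Polynomials over algebraically closed fields\<close>

abbreviation roots :: "'a::comm_semiring_0 poly \<Rightarrow> 'a set" where
  "roots p \<equiv> {x. poly p x = 0}"

lemma alg_closed_prod_order:
  fixes p :: "'a::alg_closed_field poly"
  assumes "p \<noteq> 0"
  shows "p = smult (lead_coeff p) (\<Prod>z | poly p z = 0. [:-z, 1:] ^ order z p)"
proof -
  obtain M where M: "p = smult (lead_coeff p) (\<Prod>x\<in>#M. [:-x, 1:])"
    using alg_closed_imp_factorization[OF assms] by blast
  have nz: "(\<Prod>x\<in>#M. [:-x, 1:]) \<noteq> 0" using M assms by (metis smult_0_right)
  have ord: "order z (\<Prod>x\<in>#M. [:-x, 1:]) = count M z" for z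
  proof (induction M)
    case (add x M)
    have "(\<Prod>x\<in>#add_mset x M. [:-x, 1:]) \<noteq> 0" by (subst prod_mset_zero_iff) auto
    hence "order z (\<Prod>x\<in>#add_mset x M. [:-x, 1:]) = order z [:-x, 1:] + count M z"
      unfolding add[symmetric] image_mset_add_mset prod_mset.add_mset by (rule order_mult)
    moreover have "order z [:-x, 1:] = (if x = z then 1 else 0)"
      using order_power_n_n[of z 1] by (auto intro: order_0I)
    ultimately show ?case by auto
  qed simp
  have ordp: "order z p = count M z" for z
    using ord[of z] assms by (subst M) (simp add: order_smult)
  have roots: "roots p = set_mset M"
    using assms ordp by (auto simp: order_root simp flip: count_greater_zero_iff)
  have "(\<Prod>x\<in>#M. [:-x, 1:]) = (\<Prod>x\<in>set_mset M. [:-x, 1:] ^ count M x)"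
    by (rule image_prod_mset_multiplicity)
  thus ?thesis using M by (simp add: roots ordp)
qed

lemma sum_order_eq_degree:
  fixes p :: "'a::alg_closed_field poly"
  assumes "p \<noteq> 0"
  shows "(\<Sum>z | poly p z = 0. order z p) = degree p"
proof -
  have "degree p = degree (\<Prod>z | poly p z = 0. [:-z, 1:] ^ order z p)"
    using assms by (subst alg_closed_prod_order[OF assms]) simp
  also have "\<dots> = (\<Sum>z | poly p z = 0. degree ([:-z, 1:] ^ order z p))"
    by (rule degree_prod_eq_sum_degree) auto
  also have "\<dots> = (\<Sum>z | poly p z = 0. order z p)"
    by (intro sum.cong) (auto simp: degree_power_eq)
  finally show ?thesis by simp
qed

lemma one_root_power:
  fixes p :: "'a::alg_closed_field poly"
  assumes "p \<noteq> 0" "card (roots p) \<le> 1" "degree p \<ge> 1"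
  obtains z where "p = smult (lead_coeff p) ([:-z, 1:] ^ degree p)"
proof -
  have "\<exists>z. poly p z = 0" using assms(3) by (intro alg_closed_imp_poly_has_root) simp
  then obtain z where z: "poly p z = 0" by blast
  have fin: "finite (roots p)" using assms(1) by (rule poly_roots_finite)
  have eq: "roots p = {z}"
    using card_le_Suc0_iff_eq[OF fin] assms(2) z by auto
  have "order z p = degree p" using sum_order_eq_degree[OF assms(1)] unfolding eq by simp
  thus ?thesis using alg_closed_prod_order[OF assms(1)] that[of z] unfolding eq by simp
qed

lemma power_if_dvd_orders:
  fixes p :: "'a::alg_closed_field poly"
  assumes "p \<noteq> 0" "\<And>z. n dvd order z p"
  obtains r where "p = smult (lead_coeff p) (r ^ n)"
proof -
  have "(\<Prod>z | poly p z = 0. [:-z, 1:] ^ order z p) = (\<Prod>z | poly p z = 0. [:-z, 1:] ^ (order z p div n)) ^ n"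
    unfolding prod_power_distrib using assms(2) by (intro prod.cong) (auto simp flip: power_mult)
  with alg_closed_prod_order[OF assms(1)] show ?thesis by (intro that) (rule trans, assumption, simp)
qed

lemma eq_smult_if_orders_eq:
  fixes p q :: "'a::alg_closed_field poly"
  assumes "p \<noteq> 0" "q \<noteq> 0" "\<And>z. order z p = order z q"
  obtains c where "q = smult c p" "c \<noteq> 0"
proof -
  have "roots p = roots q" using assms by (auto simp: order_root)
  hence eq: "(\<Prod>z | poly p z = 0. [:-z, 1:] ^ order z p) = (\<Prod>z | poly q z = 0. [:-z, 1:] ^ order z q)"
    using assms(3) by simp
  define F where "F = (\<Prod>z | poly q z = 0. [:-z, 1:] ^ order z q)"
  define a b where "a = lead_coeff p" and "b = lead_coeff q"
  have "p = smult a F" "q = smult b F" "a \<noteq> 0" "b \<noteq> 0"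
    using alg_closed_prod_order[OF assms(1)] alg_closed_prod_order[OF assms(2)] assms(1,2)
    unfolding eq F_def a_def b_def by auto
  thus ?thesis using that[of "b / a"] by simp
qed

section \<open>Roots of solutions of the Wronskian equation\<close>

text \<open>
  Compare orders at \<open>z\<close>. If the lowest terms on the left did cancel, the order of \<open>g\<close> would be
  \<open>v m / w\<close>, and the left side would vanish to order at least \<open>m + v m / w\<close>, which exceeds the order
  \<open>N m\<close> of the right side because \<open>v + w > N w\<close>.
\<close>
lemma order_solution:
  fixes \<rho> g :: "'a::field_char_0 poly"
  assumes "\<rho> \<noteq> 0" "g \<noteq> 0" "wron w v \<rho> g = smult c (\<rho> ^ N)" "c \<noteq> 0"
    and "w > 0" "\<delta> > 0" "v + w = of_nat N * w + \<delta>" "poly \<rho> z = 0"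
  shows "order z g + order z \<rho> = N * order z \<rho> + 1" "\<delta> * of_nat (order z \<rho>) \<noteq> w"
proof -
  define m where "m = order z \<rho>"
  define s where "s = order z g"
  have W: "wron w v \<rho> g \<noteq> 0" using assms by simp
  have "order z (\<rho> ^ N) = N * m" unfolding m_def using assms(1) by (induction N) (auto simp: order_mult)
  hence oW: "order z (wron w v \<rho> g) = N * m" using assms by (simp add: order_smult)
  have m: "m > 0" unfolding m_def using assms by (simp add: order_root)
  have ne: "w * of_nat s \<noteq> v * of_nat m"
  proof
    assume eq: "w * of_nat s = v * of_nat m"
    hence "m + s \<le> N * m" using order_wron_ge[OF assms(1,2) _ W, of z] oW by (simp add: m_def s_def)
    hence "w * (of_nat m + of_nat s) \<le> w * (of_nat N * of_nat m)"
      using \<open>w > 0\<close> by (intro mult_left_mono) (simp_all flip: of_nat_add of_nat_mult)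
    hence "(v + w) * of_nat m \<le> of_nat N * w * of_nat m" using eq by (simp add: algebra_simps)
    hence "\<delta> * of_nat m \<le> 0" unfolding assms(7) by (simp add: algebra_simps)
    moreover have "\<delta> * of_nat m > 0" using m \<open>\<delta> > 0\<close> by simp
    ultimately show False by linarith
  qed
  show 1: "order z g + order z \<rho> = N * order z \<rho> + 1"
    using order_wron[OF assms(1,2), of w z v] ne oW by (simp add: m_def s_def)
  show "\<delta> * of_nat (order z \<rho>) \<noteq> w"
  proof
    assume "\<delta> * of_nat (order z \<rho>) = w"
    moreover have "(v + w) * of_nat m = (of_nat N * w + \<delta>) * of_nat m" using assms(7) by simp
    ultimately have "v * of_nat m + w * of_nat m = of_nat N * w * of_nat m + w"
      by (simp add: m_def algebra_simps)
    moreover have "of_nat s + of_nat m = of_nat N * of_nat m + (1::rat)"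
      using 1 unfolding m_def[symmetric] s_def[symmetric] by (simp flip: of_nat_add of_nat_mult)
    hence "w * (of_nat s + of_nat m) = w * (of_nat N * of_nat m + 1)" by simp
    ultimately show False using ne by (simp add: algebra_simps)
  qed
qed

lemma card_roots_solution:
  fixes \<rho> g :: "'a::{alg_closed_field,field_char_0} poly"
  assumes "\<rho> \<noteq> 0" "g \<noteq> 0" "wron w v \<rho> g = smult c (\<rho> ^ N)" "c \<noteq> 0"
    and "w > 0" "\<delta> > 0" "v + w = of_nat N * w + \<delta>"
  shows "card (roots \<rho>) + N * degree \<rho> \<le> degree g + degree \<rho>"
proof -
  let ?R = "roots \<rho>"
  have fin: "finite ?R" using assms(1) by (rule poly_roots_finite)
  have "card ?R + N * degree \<rho> = (\<Sum>z\<in>?R. N * order z \<rho> + 1)"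
    by (simp add: sum_Suc sum_distrib_left sum_order_eq_degree[OF assms(1), symmetric])
  also have "\<dots> = (\<Sum>z\<in>?R. order z g + order z \<rho>)"
    using order_solution(1)[OF assms] by (intro sum.cong) auto
  also have "\<dots> = (\<Sum>z\<in>?R. order z g) + degree \<rho>"
    by (simp add: sum.distrib sum_order_eq_degree[OF assms(1)])
  also have "(\<Sum>z\<in>?R. order z g) = (\<Sum>z\<in>?R \<inter> roots g. order z g)"
    using fin by (intro sum.mono_neutral_right) (auto simp: order_0I)
  also have "\<dots> \<le> (\<Sum>z | poly g z = 0. order z g)"
    using poly_roots_finite[OF assms(2)] by (intro sum_mono2) auto
  also have "\<dots> \<le> degree g" using assms(2) by (rule sum_order_le_degree)
  finally show ?thesis by simp
qed

text \<open>
  If the top terms of \<open>\<rho>\<close> and \<open>g\<close> do not commute, the degree of the left side is known and makes the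
  bound of \<open>card_roots_solution\<close> equal to \<open>1\<close>. If \<open>v = s w\<close>, then \<open>\<rho>\<^sup>s\<close> solves the homogeneous equation, and
  subtracting a multiple of it from \<open>g\<close> leads to the first case.
\<close>
lemma one_root_solution:
  fixes \<rho> g :: "'a::{alg_closed_field,field_char_0} poly"
  assumes "\<rho> \<noteq> 0" "g \<noteq> 0" "wron w v \<rho> g = smult c (\<rho> ^ N)" "c \<noteq> 0"
    and "w > 0" "\<delta> > 0" "v + w = of_nat N * w + \<delta>"
    and "w * of_nat (degree g) \<noteq> v * of_nat (degree \<rho>) \<or> v = of_nat s * w"
  shows "card (roots \<rho>) \<le> 1"
proof -
  have main: "card (roots \<rho>) \<le> 1"
    if g: "g \<noteq> 0" "wron w v \<rho> g = smult c (\<rho> ^ N)" "w * of_nat (degree g) \<noteq> v * of_nat (degree \<rho>)" for g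
  proof -
    have "degree (wron w v \<rho> g) + 1 = degree \<rho> + degree g" using assms(1) g by (intro degree_wron)
    moreover have "degree (wron w v \<rho> g) = N * degree \<rho>" using assms by (simp add: g degree_power_eq)
    ultimately show ?thesis using card_roots_solution[OF assms(1) g(1,2) assms(4-7)] by simp
  qed
  show ?thesis
  proof (cases "w * of_nat (degree g) = v * of_nat (degree \<rho>)")
    case False thus ?thesis using main assms by blast
  next
    case True
    hence v: "v = of_nat s * w" using assms by blast
    hence dg: "degree g = s * degree \<rho>" using True \<open>w > 0\<close> by (simp flip: of_nat_mult of_nat_eq_iff)
    define a where "a = lead_coeff g / lead_coeff (\<rho> ^ s)"
    define h where "h = g - smult a (\<rho> ^ s)"
    have W: "wron w v \<rho> h = smult c (\<rho> ^ N)"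
      unfolding h_def wron_diff_right wron_smult assms(3) unfolding v wron_power_self by simp
    have h0: "h \<noteq> 0" using W assms by (auto simp: wron_def)
    have "degree h \<noteq> degree g"
    proof
      assume "degree h = degree g"
      moreover have "degree g = degree (\<rho> ^ s)" using assms(1) by (simp add: dg degree_power_eq)
      hence "coeff h (degree g) = lead_coeff g - a * lead_coeff (\<rho> ^ s)" by (simp add: h_def)
      hence "coeff h (degree g) = 0" using assms(1) by (simp add: a_def)
      ultimately show False using h0 by (metis leading_coeff_0_iff)
    qed
    hence "w * of_nat (degree h) \<noteq> v * of_nat (degree \<rho>)" using True \<open>w > 0\<close>
      by (metis mult_left_cancel of_nat_eq_iff less_irrefl)
    thus ?thesis using main h0 W by blast
  qed
qed

section \<open>Commuting polynomials\<close>

lemma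
  fixes \<rho> g :: "'a::field_char_0 poly"
  assumes "\<rho> \<noteq> 0" "g \<noteq> 0" "wron w v \<rho> g = 0"
  shows order_commuting: "w * of_nat (order z g) = v * of_nat (order z \<rho>)"
    and degree_commuting: "w * of_nat (degree g) = v * of_nat (degree \<rho>)"
proof -
  show "w * of_nat (order z g) = v * of_nat (order z \<rho>)" using order_wron[OF assms(1,2), of w z v] assms(3) by blast
  show "w * of_nat (degree g) = v * of_nat (degree \<rho>)"
  proof (rule ccontr)
    assume *: "w * of_nat (degree g) \<noteq> v * of_nat (degree \<rho>)"
    hence "degree \<rho> + degree g \<noteq> 0" by (intro notI) auto
    then obtain n where n: "degree \<rho> + degree g = Suc n" by (cases "degree \<rho> + degree g") auto
    have "of_rat (w * of_nat (degree g) - v * of_nat (degree \<rho>)) \<noteq> (0::'a)" using * by simp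
    thus False using coeff_wron_top(1)[OF n, of w v] assms by simp
  qed
qed

lemma commuting_power:
  fixes \<rho> g :: "'a::field_char_0 poly"
  assumes "\<rho> \<noteq> 0" "g \<noteq> 0" "wron w v \<rho> g = 0" "v = of_nat s * w" "w > 0"
  obtains c where "g = smult c (\<rho> ^ s)" "c \<noteq> 0"
proof -
  have dg: "degree g = s * degree \<rho>"
    using degree_commuting[OF assms(1-3)] assms(4,5) by (simp flip: of_nat_mult of_nat_eq_iff)
  define a where "a = lead_coeff g / lead_coeff (\<rho> ^ s)"
  define h where "h = g - smult a (\<rho> ^ s)"
  have W: "wron w v \<rho> h = 0"
    unfolding h_def wron_diff_right wron_smult assms(3) unfolding assms(4) wron_power_self by simp
  have "h = 0"
  proof (rule ccontr)
    assume "h \<noteq> 0"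
    hence "w * of_nat (degree h) = v * of_nat (degree \<rho>)" using degree_commuting[OF assms(1) _ W] by simp
    hence "degree h = degree g" using degree_commuting[OF assms(1-3)] \<open>w > 0\<close> by (metis mult_left_cancel of_nat_eq_iff less_irrefl)
    moreover have "degree g = degree (\<rho> ^ s)" using assms(1) by (simp add: dg degree_power_eq)
    hence "coeff h (degree g) = lead_coeff g - a * lead_coeff (\<rho> ^ s)" by (simp add: h_def)
    hence "coeff h (degree g) = 0" using assms(1) by (simp add: a_def)
    ultimately show False using \<open>h \<noteq> 0\<close> by (metis leading_coeff_0_iff)
  qed
  hence "g = smult a (\<rho> ^ s)" by (simp add: h_def)
  moreover have "a \<noteq> 0" using assms by (simp add: a_def)
  ultimately show ?thesis using that by blast
qed

text \<open>
  Commuting forces \<open>2 ord g = s ord \<rho>\<close> at each point, so \<open>\<rho>\<close> has even order everywhere.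
\<close>
lemma commuting_odd_square:
  fixes \<rho> g :: "'a::{alg_closed_field,field_char_0} poly"
  assumes "\<rho> \<noteq> 0" "g \<noteq> 0" "wron w v \<rho> g = 0" "2 * v = of_nat s * w" "odd s" "w > 0"
  obtains \<sigma> c where "\<rho> = smult c (\<sigma> ^ 2)" "c \<noteq> 0"
proof -
  have "even (order z \<rho>)" for z
  proof -
    have "w * of_nat (2 * order z g) = 2 * (w * of_nat (order z g))" by simp
    also have "\<dots> = (2 * v) * of_nat (order z \<rho>)"
      unfolding order_commuting[OF assms(1-3), of z] by simp
    also have "\<dots> = w * of_nat (s * order z \<rho>)" unfolding assms(4) by simp
    finally have "w * of_nat (2 * order z g) = w * of_nat (s * order z \<rho>)" .
    hence "2 * order z g = s * order z \<rho>" using \<open>w > 0\<close> by (simp only: mult_cancel_left of_nat_eq_iff) auto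
    thus ?thesis using \<open>odd s\<close> by (metis dvd_triv_left even_mult_iff)
  qed
  then obtain \<sigma> where "\<rho> = smult (lead_coeff \<rho>) (\<sigma> ^ 2)" using power_if_dvd_orders[OF assms(1)] by blast
  thus ?thesis using that assms(1) by (metis leading_coeff_0_iff)
qed

lemma commuting_common_power:
  fixes p q :: "'a::{alg_closed_field,field_char_0} poly"
  assumes "p \<noteq> 0" "q \<noteq> 0" "wron (of_nat A * w) (of_nat C * w) p q = 0" "w > 0" "coprime A C" "A \<ge> 1" "C \<ge> 1"
  obtains r c c' where "p = smult c (r ^ A)" "c \<noteq> 0" "q = smult c' (r ^ C)" "c' \<noteq> 0" "r \<noteq> 0"
proof -
  have ord: "A * order z q = C * order z p" for z
  proof -
    have "w * of_nat (A * order z q) = w * of_nat (C * order z p)"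
      using order_commuting[OF assms(1-3), of z] by (simp add: algebra_simps)
    thus ?thesis using \<open>w > 0\<close> by (simp only: mult_cancel_left of_nat_eq_iff) auto
  qed
  have "A dvd order z p" for z
    using ord[of z] assms(5) by (metis coprime_dvd_mult_right_iff dvd_triv_left)
  then obtain r where r: "p = smult (lead_coeff p) (r ^ A)" using power_if_dvd_orders[OF assms(1)] by blast
  have r0: "r \<noteq> 0" using r assms by (metis leading_coeff_0_iff power_0_left smult_0_right not_one_le_zero)
  have ordpow: "order z (r ^ n) = n * order z r" for n z
    using r0 by (induction n) (auto simp: order_mult)
  have "order z p = A * order z r" for z
    using assms(1) by (subst r) (simp add: order_smult ordpow)
  hence "order z (r ^ C) = order z q" for z
    using ord[of z] assms(6) by (auto simp: ordpow)
  then obtain c' where "q = smult c' (r ^ C)" "c' \<noteq> 0"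
    using eq_smult_if_orders_eq[of "r ^ C" q] r0 assms(2) by auto
  thus ?thesis using that r r0 assms(1) by (metis leading_coeff_0_iff)
qed

section \<open>Lowering leading terms\<close>

lemma finite_weights: "finite {(i::int, j::nat). j \<le> D \<and> vmin \<le> wt e i j \<and> wt e i j \<le> (v0::rat)}"
proof (rule finite_subset)
  show "{(i::int, j::nat). j \<le> D \<and> vmin \<le> wt e i j \<and> wt e i j \<le> v0}
    \<subseteq> prod.swap ` (SIGMA j:{..D}. {\<lceil>vmin + e * of_nat j\<rceil>..\<lfloor>v0 + e * of_nat j\<rfloor>})"
    by (auto simp: image_iff ceiling_le_iff le_floor_iff algebra_simps)
qed auto

text \<open>
  Among the admissible \<open>G\<close>, the leading terms are ordered by weight and then by degree in \<open>\<zeta>\<close>. A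
  leading term that agrees with that of some \<open>M s\<close> can be cancelled, which lowers it; since weights and
  \<open>y\<close>-degrees are bounded, only finitely many terms are available and the process stops. The predicate
  \<open>X\<close> collects whatever is to be preserved by the cancellations.
\<close>
lemma greedy:
  fixes X :: "'a::field_char_0 fls poly \<Rightarrow> bool"
  assumes X0: "X G0"
    and bd: "\<And>G. X G \<Longrightarrow> degree G \<le> D \<and> wt_le e v0 G"
    and low: "\<And>G v. X G \<Longrightarrow> wt_le e v G \<Longrightarrow> vmin \<le> v"
    and red: "\<And>s c G. s \<in> S \<Longrightarrow> of_nat s * w \<le> v0 \<Longrightarrow> X G \<Longrightarrow> X (G - smult (fls_const c) (M s))"
    and M: "\<And>s. s \<in> S \<Longrightarrow> of_nat s * w \<le> v0 \<Longrightarrow> wt_le e (of_nat s * w) (M s) \<and>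
        (\<exists>\<kappa>. \<kappa> \<noteq> 0 \<and> lform e (of_nat s * w) (M s) = smult \<kappa> (\<rho> ^ s))"
    and \<rho>: "\<rho> \<noteq> 0"
  obtains G v where "X G" "wt_le e v G" "lform e v G \<noteq> 0" "v \<le> v0"
    "\<And>s. s \<in> S \<Longrightarrow> v = of_nat s * w \<Longrightarrow> degree (lform e v G) \<noteq> s * degree \<rho>"
proof -
  define \<Lambda> where "\<Lambda> = {(i::int, j::nat). j \<le> D \<and> vmin \<le> wt e i j \<and> wt e i j \<le> v0}"
  have fin\<Lambda>: "finite \<Lambda>" unfolding \<Lambda>_def by (rule finite_weights)
  \<comment> \<open>the exponents of monomials that do not exceed a leading term of weight \<open>v\<close> and degree \<open>d\<close>\<close>
  define T where "T v d = {(i, j) \<in> \<Lambda>. wt e i j < v \<or> (wt e i j = v \<and> j \<le> d)}" for v d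
  have "\<exists>G' v'. X G' \<and> wt_le e v' G' \<and> lform e v' G' \<noteq> 0 \<and>
      (\<forall>s\<in>S. v' = of_nat s * w \<longrightarrow> degree (lform e v' G') \<noteq> s * degree \<rho>)"
    if "X G" "wt_le e v G" "lform e v G \<noteq> 0" for G v
    using that
  proof (induction "card (T v (degree (lform e v G)))" arbitrary: G v rule: less_induct)
    case less
    define d where "d = degree (lform e v G)"
    have vv0: "v \<le> v0" using bd[OF less.prems(1)] less.prems(3) wt_le_if_lform_nonzero by blast
    show ?case
    proof (cases "\<exists>s\<in>S. v = of_nat s * w \<and> d = s * degree \<rho>")
      case False
      thus ?thesis using less.prems unfolding d_def by blast
    next
      case True
      then obtain s where s: "s \<in> S" "v = of_nat s * w" "d = s * degree \<rho>" by blast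
      obtain \<kappa> where \<kappa>: "\<kappa> \<noteq> 0" "lform e v (M s) = smult \<kappa> (\<rho> ^ s)" "wt_le e v (M s)"
        using M[OF s(1)] vv0 s(2) by auto
      define c where "c = lead_coeff (lform e v G) / (\<kappa> * lead_coeff (\<rho> ^ s))"
      define G' where "G' = G - smult (fls_const c) (M s)"
      have XG': "X G'" unfolding G'_def using red[OF s(1)] vv0 s(2) less.prems(1) by auto
      have wG': "wt_le e v G'" unfolding G'_def using less.prems(2) \<kappa>(3) by (intro wt_le_diff wt_le_smult)
      have lG': "lform e v G' = lform e v G - smult (c * \<kappa>) (\<rho> ^ s)" by (simp add: G'_def \<kappa>(2))
      have dd: "d = degree (\<rho> ^ s)" using \<rho> by (simp add: s(3) degree_power_eq)
      have "coeff (lform e v G') d = lead_coeff (lform e v G) - c * \<kappa> * lead_coeff (\<rho> ^ s)"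
        unfolding lG' by (simp add: d_def[symmetric]) (simp add: dd)
      hence cd: "coeff (lform e v G') d = 0" using \<kappa>(1) \<rho> by (simp add: c_def)
      have ledeg: "degree (lform e v G') \<le> d"
        unfolding lG' by (intro degree_diff_le) (auto simp: d_def[symmetric] dd intro: order_trans[OF degree_smult_le])
      have G'0: "G' \<noteq> 0"
      proof
        assume "G' = 0"
        hence "vmin \<le> vmin - 1" using low[OF XG', of "vmin - 1"] by simp
        thus False by simp
      qed
      then obtain v' where v': "wt_le e v' G'" "lform e v' G' \<noteq> 0" using ex_weight by blast
      have "v' \<le> v" using wG' v' wt_le_if_lform_nonzero by blast
      moreover have "degree (lform e v' G') < d" if "v' = v"
        using that ledeg cd v'(2) by (metis leading_coeff_0_iff le_neq_implies_less)
      ultimately have lt: "v' < v \<or> (v' = v \<and> degree (lform e v' G') < d)" by fastforce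
      have "coeff (lform e v G) d \<noteq> 0" using less.prems(3) by (simp add: d_def)
      then obtain i where i: "of_int i = v + e * of_nat d" "mon G i d \<noteq> 0" by (metis coeff_lform_nonzero)
      have "(i, d) \<in> T v d" unfolding T_def \<Lambda>_def
        using i vv0 low[OF less.prems(1,2)] bd[OF less.prems(1)] mon_nonzero_le_degree[OF i(2)] by auto
      moreover have "(i, d) \<notin> T v' (degree (lform e v' G'))" unfolding T_def using i lt by auto
      moreover have "T v' (degree (lform e v' G')) \<subseteq> T v d" unfolding T_def using lt by auto
      ultimately have "T v' (degree (lform e v' G')) \<subset> T v d" by blast
      moreover have "finite (T v d)" unfolding T_def using fin\<Lambda> by (auto intro: finite_subset[OF _ fin\<Lambda>])
      ultimately have "card (T v' (degree (lform e v' G'))) < card (T v (degree (lform e v G)))"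
        unfolding d_def by (intro psubset_card_mono)
      thus ?thesis using less.hyps XG' v' by blast
    qed
  qed
  moreover have "G0 \<noteq> 0"
  proof
    assume "G0 = 0"
    hence "vmin \<le> vmin - 1" using low[OF X0, of "vmin - 1"] by simp
    thus False by simp
  qed
  then obtain v where "wt_le e v G0" "lform e v G0 \<noteq> 0" using ex_weight by blast
  ultimately obtain G' v' where "X G'" "wt_le e v' G'" "lform e v' G' \<noteq> 0"
      "\<forall>s\<in>S. v' = of_nat s * w \<longrightarrow> degree (lform e v' G') \<noteq> s * degree \<rho>" using X0 by blast
  moreover from this have "v' \<le> v0" using bd wt_le_if_lform_nonzero by blast
  ultimately show ?thesis using that by blast
qed

lemma jac_threshold:
  fixes P G :: "'a::field_char_0 fls poly"
  assumes "wt_le e (of_nat A * w) P" "wt_le e v G"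
    and "lform e (of_nat t * w + 1) (jac P G) \<noteq> 0"
  shows "of_nat t * w + 1 \<le> of_nat A * w + v + e"
  using wt_le_jac[OF assms(1,2)] assms(3) wt_le_if_lform_nonzero by blast

text \<open>
  The weight of \<open>jac P G\<close> is at most the sum of the weights involved. Equality yields the inhomogeneous
  Wronskian equation, after the power \<open>\<rho>^(A - 1)\<close> that comes from differentiating \<open>\<rho>^A\<close> is cancelled;
  strict inequality means that the leading forms commute.
\<close>
lemma jac_alternative:
  fixes P G :: "'a::field_char_0 fls poly"
  assumes P: "wt_le e (of_nat A * w) P" "lform e (of_nat A * w) P = smult c (\<rho> ^ A)" "c \<noteq> 0"
    and A: "A \<ge> 1" and deg: "degree \<rho> \<ge> 1"
    and G: "wt_le e v G" "wt_le e (of_nat t * w + 1) (jac P G)"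
      "lform e (of_nat t * w + 1) (jac P G) = smult c2 (\<rho> ^ t)" "c2 \<noteq> 0"
  obtains (solution) N c3 where "c3 \<noteq> 0" "wron w v \<rho> (lform e v G) = smult c3 (\<rho> ^ N)"
      "v + w = of_nat N * w + (1 - e)"
    | (commuting) "wron w v \<rho> (lform e v G) = 0" "of_nat t * w + 1 < of_nat A * w + v + e"
proof -
  define W where "W = wron w v \<rho> (lform e v G)"
  have \<rho>0: "\<rho> \<noteq> 0" using deg by auto
  have "lform e (of_nat A * w + v + e) (jac P G) = wron (of_nat A * w) v (smult c (\<rho> ^ A)) (lform e v G)"
    unfolding lform_jac[OF P(1) G(1)] P(2) ..
  hence L: "lform e (of_nat A * w + v + e) (jac P G) = smult (c * of_nat A) (\<rho> ^ (A - 1) * W)"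
    by (simp add: wron_smult wron_power_left[OF A] W_def)
  have nz: "lform e (of_nat t * w + 1) (jac P G) \<noteq> 0" using G(3,4) \<rho>0 by simp
  consider "of_nat t * w + 1 = of_nat A * w + v + e" | "of_nat t * w + 1 < of_nat A * w + v + e"
    using jac_threshold[OF P(1) G(1) nz] by fastforce
  thus ?thesis
  proof cases
    case 1
    define k where "k = c * of_nat A"
    have k: "k \<noteq> 0" using P(3) A by (simp add: k_def)
    have eq: "smult k (\<rho> ^ (A - 1) * W) = smult c2 (\<rho> ^ t)" using L G(3) 1 by (simp add: k_def)
    have W0: "W \<noteq> 0" using eq G(4) \<rho>0 by auto
    have "degree (smult k (\<rho> ^ (A - 1) * W)) = (A - 1) * degree \<rho> + degree W"
      using k W0 \<rho>0 by (simp add: degree_mult_eq degree_power_eq)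
    moreover have "degree (smult c2 (\<rho> ^ t)) = t * degree \<rho>" using G(4) \<rho>0 by (simp add: degree_power_eq)
    ultimately have "t * degree \<rho> = (A - 1) * degree \<rho> + degree W" using eq by metis
    hence "(A - 1) * degree \<rho> \<le> t * degree \<rho>" by linarith
    hence "A - 1 \<le> t" using deg by simp
    then obtain N where N: "t = A - 1 + N" using le_Suc_ex by blast
    have "\<rho> ^ (A - 1) * smult k W = \<rho> ^ (A - 1) * smult c2 (\<rho> ^ N)"
      using eq by (simp add: N power_add)
    hence "smult k W = smult c2 (\<rho> ^ N)" using \<rho>0 by (subst (asm) mult_left_cancel) auto
    hence "smult (1/k) (smult k W) = smult (1/k) (smult c2 (\<rho> ^ N))" by simp
    hence "W = smult (c2 / k) (\<rho> ^ N)" using k by simp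
    moreover have "t + 1 = A + N" using N A by simp
    hence "of_nat t + 1 = (of_nat A + of_nat N :: rat)" by (metis of_nat_add of_nat_1)
    hence "(of_nat t + 1) * w = (of_nat A + of_nat N) * w" by simp
    hence "v + w = of_nat N * w + (1 - e)" using 1 by (simp add: algebra_simps)
    ultimately show ?thesis using solution[of "c2 / k" N] G(4) k unfolding W_def by simp
  next
    case 2
    have "smult (c * of_nat A) (\<rho> ^ (A - 1) * W) = 0" using L lform_eq_0[OF G(2) 2] by simp
    hence "W = 0" using P(3) A \<rho>0 by simp
    thus ?thesis using commuting 2 unfolding W_def by blast
  qed
qed

lemma frobenius_coin:
  fixes A C s :: nat
  assumes "coprime A C" "A \<ge> 1" "C \<ge> 1" "A * C < s + A + C"
  obtains i j where "s = A * i + C * j"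
proof -
  obtain y where y: "[C * y = 1] (mod A)"
    using cong_solve_coprime_nat[of C A] assms(1) by (auto simp: coprime_commute)
  define x where "x = y * s"
  have x: "[C * x = s] (mod A)" using cong_scalar_right[OF y, of s] by (simp add: x_def mult.assoc)
  define j where "j = x mod A"
  have j: "j < A" "[C * j = s] (mod A)" using x assms(2) by (auto simp: j_def cong_def mod_mult_right_eq)
  have "C * j \<le> C * (A - 1)" using j(1) by (intro mult_le_mono2) linarith
  also have "\<dots> = A * C - C" by (simp add: algebra_simps)
  finally have 1: "C * j < s + A" using assms(2-4) by (simp add: mult.commute)
  have "C * j \<le> s"
  proof (rule ccontr)
    assume "\<not> C * j \<le> s"
    hence lt: "s < C * j" by simp
    hence "A dvd C * j - s" using j(2) by (metis cong_altdef_nat less_imp_le_nat)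
    hence "A \<le> C * j - s" using lt by (intro dvd_imp_le) auto
    thus False using 1 lt by simp
  qed
  moreover from this have "A dvd s - C * j" using j(2) by (metis cong_altdef_nat cong_sym)
  then obtain i where "s - C * j = A * i" by (elim dvdE)
  ultimately have "s = A * i + C * j" by simp
  thus ?thesis using that by blast
qed

section \<open>Combinations of a Jacobian pair\<close>

lemma wt_le_of_nat: "wt_le e 0 (of_nat n :: 'a::comm_ring_1 fls poly)"
  and lform_of_nat: "lform e 0 (of_nat n :: 'a::comm_ring_1 fls poly) = of_nat n"
  by (induction n) (auto intro: wt_le_add wt_le_one simp: lform_one)

lemma
  fixes P Q :: "'a::field_char_0 fls poly"
  assumes P: "wt_le e (of_nat a * w) P" and Q: "wt_le e (of_nat k * w) Q"
  shows wt_le_monomial: "wt_le e (of_nat (a * i + k * j) * w) (P ^ i * Q ^ j)"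
    and lform_monomial: "lform e (of_nat a * w) P = smult cP (\<rho> ^ a) \<Longrightarrow> lform e (of_nat k * w) Q = smult cQ (\<rho> ^ k) \<Longrightarrow>
      lform e (of_nat (a * i + k * j) * w) (P ^ i * Q ^ j) = smult (cP ^ i * cQ ^ j) (\<rho> ^ (a * i + k * j))"
proof -
  have eq: "of_nat (a * i + k * j) * w = of_nat i * (of_nat a * w) + of_nat j * (of_nat k * w)"
    by (simp add: algebra_simps)
  note * = wt_le_power[OF P, of i] wt_le_power[OF Q, of j]
  show "wt_le e (of_nat (a * i + k * j) * w) (P ^ i * Q ^ j)"
    unfolding eq by (rule wt_le_mult[OF *])
  show "lform e (of_nat (a * i + k * j) * w) (P ^ i * Q ^ j) = smult (cP ^ i * cQ ^ j) (\<rho> ^ (a * i + k * j))"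
    if "lform e (of_nat a * w) P = smult cP (\<rho> ^ a)" "lform e (of_nat k * w) Q = smult cQ (\<rho> ^ k)"
    unfolding eq lform_mult[OF *] lform_power[OF P] lform_power[OF Q] that
    by (simp add: smult_power power_add mult.commute flip: power_mult)
qed

lemma jac_monomial: "jac P (P ^ i * Q ^ j) = P ^ i * (of_nat j * Q ^ (j - 1) * jac P Q)"
  for P Q :: "'a::idom fls poly"
  by (simp add: jac_mult_right jac_power_right[of P Q])

lemma wt_le_jac_monomial:
  fixes P Q :: "'a::field_char_0 fls poly"
  assumes "wt_le e (of_nat a * w) P" "wt_le e (of_nat k * w) Q" "keller P Q c"
  shows "wt_le e (of_nat (a * i + k * (j - 1)) * w + 1) (jac P (P ^ i * Q ^ j))"
proof -
  have eq: "of_nat (a * i + k * (j - 1)) * w + 1 = 0 + (of_nat (a * i + k * (j - 1)) * w) + (1::rat)" by simp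
  have "jac P (P ^ i * Q ^ j) = of_nat j * (P ^ i * Q ^ (j - 1)) * jac P Q"
    unfolding jac_monomial by (simp add: mult_ac)
  thus ?thesis unfolding eq assms(3)
    using wt_le_mult[OF wt_le_mult[OF wt_le_of_nat wt_le_monomial[OF assms(1,2)]] wt_le_const_x] by metis
qed

text \<open>
  The combinations are of the form \<open>Q^A - \<Sum> c P\<^sup>i Q\<^sup>j\<close>. The correction terms do not change the leading form
  of \<open>jac P G\<close>, which stays that of \<open>A Q^(A - 1) jac P Q\<close>. The factor \<open>\<delta>\<close> allows for leading forms
  \<open>\<rho>^(\<delta> A)\<close> and \<open>\<rho>^(\<delta> C)\<close> with exponents that are not coprime; then only multiples of \<open>\<delta>\<close> can be removed.
  The last property holds for all directions at once, since it only depends on the shape of \<open>G\<close>.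
\<close>
lemma ex_reduced_combination:
  fixes P Q :: "'a::field_char_0 fls poly"
  assumes keller: "keller P Q c" "c \<noteq> 0"
    and AC: "coprime A C" "A \<ge> 1" "C \<ge> 1" and \<delta>: "\<delta> \<ge> 1"
    and P: "wt_le e (of_nat (\<delta> * A) * w) P" "lform e (of_nat (\<delta> * A) * w) P = smult cP (\<rho> ^ (\<delta> * A))" "cP \<noteq> 0"
    and Q: "wt_le e (of_nat (\<delta> * C) * w) Q" "lform e (of_nat (\<delta> * C) * w) Q = smult cQ (\<rho> ^ (\<delta> * C))" "cQ \<noteq> 0"
    and deg: "degree \<rho> \<ge> 1" and w: "w > 0" and e: "e < 1"
  obtains G v c2 where "wt_le e v G" "lform e v G \<noteq> 0"
    "wt_le e (of_nat (\<delta> * C * (A - 1)) * w + 1) (jac P G)"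
    "lform e (of_nat (\<delta> * C * (A - 1)) * w + 1) (jac P G) = smult c2 (\<rho> ^ (\<delta> * C * (A - 1)))" "c2 \<noteq> 0"
    "v \<le> of_nat (\<delta> * (A * C)) * w"
    "\<And>s. v = of_nat (\<delta> * s) * w \<Longrightarrow> degree (lform e v G) \<noteq> \<delta> * s * degree \<rho>"
    "\<And>e1 w1. w1 > 0 \<Longrightarrow> wt_le e1 (of_nat (\<delta> * A) * w1) P \<Longrightarrow> wt_le e1 (of_nat (\<delta> * C) * w1) Q \<Longrightarrow>
      wt_le e1 (of_nat (\<delta> * C * (A - 1)) * w1 + 1) (jac P G)"
proof -
  define t where "t = \<delta> * C * (A - 1)"
  define v0 where "v0 = of_nat (\<delta> * (A * C)) * w"
  define D where "D = degree P * C + degree Q * A"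
  define c2 where "c2 = of_nat A * cQ ^ (A - 1) * c"
  have \<rho>0: "\<rho> \<noteq> 0" using deg by auto
  have c2: "c2 \<noteq> 0" using AC Q(3) keller(2) by (simp add: c2_def)
  have A1: "of_nat (A - 1) = of_nat A - (1::rat)" using AC(2) by (simp add: of_nat_diff)
  define Y where "Y G \<longleftrightarrow> (\<forall>e1 w1. w1 > 0 \<longrightarrow> wt_le e1 (of_nat (\<delta> * A) * w1) P \<longrightarrow> wt_le e1 (of_nat (\<delta> * C) * w1) Q \<longrightarrow>
      wt_le e1 (of_nat t * w1 + 1) (jac P G))" for G
  define X where "X G \<longleftrightarrow> degree G \<le> D \<and> wt_le e v0 G \<and> lform e (of_nat t * w + 1) (jac P G) = smult c2 (\<rho> ^ t) \<and> Y G" for G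
  have degmon: "degree (P ^ i * Q ^ j) \<le> D" if "i \<le> C" "j \<le> A" for i j
  proof -
    have "degree (P ^ i * Q ^ j) \<le> degree P * i + degree Q * j"
      using degree_mult_le[of "P ^ i" "Q ^ j"] degree_power_le[of P i] degree_power_le[of Q j] by linarith
    also have "\<dots> \<le> D" unfolding D_def using that by (intro add_mono mult_le_mono2)
    finally show ?thesis .
  qed
  have Ymon: "Y (P ^ i * Q ^ j)" if "j = 0 \<or> A * i + C * j \<le> A * C" for i j
    unfolding Y_def
  proof (intro allI impI)
    fix e1 w1 assume *: "w1 > 0" "wt_le e1 (of_nat (\<delta> * A) * w1) P" "wt_le e1 (of_nat (\<delta> * C) * w1) Q"
    show "wt_le e1 (of_nat t * w1 + 1) (jac P (P ^ i * Q ^ j))"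
    proof (cases "j = 0")
      case False
      hence j: "C * j = C * (j - 1) + C" by (cases j) auto
      moreover have "A * C = C * (A - 1) + C" using AC(2) by (cases A) (auto simp: algebra_simps)
      ultimately have "A * i + C * (j - 1) \<le> C * (A - 1)" using that False by simp
      hence "\<delta> * A * i + \<delta> * C * (j - 1) \<le> t" unfolding t_def
        using mult_le_mono2[of "A * i + C * (j - 1)" "C * (A - 1)" \<delta>] by (simp add: algebra_simps)
      hence "of_nat (\<delta> * A * i + \<delta> * C * (j - 1)) * w1 + 1 \<le> of_nat t * w1 + 1"
        using *(1) by (intro add_right_mono mult_right_mono) (simp_all only: of_nat_le_iff less_imp_le)
      thus ?thesis using wt_le_jac_monomial[OF *(2,3) keller(1)] wt_le_mono by blast
    qed simp
  qed
  have lmon: "lform e (of_nat t * w + 1) (jac P (P ^ i * Q ^ j)) = 0" if "j = 0 \<or> A * i + C * j < A * C" for i j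
  proof (cases "j = 0")
    case False
    hence j: "C * j = C * (j - 1) + C" by (cases j) auto
    moreover have "A * C = C * (A - 1) + C" using AC(2) by (cases A) (auto simp: algebra_simps)
    ultimately have "A * i + C * (j - 1) < C * (A - 1)" using that False by simp
    hence "\<delta> * A * i + \<delta> * C * (j - 1) < t" unfolding t_def
      using mult_less_mono2[of "A * i + C * (j - 1)" "C * (A - 1)" \<delta>] \<delta> by (simp add: algebra_simps)
    hence "of_nat (\<delta> * A * i + \<delta> * C * (j - 1)) * w + 1 < of_nat t * w + 1"
      using w by (intro add_strict_right_mono mult_strict_right_mono) (simp_all only: of_nat_less_iff)
    thus ?thesis using wt_le_jac_monomial[OF P(1) Q(1) keller(1)] lform_eq_0 by blast
  qed simp
  have "X (Q ^ A)"
    unfolding X_def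
  proof (intro conjI)
    show "degree (Q ^ A) \<le> D" using degmon[of 0 A] by simp
    show "wt_le e v0 (Q ^ A)" unfolding v0_def
      using wt_le_monomial[OF P(1) Q(1), of 0 A] by (simp add: mult_ac)
    have "lform e (0 + of_nat t * w + 1) (of_nat A * Q ^ (A - 1) * jac P Q) = of_nat A * smult (cQ ^ (A - 1)) (\<rho> ^ t) * [:c:]"
      unfolding keller(1)
    proof (subst lform_mult)
      show 1: "wt_le e (0 + of_nat t * w) (of_nat A * Q ^ (A - 1))"
        using wt_le_mult[OF wt_le_of_nat wt_le_monomial[OF P(1) Q(1), of 0 "A - 1"]] by (simp add: t_def)
      show "wt_le e 1 [:fls_const c * fls_X_inv:]" by (rule wt_le_const_x)
      have "lform e (0 + of_nat t * w) (of_nat A * (P ^ 0 * Q ^ (A - 1))) = of_nat A * smult (cP ^ 0 * cQ ^ (A - 1)) (\<rho> ^ t)"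
        using lform_mult[OF wt_le_of_nat wt_le_monomial[OF P(1) Q(1), of 0 "A - 1"], of A]
          lform_monomial[OF P(1) Q(1) P(2) Q(2), of 0 "A - 1"] by (simp add: t_def lform_of_nat)
      thus "lform e (0 + of_nat t * w) (of_nat A * Q ^ (A - 1)) * lform e 1 [:fls_const c * fls_X_inv:] =
          of_nat A * smult (cQ ^ (A - 1)) (\<rho> ^ t) * [:c:]"
        by (simp add: lform_const_x)
    qed
    also have "of_nat A * smult (cQ ^ (A - 1)) (\<rho> ^ t) * [:c:] = smult c2 (\<rho> ^ t)"
      by (simp add: c2_def of_nat_poly mult_ac)
    finally show "lform e (of_nat t * w + 1) (jac P (Q ^ A)) = smult c2 (\<rho> ^ t)"
      by (simp add: jac_power_right)
    show "Y (Q ^ A)" using Ymon[of A 0] by (simp add: mult.commute)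
  qed
  have c2\<rho>: "smult c2 (\<rho> ^ t) \<noteq> 0" using c2 \<rho>0 by simp
  define S where "S = {\<delta> * s |s. A * C < s + A + C}"
  define good where "good s M \<longleftrightarrow> degree M \<le> D \<and> wt_le e (of_nat s * w) M \<and>
      (\<exists>\<kappa>. \<kappa> \<noteq> 0 \<and> lform e (of_nat s * w) M = smult \<kappa> (\<rho> ^ s)) \<and>
      lform e (of_nat t * w + 1) (jac P M) = 0 \<and> Y M" for s M
  have ex: "\<exists>M. good s M" if "s \<in> S" "of_nat s * w \<le> v0" for s
  proof -
    obtain s' where s': "s = \<delta> * s'" "A * C < s' + A + C" using \<open>s \<in> S\<close> unfolding S_def by auto
    have "of_nat s \<le> (of_nat (\<delta> * (A * C)) :: rat)" using that(2) w unfolding v0_def by simp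
    hence le: "s' \<le> A * C" unfolding s'(1) using \<delta> by (simp only: of_nat_le_iff) simp
    have "\<exists>i j. s' = A * i + C * j \<and> (j = 0 \<or> s' < A * C)"
    proof (cases "s' = A * C")
      case True
      thus ?thesis by (intro exI[of _ C] exI[of _ 0]) simp
    next
      case False
      obtain i j where "s' = A * i + C * j" using frobenius_coin[OF AC s'(2)] .
      thus ?thesis using False le by auto
    qed
    then obtain i j where ij: "s' = A * i + C * j" "j = 0 \<or> A * i + C * j < A * C" by blast
    have "A * i \<le> A * C" "C * j \<le> C * A"
      using ij(1) le mult.commute[of A C] by linarith+
    hence ij_le: "i \<le> C" "j \<le> A" using AC by simp_all
    have s: "s = \<delta> * A * i + \<delta> * C * j" by (simp add: s'(1) ij(1) algebra_simps)
    have "cP ^ i * cQ ^ j \<noteq> 0" using P(3) Q(3) by simp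
    hence "good s (P ^ i * Q ^ j)" unfolding good_def
    proof (intro conjI exI[of _ "cP ^ i * cQ ^ j"])
      show "wt_le e (of_nat s * w) (P ^ i * Q ^ j)" unfolding s by (rule wt_le_monomial[OF P(1) Q(1)])
      show "lform e (of_nat s * w) (P ^ i * Q ^ j) = smult (cP ^ i * cQ ^ j) (\<rho> ^ s)"
        unfolding s by (rule lform_monomial[OF P(1) Q(1) P(2) Q(2)])
      show "Y (P ^ i * Q ^ j)" using Ymon ij(2) by (auto simp: less_imp_le)
    qed (use degmon[OF ij_le] lmon[OF ij(2)] in auto)
    thus ?thesis by blast
  qed
  define M where "M s = (SOME M. good s M)" for s
  have M: "good s (M s)" if "s \<in> S" "of_nat s * w \<le> v0" for s
    unfolding M_def using ex[OF that] by (rule someI_ex)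
  have low: "of_nat t * w + 1 - e - of_nat (\<delta> * A) * w \<le> v" if "X G" "wt_le e v G" for G v
    using jac_threshold[OF P(1) that(2), of t] that(1) c2\<rho> unfolding X_def by simp
  obtain G v where G: "X G" "wt_le e v G" "lform e v G \<noteq> 0" "v \<le> v0"
    "\<And>s. s \<in> S \<Longrightarrow> v = of_nat s * w \<Longrightarrow> degree (lform e v G) \<noteq> s * degree \<rho>"
  proof (rule greedy[where X = X and e = e and w = w and S = S and M = M and \<rho> = \<rho> and ?v0.0 = v0 and D = D])
    show "X (Q ^ A)" by fact
    show "degree G \<le> D \<and> wt_le e v0 G" if "X G" for G using that by (simp add: X_def)
    show "of_nat t * w + 1 - e - of_nat (\<delta> * A) * w \<le> v" if "X G" "wt_le e v G" for G v using low that .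
    show "\<rho> \<noteq> 0" by fact
    fix s assume s: "s \<in> S" "of_nat s * w \<le> v0"
    note Ms = M[OF s, unfolded good_def]
    show "wt_le e (of_nat s * w) (M s) \<and> (\<exists>\<kappa>. \<kappa> \<noteq> 0 \<and> lform e (of_nat s * w) (M s) = smult \<kappa> (\<rho> ^ s))"
      using Ms by blast
    fix c G assume "X G"
    thus "X (G - smult (fls_const c) (M s))"
      using Ms wt_le_mono[OF _ s(2)] unfolding X_def Y_def jac_diff_right jac_smult_right
      by (auto intro!: wt_le_diff wt_le_smult degree_diff_le intro: order_trans[OF degree_smult_le])
  qed (rule that)
  show ?thesis
  proof (rule that[of v G c2])
    show "wt_le e v G" "lform e v G \<noteq> 0" "c2 \<noteq> 0" by fact+
    show "lform e (of_nat (\<delta> * C * (A - 1)) * w + 1) (jac P G) = smult c2 (\<rho> ^ (\<delta> * C * (A - 1)))"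
      using G(1) by (simp add: X_def t_def)
    show 8: "wt_le e1 (of_nat (\<delta> * C * (A - 1)) * w1 + 1) (jac P G)"
      if "w1 > 0" "wt_le e1 (of_nat (\<delta> * A) * w1) P" "wt_le e1 (of_nat (\<delta> * C) * w1) Q" for e1 w1
      using that G(1) unfolding X_def Y_def t_def by blast
    show "wt_le e (of_nat (\<delta> * C * (A - 1)) * w + 1) (jac P G)" using 8[OF w P(1) Q(1)] .
    show "v \<le> of_nat (\<delta> * (A * C)) * w" using G(4) by (simp add: v0_def)
    fix s assume v: "v = of_nat (\<delta> * s) * w"
    have "of_nat t * w + 1 - e - of_nat (\<delta> * A) * w \<le> of_nat (\<delta> * s) * w" using low[OF G(1,2)] v by simp
    hence "of_nat t * w < of_nat (\<delta> * s) * w + of_nat (\<delta> * A) * w" using e by linarith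
    hence "of_nat t * w < of_nat (\<delta> * s + \<delta> * A) * w" by (simp add: algebra_simps)
    hence "t < \<delta> * s + \<delta> * A" using w by (simp only: mult_less_cancel_right_pos of_nat_less_iff)
    hence "\<delta> * (C * (A - 1)) < \<delta> * (s + A)" by (simp add: t_def algebra_simps)
    hence "C * (A - 1) < s + A" by simp
    moreover have "A * C = C * (A - 1) + C" using AC(2) by (cases A) (auto simp: algebra_simps)
    ultimately have "\<delta> * s \<in> S" unfolding S_def by auto
    thus "degree (lform e v G) \<noteq> \<delta> * s * degree \<rho>" using G(5) v by blast
  qed
qed

section \<open>Leading forms along an edge\<close>

text \<open>
  The top term of the leading form of \<open>G\<close> sits at a lattice point on the ray through the primitive
  lattice point \<open>(a, b)\<close>, hence at an integral multiple of it.
\<close>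
lemma parallel_to_primitive:
  fixes a :: int and b :: nat and w :: rat
  assumes "lform e v G \<noteq> 0" "w * of_nat (degree (lform e v G)) = v * of_nat b"
    and "of_int a = w + e * of_nat b" "coprime a (int b)" "b \<ge> 1"
  obtains s where "degree (lform e v G) = s * b" "v = of_nat s * w"
proof -
  define j where "j = degree (lform e v G)"
  have "coeff (lform e v G) j \<noteq> 0" using assms(1) by (simp add: j_def)
  then obtain i where i: "of_int i = v + e * of_nat j" by (metis coeff_lform_nonzero)
  have "of_int (i * int b) = (v + e * of_nat j) * of_nat b" by (simp add: i)
  also have "\<dots> = of_int a * of_nat j" using assms(2) by (simp add: assms(3) j_def algebra_simps)
  also have "\<dots> = of_int (a * int j)" by simp
  finally have "i * int b = a * int j" by (simp only: of_int_eq_iff)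
  hence "int b dvd a * int j" by (metis dvd_triv_right)
  hence "int b dvd int j" using assms(4) by (simp add: coprime_commute coprime_dvd_mult_right_iff)
  hence "b dvd j" by simp
  then obtain s where s: "j = s * b" by (metis dvdE mult.commute)
  have "v * of_nat b = of_nat s * w * of_nat b" using assms(2) by (auto simp: s mult_ac simp flip: j_def)
  hence "v = of_nat s * w" using assms(5) by (subst (asm) mult_cancel_right) auto
  thus ?thesis using that[of s] s by (simp add: j_def)
qed

text \<open>
  If the leading forms are \<open>\<rho>^(2 A)\<close> and \<open>\<rho>^(2 C)\<close>, the first reduction may stop at a \<open>G\<close> with leading
  form \<open>\<rho>\<^sup>s\<close> for an odd \<open>s\<close>. Then \<open>2 A\<close>, \<open>2 C\<close> and \<open>s\<close> together generate all large integers, and a second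
  reduction, of \<open>G\<^sup>2\<close> by monomials \<open>P\<^sup>i Q\<^sup>j\<close> and \<open>P\<^sup>i Q\<^sup>j G\<close>, can stop only with noncommuting leading forms.
\<close>
lemma square_edge_one_root:
  fixes P Q :: "'a::{alg_closed_field,field_char_0} fls poly"
  assumes keller: "keller P Q c"
    and AC: "coprime A C" "A \<ge> 1" "C \<ge> 1"
    and P: "wt_le e (of_nat (2 * A) * w) P" "lform e (of_nat (2 * A) * w) P = smult cP (\<rho> ^ (2 * A))" "cP \<noteq> 0"
    and Q: "wt_le e (of_nat (2 * C) * w) Q" "lform e (of_nat (2 * C) * w) Q = smult cQ (\<rho> ^ (2 * C))" "cQ \<noteq> 0"
    and deg: "degree \<rho> \<ge> 1" and w: "w > 0" and e: "e < 1"
    and prim: "of_int a = w + e * of_nat (degree \<rho>)" "coprime a (int (degree \<rho>))"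
    and G: "wt_le e (of_nat s * w) G" "lform e (of_nat s * w) G = smult cG (\<rho> ^ s)" "cG \<noteq> 0"
    and s: "odd s" "s \<le> 2 * (A * C)"
    and t: "t = 2 * C * (A - 1)"
    and J: "wt_le e (of_nat t * w + 1) (jac P G)" "lform e (of_nat t * w + 1) (jac P G) = smult c2 (\<rho> ^ t)" "c2 \<noteq> 0"
  shows "card (roots \<rho>) \<le> 1"
proof -
  define t2 where "t2 = s + t"
  define v0 where "v0 = of_nat (2 * s) * w"
  define D where "D = degree P * s + degree Q * s + degree G * 2"
  define c4 where "c4 = 2 * cG * c2"
  have \<rho>0: "\<rho> \<noteq> 0" using deg by auto
  have c4: "c4 \<noteq> 0" using G(3) J(3) by (simp add: c4_def)
  have AC1: "2 * (A * C) = t + 2 * C" using AC(2) unfolding t by (cases A) (auto simp: algebra_simps)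
  have s_lt: "s < 2 * (A * C)" using s by (metis dvd_triv_left le_neq_implies_less)
  have AC2: "A + C \<le> A * C + 1" using AC(2,3) by (cases A; cases C) (auto simp: algebra_simps)
  define X where "X H \<longleftrightarrow> degree H \<le> D \<and> wt_le e v0 H \<and> wt_le e (of_nat t2 * w + 1) (jac P H) \<and>
    lform e (of_nat t2 * w + 1) (jac P H) = smult c4 (\<rho> ^ t2)" for H
  have t2eq: "of_nat t2 * w + 1 = of_nat s * w + (of_nat t * w + 1)" by (simp add: t2_def algebra_simps)
  have XG: "X (G ^ 2)"
    unfolding X_def
  proof (intro conjI)
    show "degree (G ^ 2) \<le> D" using degree_power_le[of G 2] by (simp add: D_def)
    show "wt_le e v0 (G ^ 2)" unfolding v0_def using wt_le_power[OF G(1), of 2] by (simp add: algebra_simps)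
    have jG: "jac P (G ^ 2) = G * jac P G + G * jac P G"
      by (simp add: jac_mult_right power2_eq_square mult.commute)
    show "wt_le e (of_nat t2 * w + 1) (jac P (G ^ 2))"
      unfolding jG t2eq by (intro wt_le_add wt_le_mult G J)
    have "lform e (of_nat t2 * w + 1) (jac P (G ^ 2)) = smult (cG * c2) (\<rho> ^ t2) + smult (cG * c2) (\<rho> ^ t2)"
      unfolding jG t2eq lform_simps lform_mult[OF G(1) J(1)] unfolding G(2) J(2) by (simp add: t2_def power_add mult.commute)
    also have "\<dots> = smult c4 (\<rho> ^ t2)" by (simp add: c4_def mult_ac flip: smult_add_left)
    finally show "lform e (of_nat t2 * w + 1) (jac P (G ^ 2)) = smult c4 (\<rho> ^ t2)" .
  qed
  \<comment> \<open>the exponents that are not excluded by the weight of the Jacobian\<close>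
  define S where "S = {s'. s + t < s' + 2 * A}"
  define good where "good s' M \<longleftrightarrow> degree M \<le> D \<and> wt_le e (of_nat s' * w) M \<and>
      (\<exists>\<kappa>. \<kappa> \<noteq> 0 \<and> lform e (of_nat s' * w) M = smult \<kappa> (\<rho> ^ s')) \<and>
      (\<exists>u < of_nat t2 * w + 1. wt_le e u (jac P M))" for s' M
  have degmon: "degree (P ^ i * Q ^ j) \<le> degree P * s + degree Q * s" if "i \<le> s" "j \<le> s" for i j
  proof -
    have "degree (P ^ i * Q ^ j) \<le> degree P * i + degree Q * j"
      using degree_mult_le[of "P ^ i" "Q ^ j"] degree_power_le[of P i] degree_power_le[of Q j] by linarith
    also have "\<dots> \<le> degree P * s + degree Q * s" using that by (intro add_mono mult_le_mono2)
    finally show ?thesis .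
  qed
  have mono: "of_nat x * w + 1 < of_nat y * w + 1" if "x < y" for x y :: nat
    using that w by (intro add_strict_right_mono mult_strict_right_mono) simp_all
  have ex: "\<exists>M. good s' M" if "s' \<in> S" "of_nat s' * w \<le> v0" for s'
  proof -
    have S: "s + 2 * (A * C) < s' + 2 * A + 2 * C" using that(1) AC1 by (simp add: S_def)
    have le: "s' \<le> 2 * s" using that(2) w unfolding v0_def by (simp only: mult_le_cancel_right_pos of_nat_le_iff)
    show ?thesis
    proof (cases "even s'")
      case True
      then obtain h where h: "s' = 2 * h" by (elim evenE)
      have "A * C < h + A + C" using S unfolding h by linarith
      then obtain i j where ij: "h = A * i + C * j" using frobenius_coin[OF AC] by blast
      have s'eq: "s' = 2 * A * i + 2 * C * j" by (simp add: h ij algebra_simps)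
      have "1 * i \<le> A * i" "1 * j \<le> C * j" using AC by (intro mult_le_mono1; simp)+
      hence "i \<le> s" "j \<le> s" using le h ij by linarith+
      have "\<exists>u < of_nat t2 * w + 1. wt_le e u (jac P (P ^ i * Q ^ j))"
      proof (cases "j = 0")
        case True
        thus ?thesis by (intro exI[of _ "of_nat t2 * w"]) simp
      next
        case False
        hence "C * j = C * (j - 1) + C" by (cases j) auto
        hence "2 * A * i + 2 * C * (j - 1) < t2" using s'eq le s_lt AC1 unfolding t2_def by simp
        thus ?thesis using wt_le_jac_monomial[OF P(1) Q(1) keller(1), of i j] mono by blast
      qed
      hence "good s' (P ^ i * Q ^ j)" unfolding good_def
        using degmon[OF \<open>i \<le> s\<close> \<open>j \<le> s\<close>] wt_le_monomial[OF P(1) Q(1), of i j] lform_monomial[OF P(1) Q(1) P(2) Q(2), of i j] P(3) Q(3)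
        unfolding s'eq D_def by (intro conjI exI[of _ "cP ^ i * cQ ^ j"]) auto
      thus ?thesis by blast
    next
      case False
      have "s \<le> s'"
      proof (rule ccontr)
        assume "\<not> s \<le> s'"
        moreover have "s' \<noteq> s - 1" using False s(1) by presburger
        ultimately have "s' + 2 \<le> s" by simp
        thus False using S AC2 by linarith
      qed
      moreover have "even (s' - s)" using False s(1) by simp
      ultimately obtain h where h: "s' = s + 2 * h" by (metis evenE le_add_diff_inverse)
      have "A * C < h + A + C" using S unfolding h by linarith
      then obtain i j where ij: "h = A * i + C * j" using frobenius_coin[OF AC] by blast
      have heq: "2 * h = 2 * A * i + 2 * C * j" by (simp add: ij algebra_simps)
      have s'eq: "s' = (2 * A * i + 2 * C * j) + s" using h heq by simp
      have "s' \<noteq> 2 * s" using False by auto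
      hence lt: "2 * h < s" using le h by simp
      have "1 * i \<le> A * i" "1 * j \<le> C * j" using AC by (intro mult_le_mono1; simp)+
      hence "i \<le> s" "j \<le> s" using lt ij by linarith+
      define M where "M = P ^ i * Q ^ j * G"
      have wM: "wt_le e (of_nat (2 * A * i + 2 * C * j) * w + of_nat s * w) M"
        unfolding M_def by (intro wt_le_mult wt_le_monomial P Q G)
      have lM: "lform e (of_nat (2 * A * i + 2 * C * j) * w + of_nat s * w) M = smult (cP ^ i * cQ ^ j * cG) (\<rho> ^ s')"
        unfolding M_def lform_mult[OF wt_le_monomial[OF P(1) Q(1)] G(1)] lform_monomial[OF P(1) Q(1) P(2) Q(2)] G(2)
        by (simp only: s'eq power_add mult_smult_left mult_smult_right smult_smult mult_ac)
      have eq: "of_nat (2 * A * i + 2 * C * j) * w + of_nat s * w = of_nat s' * w"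
        unfolding h heq by (simp add: algebra_simps)
      have j1: "\<exists>u < of_nat t2 * w + 1. wt_le e u (P ^ i * Q ^ j * jac P G)"
      proof (intro exI conjI)
        show "wt_le e (of_nat (2 * A * i + 2 * C * j) * w + (of_nat t * w + 1)) (P ^ i * Q ^ j * jac P G)"
          by (intro wt_le_mult wt_le_monomial P Q J)
        have "of_nat (2 * h) * w + (of_nat t * w + 1) = of_nat (2 * h + t) * w + 1" by (simp add: algebra_simps)
        also have "\<dots> < of_nat t2 * w + 1" using lt by (intro mono) (simp add: t2_def)
        finally show "of_nat (2 * A * i + 2 * C * j) * w + (of_nat t * w + 1) < of_nat t2 * w + 1" by (simp only: heq)
      qed
      have j2: "\<exists>u < of_nat t2 * w + 1. wt_le e u (jac P (P ^ i * Q ^ j) * G)"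
      proof (cases "j = 0")
        case True
        thus ?thesis by (intro exI[of _ "of_nat t2 * w"]) simp
      next
        case False
        hence "C * j = C * (j - 1) + C" by (cases j) auto
        hence lt2: "2 * A * i + 2 * C * (j - 1) + s < t2" using heq lt s_lt AC1 unfolding t2_def by simp
        have "wt_le e (of_nat (2 * A * i + 2 * C * (j - 1)) * w + 1 + of_nat s * w) (jac P (P ^ i * Q ^ j) * G)"
          by (intro wt_le_mult wt_le_jac_monomial[OF P(1) Q(1) keller(1)] G)
        moreover have "of_nat (2 * A * i + 2 * C * (j - 1)) * w + 1 + of_nat s * w = of_nat (2 * A * i + 2 * C * (j - 1) + s) * w + 1"
          by (simp add: algebra_simps)
        ultimately show ?thesis using mono[OF lt2] by metis
      qed
      have "\<exists>u < of_nat t2 * w + 1. wt_le e u (jac P M)"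
      proof -
        obtain u1 u2 where u: "u1 < of_nat t2 * w + 1" "wt_le e u1 (P ^ i * Q ^ j * jac P G)"
          "u2 < of_nat t2 * w + 1" "wt_le e u2 (jac P (P ^ i * Q ^ j) * G)" using j1 j2 by blast
        have "wt_le e (max u1 u2) (jac P M)" unfolding M_def jac_mult_right[of P "P ^ i * Q ^ j" G]
          using u by (intro wt_le_add) (auto intro: wt_le_mono)
        thus ?thesis using u by (intro exI[of _ "max u1 u2"]) auto
      qed
      moreover have "degree M \<le> D" unfolding M_def D_def
        using degmon[OF \<open>i \<le> s\<close> \<open>j \<le> s\<close>] degree_mult_le[of "P ^ i * Q ^ j" G] by linarith
      ultimately have "good s' M" unfolding good_def using wM lM P(3) Q(3) G(3) unfolding eq
        by (intro conjI exI[of _ "cP ^ i * cQ ^ j * cG"]) auto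
      thus ?thesis by blast
    qed
  qed
  define M where "M s' = (SOME M. good s' M)" for s'
  have M: "good s' (M s')" if "s' \<in> S" "of_nat s' * w \<le> v0" for s'
    unfolding M_def using ex[OF that] by (rule someI_ex)
  have low: "of_nat t2 * w + 1 - e - of_nat (2 * A) * w \<le> v" if "X H" "wt_le e v H" for H v
    using jac_threshold[OF P(1) that(2), of t2] that(1) c4 \<rho>0 unfolding X_def by simp
  obtain H v where H: "X H" "wt_le e v H" "lform e v H \<noteq> 0" "v \<le> v0"
    "\<And>s'. s' \<in> S \<Longrightarrow> v = of_nat s' * w \<Longrightarrow> degree (lform e v H) \<noteq> s' * degree \<rho>"
  proof (rule greedy[where X = X and e = e and w = w and S = S and M = M and \<rho> = \<rho> and ?v0.0 = v0 and D = D])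
    show "X (G ^ 2)" by fact
    show "degree G \<le> D \<and> wt_le e v0 G" if "X G" for G using that by (simp add: X_def)
    show "of_nat t2 * w + 1 - e - of_nat (2 * A) * w \<le> v" if "X H" "wt_le e v H" for H v using low that .
    show "\<rho> \<noteq> 0" by fact
    fix s' assume s': "s' \<in> S" "of_nat s' * w \<le> v0"
    note Ms = M[OF s', unfolded good_def]
    show "wt_le e (of_nat s' * w) (M s') \<and> (\<exists>\<kappa>. \<kappa> \<noteq> 0 \<and> lform e (of_nat s' * w) (M s') = smult \<kappa> (\<rho> ^ s'))"
      using Ms by blast
    obtain u where u: "u < of_nat t2 * w + 1" "wt_le e u (jac P (M s'))" using Ms by blast
    fix c H assume "X H"
    thus "X (H - smult (fls_const c) (M s'))"
      using Ms wt_le_mono[OF _ s'(2)] wt_le_mono[OF u(2) less_imp_le[OF u(1)]] lform_eq_0[OF u(2,1)]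
      unfolding X_def jac_diff_right jac_smult_right
      by (auto intro!: wt_le_diff wt_le_smult degree_diff_le intro: order_trans[OF degree_smult_le])
  qed (rule that)
  have contra: False if top: "w * of_nat (degree (lform e v H)) = v * of_nat (degree \<rho>)"
  proof -
    obtain s' where s': "degree (lform e v H) = s' * degree \<rho>" "v = of_nat s' * w"
      using parallel_to_primitive[OF H(3) top prim deg] .
    have "of_nat t2 * w + 1 - e - of_nat (2 * A) * w \<le> of_nat s' * w" using low[OF H(1,2)] s'(2) by simp
    hence "of_nat t2 * w < of_nat s' * w + of_nat (2 * A) * w" using e by linarith
    hence "of_nat t2 * w < of_nat (s' + 2 * A) * w" by (simp add: algebra_simps)
    hence "t2 < s' + 2 * A" using w by (simp only: mult_less_cancel_right_pos of_nat_less_iff)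
    thus False using H(5) s' by (auto simp: S_def t2_def)
  qed
  have J2: "wt_le e (of_nat t2 * w + 1) (jac P H)" "lform e (of_nat t2 * w + 1) (jac P H) = smult c4 (\<rho> ^ t2)"
    using H(1) by (auto simp: X_def)
  have A2: "2 * A \<ge> 1" using AC by simp
  show ?thesis
  proof (rule jac_alternative[OF P A2 deg H(2) J2 c4])
    fix N c3 assume *: "c3 \<noteq> 0" "wron w v \<rho> (lform e v H) = smult c3 (\<rho> ^ N)" "v + w = of_nat N * w + (1 - e)"
    show ?thesis
      using one_root_solution[OF \<rho>0 H(3) *(2,1) w _ *(3)] contra e by auto
  next
    assume "wron w v \<rho> (lform e v H) = 0"
    thus ?thesis using contra degree_commuting[OF \<rho>0 H(3)] by blast
  qed
qed

text \<open>
  At a primitive vertex \<open>(a, b)\<close> all leading terms commuting with \<open>\<rho>\<close> are integral powers of it. Either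
  these can be removed until the leading terms fail to commute, or the solution \<open>g\<close> has an integral
  weight ratio; in both cases \<open>one_root_solution\<close> applies. For \<open>\<delta> = 2\<close> an odd power of \<open>\<rho>\<close> may remain,
  which \<open>square_edge_one_root\<close> treats.
\<close>
lemma primitive_edge_one_root:
  fixes P Q :: "'a::{alg_closed_field,field_char_0} fls poly"
  assumes keller: "keller P Q c" "c \<noteq> 0"
    and AC: "coprime A C" "A \<ge> 1" "C \<ge> 1" and \<delta>: "\<delta> = 1 \<or> \<delta> = 2"
    and P: "wt_le e (of_nat (\<delta> * A) * w) P" "lform e (of_nat (\<delta> * A) * w) P = smult cP (\<rho> ^ (\<delta> * A))" "cP \<noteq> 0"
    and Q: "wt_le e (of_nat (\<delta> * C) * w) Q" "lform e (of_nat (\<delta> * C) * w) Q = smult cQ (\<rho> ^ (\<delta> * C))" "cQ \<noteq> 0"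
    and deg: "degree \<rho> \<ge> 1" and w: "w > 0" and e: "e < 1"
    and prim: "of_int a = w + e * of_nat (degree \<rho>)" "coprime a (int (degree \<rho>))"
  shows "card (roots \<rho>) \<le> 1"
proof -
  have \<rho>0: "\<rho> \<noteq> 0" using deg by auto
  have \<delta>1: "\<delta> \<ge> 1" "\<delta> * A \<ge> 1" using \<delta> AC by auto
  obtain G v c2 where G: "wt_le e v G" "lform e v G \<noteq> 0"
    "wt_le e (of_nat (\<delta> * C * (A - 1)) * w + 1) (jac P G)"
    "lform e (of_nat (\<delta> * C * (A - 1)) * w + 1) (jac P G) = smult c2 (\<rho> ^ (\<delta> * C * (A - 1)))" "c2 \<noteq> 0"
    "v \<le> of_nat (\<delta> * (A * C)) * w"
    "\<And>s. v = of_nat (\<delta> * s) * w \<Longrightarrow> degree (lform e v G) \<noteq> \<delta> * s * degree \<rho>"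
    by (rule ex_reduced_combination[OF keller AC \<delta>1(1) P Q deg w e]) blast
  show ?thesis
  proof (rule jac_alternative[OF P \<delta>1(2) deg G(1,3,4,5)])
    fix N c3 assume *: "c3 \<noteq> 0" "wron w v \<rho> (lform e v G) = smult c3 (\<rho> ^ N)" "v + w = of_nat N * w + (1 - e)"
    show ?thesis
    proof (cases "w * of_nat (degree (lform e v G)) = v * of_nat (degree \<rho>)")
      case True
      obtain s where "v = of_nat s * w" using parallel_to_primitive[OF G(2) True prim deg] .
      thus ?thesis using one_root_solution[OF \<rho>0 G(2) *(2,1) w _ *(3)] e by auto
    next
      case False
      thus ?thesis using one_root_solution[OF \<rho>0 G(2) *(2,1) w _ *(3)] e by auto
    qed
  next
    assume comm: "wron w v \<rho> (lform e v G) = 0"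
    obtain s where s: "degree (lform e v G) = s * degree \<rho>" "v = of_nat s * w"
      using parallel_to_primitive[OF G(2) degree_commuting[OF \<rho>0 G(2) comm] prim deg] .
    have not_dvd: "\<not> \<delta> dvd s"
    proof
      assume "\<delta> dvd s"
      then obtain s' where "s = \<delta> * s'" by (elim dvdE)
      thus False using G(7)[of s'] s by simp
    qed
    hence \<delta>2: "\<delta> = 2" "odd s" using \<delta> by auto
    obtain cG where cG: "lform e v G = smult cG (\<rho> ^ s)" "cG \<noteq> 0"
      using commuting_power[OF \<rho>0 G(2) comm s(2) w] .
    have "s \<le> 2 * (A * C)" using G(6) w unfolding s(2) \<delta>2 by (simp only: mult_le_cancel_right_pos of_nat_le_iff)
    thus ?thesis
      using square_edge_one_root[OF keller(1) AC P[unfolded \<delta>2] Q[unfolded \<delta>2] deg w e prim G(1)[unfolded s(2)]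
          cG(1)[unfolded s(2)] cG(2) \<delta>2(2) _ refl G(3-5)[unfolded \<delta>2]] by blast
  qed
qed

text \<open>
  At a vertex \<open>2 (a, b)\<close> the reduction may stop at a half-integral power \<open>s / 2\<close> of \<open>r\<close>. As \<open>r\<close> is not a
  square, the leading forms cannot commute, and \<open>k = s + 2 - 2 N\<close> is the odd number that measures the
  weight \<open>k w / 2 = 1 - e\<close> by which the solution exceeds \<open>r^(N - 1)\<close>.
\<close>
lemma doubled_edge_roots:
  fixes P Q :: "'a::{alg_closed_field,field_char_0} fls poly"
  assumes keller: "keller P Q c" "c \<noteq> 0"
    and AC: "coprime A C" "A \<ge> 1" "C \<ge> 1"
    and P: "wt_le e (of_nat A * w) P" "lform e (of_nat A * w) P = smult cP (r ^ A)" "cP \<noteq> 0"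
    and Q: "wt_le e (of_nat C * w) Q" "lform e (of_nat C * w) Q = smult cQ (r ^ C)" "cQ \<noteq> 0"
    and deg: "degree r = 2 * b" "b \<ge> 1" and w: "w > 0" and e: "e < 1"
    and prim: "2 * of_int a = w + e * of_nat (2 * b)" "coprime a (int b)"
    and nonsquare: "\<And>\<sigma> c. r \<noteq> smult c (\<sigma> ^ 2)"
    and many: "card (roots r) > 1"
  obtains k where "odd k" "of_nat k * w = 2 * (1 - e)" "card (roots r) \<le> k * b"
    "\<And>z. poly r z = 0 \<Longrightarrow> k * order z r \<noteq> 2"
proof -
  have r0: "r \<noteq> 0" using deg by auto
  have deg1: "degree r \<ge> 1" using deg by simp
  have P': "wt_le e (of_nat (1 * A) * w) P" "lform e (of_nat (1 * A) * w) P = smult cP (r ^ (1 * A))"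
    and Q': "wt_le e (of_nat (1 * C) * w) Q" "lform e (of_nat (1 * C) * w) Q = smult cQ (r ^ (1 * C))"
    using P Q by simp_all
  obtain G v c2 where G: "wt_le e v G" "lform e v G \<noteq> 0"
    "wt_le e (of_nat (1 * C * (A - 1)) * w + 1) (jac P G)"
    "lform e (of_nat (1 * C * (A - 1)) * w + 1) (jac P G) = smult c2 (r ^ (1 * C * (A - 1)))" "c2 \<noteq> 0"
    "\<And>s. v = of_nat (1 * s) * w \<Longrightarrow> degree (lform e v G) \<noteq> 1 * s * degree r"
    by (rule ex_reduced_combination[OF keller AC order_refl P' P(3) Q' Q(3) deg1 w e]) blast
  have prim': "of_int a = w / 2 + e * of_nat b" using prim(1) by simp
  have par: "\<exists>s. odd s \<and> degree (lform e v G) = s * b \<and> v = of_nat s * (w / 2)"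
    if top: "w * of_nat (degree (lform e v G)) = v * of_nat (degree r)"
  proof -
    have "(w / 2) * of_nat (degree (lform e v G)) = v * of_nat b" using top deg by simp
    then obtain s where s: "degree (lform e v G) = s * b" "v = of_nat s * (w / 2)"
      using parallel_to_primitive[OF G(2) _ prim' prim(2) deg(2)] by blast
    have "odd s"
    proof
      assume "even s"
      then obtain s' where "s = 2 * s'" by (elim evenE)
      thus False using G(6)[of s'] s deg by simp
    qed
    thus ?thesis using s by blast
  qed
  show ?thesis
  proof (rule jac_alternative[OF P AC(2) deg1 G(1,3,4,5)[unfolded mult_1]])
    fix N c3 assume *: "c3 \<noteq> 0" "wron w v r (lform e v G) = smult c3 (r ^ N)" "v + w = of_nat N * w + (1 - e)"
    have e': "1 - e > 0" using e by simp
    have "w * of_nat (degree (lform e v G)) = v * of_nat (degree r)"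
      using one_root_solution[OF r0 G(2) *(2,1) w e' *(3)] many by (metis not_le)
    then obtain s where s: "odd s" "degree (lform e v G) = s * b" "v = of_nat s * (w / 2)" using par by blast
    have eq: "(of_nat s + 2) * w = of_nat (2 * N) * w + 2 * (1 - e)" using *(3) s(3) by (simp add: algebra_simps)
    have "of_nat (2 * N) * w < (of_nat s + 2) * w" using e unfolding eq by simp
    hence "of_nat (2 * N) * w < of_nat (s + 2) * w" by (simp add: add.commute)
    hence lt: "2 * N < s + 2" using w by (simp only: mult_less_cancel_right_pos of_nat_less_iff)
    define k where "k = s + 2 - 2 * N"
    have sk: "s + 2 = k + 2 * N" using lt by (simp add: k_def)
    hence "of_nat s + 2 = (of_nat k + of_nat (2 * N) :: rat)" by (metis of_nat_add of_nat_numeral)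
    hence kw: "of_nat k * w = 2 * (1 - e)" using eq by (simp add: algebra_simps)
    show ?thesis
    proof (rule that[of k])
      show "odd k" using s(1) sk by presburger
      show "of_nat k * w = 2 * (1 - e)" by fact
      have "card (roots r) + N * (2 * b) \<le> s * b + 2 * b"
        using card_roots_solution[OF r0 G(2) *(2,1) w e' *(3)] by (simp only: s(2) deg(1))
      also have "\<dots> = k * b + N * (2 * b)" using sk by (metis add_mult_distrib mult.assoc mult.commute)
      finally show "card (roots r) \<le> k * b" by simp
      fix z assume z: "poly r z = 0"
      have "(1 - e) * of_nat (order z r) \<noteq> w" using order_solution(2)[OF r0 G(2) *(2,1) w e' *(3) z] .
      moreover have "2 * ((1 - e) * of_nat (order z r)) = (of_nat k * w) * of_nat (order z r)"
        unfolding kw by simp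
      hence "2 * ((1 - e) * of_nat (order z r)) = of_nat (k * order z r) * w" by (simp add: mult_ac)
      ultimately have "of_nat (k * order z r) * w \<noteq> of_nat 2 * w" unfolding of_nat_numeral by linarith
      thus "k * order z r \<noteq> 2" by metis
    qed
  next
    assume comm: "wron w v r (lform e v G) = 0"
    obtain s where s: "odd s" "v = of_nat s * (w / 2)" using par[OF degree_commuting[OF r0 G(2) comm]] by blast
    have "2 * v = of_nat s * w" using s(2) by simp
    thus ?thesis using commuting_odd_square[OF r0 G(2) comm _ s(1) w] nonsquare by metis
  qed
qed

section \<open>Edges of the Newton polygon\<close>

text \<open>
  The point \<open>(I, J)\<close> is a vertex of the Newton polygon of \<open>P\<close> that carries the highest weight for \<open>e\<close> and
  for all slightly larger parameters.
\<close>
definition vertex_from :: "rat \<Rightarrow> 'a::zero fls poly \<Rightarrow> int \<Rightarrow> nat \<Rightarrow> bool" where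
  "vertex_from e P I J \<longleftrightarrow> mon P I J \<noteq> 0 \<and> wt_le e (wt e I J) P \<and>
     (\<forall>i j. mon P i j \<noteq> 0 \<longrightarrow> j < J \<longrightarrow> wt e i j < wt e I J)"

text \<open>
  The parameters at which the rightmost monomial of some lower row \<open>j\<close> catches up with the vertex
  \<open>(I, J)\<close>; \<open>- fls_subdegree\<close> is the degree in \<open>x\<close>.
\<close>
definition slopes :: "'a::zero fls poly \<Rightarrow> int \<Rightarrow> nat \<Rightarrow> rat set" where
  "slopes P I J = (\<lambda>j. of_int (I + fls_subdegree (coeff P j)) / of_nat (J - j)) ` {j. j < J \<and> coeff P j \<noteq> 0}"

lemma finite_slopes: "finite (slopes P I J)"
  by (simp add: slopes_def)

lemma slope_le_iff:
  "j < J \<Longrightarrow> s \<le> of_int (I + k) / of_nat (J - j) \<longleftrightarrow> wt s (- k) j \<le> wt s I J"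
  for s :: rat
  by (simp add: field_simps of_nat_diff)

lemma slope_eq_iff:
  "j < J \<Longrightarrow> s = of_int (I + k) / of_nat (J - j) \<longleftrightarrow> wt s (- k) j = wt s I J"
  for s :: rat
  by (auto simp add: field_simps of_nat_diff)

lemma slopes_greater:
  assumes "vertex_from e P I J" "s \<in> slopes P I J"
  shows "e < s"
proof -
  obtain j where j: "j < J" "coeff P j \<noteq> 0" "s = of_int (I + fls_subdegree (coeff P j)) / of_nat (J - j)"
    using assms(2) by (auto simp: slopes_def)
  have "of_int (- fls_subdegree (coeff P j)) - e * of_nat j < wt e I J"
    using assms(1) j(1) mon_subdegree[OF j(2)] unfolding vertex_from_def by blast
  hence "e \<le> s \<and> e \<noteq> s" unfolding j(3) slope_le_iff[OF j(1)] slope_eq_iff[OF j(1)] by simp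
  thus ?thesis by simp
qed

lemma wt_le_up_to_slopes:
  assumes "vertex_from e P I J" "e \<le> e2" "\<And>s. s \<in> slopes P I J \<Longrightarrow> e2 \<le> s"
  shows "wt_le e2 (wt e2 I J) P"
  unfolding wt_le_def
proof (intro allI impI)
  fix i j assume nz: "mon P i j \<noteq> 0"
  show "wt e2 i j \<le> wt e2 I J"
  proof (cases "j < J")
    case True
    have "coeff P j \<noteq> 0" using nz by (auto simp: mon_def)
    hence "e2 \<le> of_int (I + fls_subdegree (coeff P j)) / of_nat (J - j)"
      using True by (intro assms(3)) (auto simp: slopes_def)
    hence "of_int (- fls_subdegree (coeff P j)) - e2 * of_nat j \<le> wt e2 I J"
      unfolding slope_le_iff[OF True] .
    moreover have "of_int i \<le> (of_int (- fls_subdegree (coeff P j)) :: rat)"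
      using mon_nonzero_le_subdegree[OF nz] by (simp only: of_int_le_iff)
    ultimately show ?thesis by linarith
  next
    case False
    have "wt e i j \<le> wt e I J"
      using assms(1) nz unfolding vertex_from_def by (blast dest: wt_leD)
    moreover have "(e2 - e) * of_nat J \<le> (e2 - e) * of_nat j"
      using False assms(2) by (intro mult_left_mono) simp_all
    ultimately show ?thesis by (simp add: algebra_simps)
  qed
qed

lemma degree_lform_vertex:
  assumes "vertex_from e P I J" "e < e2" "wt_le e2 (wt e2 I J) P"
  shows "degree (lform e2 (wt e2 I J) P) = J" "lform e2 (wt e2 I J) P \<noteq> 0"
proof -
  let ?p = "lform e2 (wt e2 I J) P"
  have cJ: "coeff ?p J \<noteq> 0" using assms(1) by (simp add: coeff_lform_mon vertex_from_def)
  thus "?p \<noteq> 0" by auto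
  have "coeff ?p j = 0" if "j > J" for j
  proof (rule ccontr)
    assume "coeff ?p j \<noteq> 0"
    then obtain i where i: "of_int i = wt e2 I J + e2 * of_nat j" "mon P i j \<noteq> 0"
      by (metis coeff_lform_nonzero)
    have "wt e i j \<le> wt e I J"
      using assms(1) i unfolding vertex_from_def by (blast dest: wt_leD)
    moreover have "(e2 - e) * of_nat J < (e2 - e) * of_nat j"
      using that assms(2) by (intro mult_strict_left_mono) simp_all
    ultimately show False using i(1) by (simp add: algebra_simps)
  qed
  thus "degree ?p = J" using cJ by (intro antisym degree_le le_degree) auto
qed

lemma edge_if_slope:
  assumes "e2 \<in> slopes P I J"
  shows "\<exists>j<J. coeff (lform e2 (wt e2 I J) P) j \<noteq> 0"
proof -
  obtain j where j: "j < J" "coeff P j \<noteq> 0" "e2 = of_int (I + fls_subdegree (coeff P j)) / of_nat (J - j)"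
    using assms by (auto simp: slopes_def)
  have "coeff (lform e2 (wt e2 I J) P) j = mon P (- fls_subdegree (coeff P j)) j"
    using j(3) unfolding slope_eq_iff[OF j(1)] using coeff_lform_mon by metis
  with mon_subdegree[OF j(2)] have "coeff (lform e2 (wt e2 I J) P) j \<noteq> 0" by simp
  with j(1) show ?thesis by blast
qed

lemma ex_first_edge:
  assumes "vertex_from e P I J" "vertex_from e Q I' J'" "e < 1"
    and "\<not> (wt_le 1 (of_int I - of_nat J) P \<and> wt_le 1 (of_int I' - of_nat J') Q)"
  obtains e2 where "e < e2" "e2 < 1" "wt_le e2 (wt e2 I J) P" "wt_le e2 (of_int I' - e2 * of_nat J') Q"
    "(\<exists>j<J. coeff (lform e2 (wt e2 I J) P) j \<noteq> 0) \<or> (\<exists>j<J'. coeff (lform e2 (of_int I' - e2 * of_nat J') Q) j \<noteq> 0)"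
proof -
  define \<Sigma> where "\<Sigma> = slopes P I J \<union> slopes Q I' J'"
  have fin: "finite \<Sigma>" by (simp add: \<Sigma>_def finite_slopes)
  have "\<exists>s\<in>\<Sigma>. s < 1"
  proof (rule ccontr)
    assume "\<not> ?thesis"
    hence "\<And>s. s \<in> \<Sigma> \<Longrightarrow> 1 \<le> s" by force
    thus False using assms(4) wt_le_up_to_slopes[OF assms(1), of 1] wt_le_up_to_slopes[OF assms(2), of 1] assms(3)
      by (auto simp: \<Sigma>_def)
  qed
  then obtain s where s: "s \<in> \<Sigma>" "s < 1" by blast
  define e2 where "e2 = Min \<Sigma>"
  have e2: "e2 \<in> \<Sigma>" using s fin unfolding e2_def by (intro Min_in) auto
  have min: "e2 \<le> s" if "s \<in> \<Sigma>" for s using that fin by (simp add: e2_def)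
  show ?thesis
  proof (rule that[of e2])
    show "e < e2" using e2 slopes_greater[OF assms(1)] slopes_greater[OF assms(2)] unfolding \<Sigma>_def by blast
    thus "wt_le e2 (wt e2 I J) P" "wt_le e2 (of_int I' - e2 * of_nat J') Q"
      using min by (auto intro!: wt_le_up_to_slopes[OF assms(1)] wt_le_up_to_slopes[OF assms(2)] simp: \<Sigma>_def)
    show "e2 < 1" using min[OF s(1)] s(2) by simp
    show "(\<exists>j<J. coeff (lform e2 (wt e2 I J) P) j \<noteq> 0) \<or> (\<exists>j<J'. coeff (lform e2 (of_int I' - e2 * of_nat J') Q) j \<noteq> 0)"
      using e2 edge_if_slope[of e2 P I J] edge_if_slope[of e2 Q I' J'] unfolding \<Sigma>_def by blast
  qed
qed

lemma order_0_le_if_coeff_nonzero: "coeff p j \<noteq> 0 \<Longrightarrow> order 0 p \<le> j"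
  for p :: "'a::field poly"
proof (rule ccontr)
  assume *: "coeff p j \<noteq> 0" "\<not> order 0 p \<le> j"
  hence "p \<noteq> 0" by auto
  hence "monom 1 (order 0 p) dvd p" by (simp add: monom_1_dvd_iff)
  thus False using * by (simp add: monom_1_dvd_iff')
qed

lemma coeff_order_0_nonzero: "p \<noteq> 0 \<Longrightarrow> coeff p (order 0 p) \<noteq> 0"
  for p :: "'a::field poly"
proof
  assume *: "p \<noteq> 0" "coeff p (order 0 p) = 0"
  have "monom 1 (order 0 p) dvd p" using * by (simp add: monom_1_dvd_iff)
  hence "monom 1 (Suc (order 0 p)) dvd p" using * by (simp add: monom_1_dvd_iff' less_Suc_eq)
  thus False using * by (simp add: monom_1_dvd_iff)
qed

lemma order_power: "p \<noteq> 0 \<Longrightarrow> order z (p ^ n) = n * order z p"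
  for p :: "'a::field poly"
  by (induction n) (auto simp: order_mult)

text \<open>
  If the vertex were dominant up to \<open>e = 1\<close>, both weights would be at most \<open>0\<close> there, because the vertex is
  on or above the diagonal, and the leading form of \<open>jac P Q\<close> at weight \<open>1\<close> would vanish. At the edge that
  is met first the leading forms commute: otherwise one of them has a constant term, and the weight of
  \<open>P\<close> or \<open>Q\<close> is an integer between \<open>0\<close> and \<open>1\<close>. For \<open>e2 < 0\<close> the weights are too large not to commute.
\<close>
lemma ex_next_edge:
  fixes P Q :: "'a::{alg_closed_field,field_char_0} fls poly"
  assumes keller: "keller P Q c" "c \<noteq> 0"
    and AC: "coprime A C" "A \<ge> 1" "C \<ge> 1"
    and P: "vertex_from e P (int A * \<alpha>) (A * \<beta>)" and Q: "vertex_from e Q (int C * \<alpha>) (C * \<beta>)"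
    and e: "e < 1" "0 \<le> e \<or> \<alpha> \<ge> 1" and \<alpha>\<beta>: "\<alpha> \<le> int \<beta>" "\<beta> \<ge> 1"
  obtains e2 w r cP cQ where "e < e2" "e2 < 1" "w = wt e2 \<alpha> \<beta>" "w > 0"
    "wt_le e2 (of_nat A * w) P" "lform e2 (of_nat A * w) P = smult cP (r ^ A)" "cP \<noteq> 0"
    "wt_le e2 (of_nat C * w) Q" "lform e2 (of_nat C * w) Q = smult cQ (r ^ C)" "cQ \<noteq> 0"
    "degree r = \<beta>" "order 0 r < \<beta>"
proof -
  have "\<not> (wt_le 1 (of_int (int A * \<alpha>) - of_nat (A * \<beta>)) P \<and> wt_le 1 (of_int (int C * \<alpha>) - of_nat (C * \<beta>)) Q)"
  proof
    assume *: "wt_le 1 (of_int (int A * \<alpha>) - of_nat (A * \<beta>)) P \<and> wt_le 1 (of_int (int C * \<alpha>) - of_nat (C * \<beta>)) Q"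
    have le: "of_int (int n * \<alpha>) - of_nat (n * \<beta>) \<le> (0::rat)" for n
    proof -
      have "int n * \<alpha> \<le> int (n * \<beta>)" using \<alpha>\<beta>(1) by (simp add: mult_left_mono)
      hence "of_int (int n * \<alpha>) \<le> (of_int (int (n * \<beta>)) :: rat)" by (simp only: of_int_le_iff)
      thus ?thesis by simp
    qed
    have "wt_le 1 0 P" "wt_le 1 0 Q" using * le wt_le_mono by blast+
    hence "lform 1 (0 + 0 + 1) (jac P Q) = wron 0 0 (lform 1 0 P) (lform 1 0 Q)" by (rule lform_jac)
    thus False using keller(2) by (simp add: keller(1) lform_const_x wron_def)
  qed
  from ex_first_edge[OF P Q e(1) this] obtain e2 where e2: "e < e2" "e2 < 1"
    "wt_le e2 (wt e2 (int A * \<alpha>) (A * \<beta>)) P" "wt_le e2 (wt e2 (int C * \<alpha>) (C * \<beta>)) Q"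
    "(\<exists>j<A * \<beta>. coeff (lform e2 (wt e2 (int A * \<alpha>) (A * \<beta>)) P) j \<noteq> 0) \<or>
     (\<exists>j<C * \<beta>. coeff (lform e2 (wt e2 (int C * \<alpha>) (C * \<beta>)) Q) j \<noteq> 0)" .
  note dP = degree_lform_vertex[OF P e2(1,3)] and dQ = degree_lform_vertex[OF Q e2(1,4)]
  define w where "w = wt e2 \<alpha> \<beta>"
  have wA: "wt e2 (int n * \<alpha>) (n * \<beta>) = of_nat n * w" for n
    by (simp add: w_def algebra_simps)
  note e2' = e2[unfolded wA] and dP = dP[unfolded wA] and dQ = dQ[unfolded wA]
  define p q where "p = lform e2 (of_nat A * w) P" and "q = lform e2 (of_nat C * w) Q"
  have pq: "p \<noteq> 0" "q \<noteq> 0" "degree p = A * \<beta>" "degree q = C * \<beta>" using dP dQ by (auto simp: p_def q_def)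
  have L: "lform e2 (of_nat A * w + of_nat C * w + e2) (jac P Q) = wron (of_nat A * w) (of_nat C * w) p q"
    unfolding p_def q_def by (rule lform_jac[OF e2'(3,4)])
  have "lform e2 1 (jac P Q) \<noteq> 0" using keller by (simp add: lform_const_x)
  from wt_le_if_lform_nonzero[OF wt_le_jac[OF e2'(3,4)] this]
  have "1 \<le> of_nat A * w + of_nat C * w + e2" .
  hence ge: "1 - e2 \<le> of_nat (A + C) * w" by (simp add: algebra_simps)
  hence "0 < of_nat (A + C) * w" using e2(2) by linarith
  hence w: "w > 0" using mult_nonneg_nonpos[of "of_nat (A + C)" w] by linarith
  have ne: "1 - e2 \<noteq> of_nat (A + C) * w"
  proof
    \<comment> \<open>the case of noncommuting leading forms\<close>
    assume eq: "1 - e2 = of_nat (A + C) * w"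
    show False
    proof (cases "e2 < 0")
      case True
      hence \<alpha>1: "\<alpha> \<ge> 1" using e e2(1) by auto
      have "e2 * of_nat \<beta> \<le> e2 * 1" using \<alpha>\<beta>(2) True by (intro mult_left_mono_neg) auto
      moreover have "(1::rat) \<le> of_int \<alpha>" using \<alpha>1 by simp
      ultimately have "1 - e2 \<le> w" unfolding w_def by linarith
      moreover have "of_nat 2 * w \<le> of_nat (A + C) * w" using AC w by (intro mult_right_mono) auto
      ultimately show False using eq w by simp
    next
      case False
      have "of_nat A * w + of_nat C * w + e2 = 1" using eq by (simp add: algebra_simps)
      hence "[:c:] = wron (of_nat A * w) (of_nat C * w) p q" using L by (simp add: keller(1) lform_const_x)
      hence "poly (wron (of_nat A * w) (of_nat C * w) p q) 0 = c" by (metis poly_const_conv)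
      hence "coeff p 0 \<noteq> 0 \<or> coeff q 0 \<noteq> 0" using keller(2) by (auto simp: wron_def simp flip: poly_0_coeff_0)
      hence "of_nat A * w \<in> \<int> \<or> of_nat C * w \<in> \<int>" by (auto simp: p_def q_def coeff_lform split: if_splits)
      moreover have "0 < of_nat A * w" "0 < of_nat C * w" using AC w by simp_all
      moreover have "of_nat A * w < 1" "of_nat C * w < 1"
        using eq False calculation(2,3) by (simp_all add: algebra_simps)
      ultimately show False by (auto elim!: Ints_cases)
    qed
  qed
  have "1 < of_nat A * w + of_nat C * w + e2" using ge ne by (simp add: algebra_simps)
  hence "lform e2 (of_nat A * w + of_nat C * w + e2) (jac P Q) = 0"
    unfolding keller(1) by (rule lform_eq_0[OF wt_le_const_x])
  hence "wron (of_nat A * w) (of_nat C * w) p q = 0" using L by simp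
  then obtain r cP cQ where r: "p = smult cP (r ^ A)" "cP \<noteq> 0" "q = smult cQ (r ^ C)" "cQ \<noteq> 0" "r \<noteq> 0"
    using commuting_common_power[OF pq(1,2) _ w AC] by blast
  have degr: "degree r = \<beta>" using pq(3) r AC by (simp add: degree_power_eq)
  have ordp: "order 0 p = A * order 0 r" "order 0 q = C * order 0 r"
    using r by (simp_all add: order_smult order_power)
  have "(\<exists>j<A * \<beta>. coeff p j \<noteq> 0) \<or> (\<exists>j<C * \<beta>. coeff q j \<noteq> 0)" using e2'(5) by (simp add: p_def q_def)
  hence "order 0 p < A * \<beta> \<or> order 0 q < C * \<beta>" using order_0_le_if_coeff_nonzero le_less_trans by blast
  hence "order 0 r < \<beta>" unfolding ordp by auto
  thus ?thesis using that e2' w_def w r degr unfolding p_def q_def by blast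
qed

text \<open>
  The two highest coefficients of a power of \<open>\<zeta> - z\<close> are nonzero, so two exponents of \<open>x\<close> that differ by \<open>e\<close>
  are integers.
\<close>
lemma one_root_integral:
  fixes P :: "'a::{alg_closed_field,field_char_0} fls poly"
  assumes "lform e v P = smult k (r ^ A)" "k \<noteq> 0" "A \<ge> 1" "card (roots r) \<le> 1" "order 0 r < degree r"
  obtains z where "e \<in> \<int>" "r = smult (lead_coeff r) ([:-z, 1:] ^ degree r)" "z \<noteq> 0"
proof -
  have r0: "r \<noteq> 0" "degree r \<ge> 1" using assms(5) by auto
  obtain z where z: "r = smult (lead_coeff r) ([:-z, 1:] ^ degree r)" using one_root_power[OF r0(1) assms(4) r0(2)] .
  have "order z r = degree r"
    using r0 order_power_n_n[of z "degree r"] by (subst z) (simp add: order_smult)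
  hence z0: "z \<noteq> 0" using assms(5) by auto
  define n where "n = degree r * A"
  have n: "n \<ge> 1" using r0 assms(3) by (simp add: n_def)
  define l where "l = k * lead_coeff r ^ A"
  have "lform e v P = smult k (smult (lead_coeff r) ([:-z, 1:] ^ degree r) ^ A)" using assms(1) z by simp
  hence p: "lform e v P = smult l ([:-z, 1:] ^ n)" by (simp add: smult_power l_def n_def power_mult)
  have l: "l \<noteq> 0" using assms(2) r0 by (simp add: l_def)
  have c: "coeff (lform e v P) i = l * (of_nat (n choose i) * (-z) ^ (n - i))" if "i \<le> n" for i
    using that unfolding p by (simp add: coeff_linear_poly_power)
  have "coeff (lform e v P) n \<noteq> 0" "coeff (lform e v P) (n - 1) \<noteq> 0"
    using l z0 n by (simp_all add: c binomial_eq_0_iff)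
  hence "v + e * of_nat n \<in> \<int>" "v + e * of_nat (n - 1) \<in> \<int>" by (auto simp: coeff_lform split: if_splits)
  hence "(v + e * of_nat n) - (v + e * of_nat (n - 1)) \<in> \<int>" by (rule Ints_diff)
  moreover have "(v + e * of_nat n) - (v + e * of_nat (n - 1)) = e" using n by (simp add: of_nat_diff algebra_simps)
  ultimately show ?thesis using that z z0 by simp
qed

section \<open>Edges below a root of large multiplicity\<close>

lemma integral_if_coprime_multiples:
  fixes x :: rat
  assumes "of_nat A * x \<in> \<int>" "of_nat C * x \<in> \<int>" "coprime A C"
  shows "x \<in> \<int>"
proof -
  obtain u v :: int where "u * int A + v * int C = gcd (int A) (int C)" using bezout_int by blast
  hence "u * int A + v * int C = 1" using assms(3) by simp
  hence "x = of_int (u * int A + v * int C) * x" by simp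
  also have "\<dots> = of_int u * (of_nat A * x) + of_int v * (of_nat C * x)"
    unfolding of_int_add of_int_mult of_int_of_nat_eq by (simp only: distrib_right mult.assoc)
  finally have "of_int u * (of_nat A * x) + of_int v * (of_nat C * x) = x" ..
  thus ?thesis using assms(1,2) by (metis Ints_add Ints_mult Ints_of_int)
qed

lemma vertex_from_order:
  fixes P :: "'a::field fls poly"
  assumes "wt_le e v P" "lform e v P = p" "p \<noteq> 0" "order 0 p = J" "of_int I = v + e * of_nat J"
  shows "vertex_from e P I J"
  unfolding vertex_from_def
proof (intro conjI allI impI)
  have v: "v = wt e I J" using assms(5) by simp
  have "coeff p J \<noteq> 0" using coeff_order_0_nonzero[OF assms(3)] assms(4) by simp
  thus "mon P I J \<noteq> 0" using coeff_lform_mon[of e I J P] assms(2) v by simp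
  show "wt_le e (wt e I J) P" using assms(1) v by simp
  fix i j assume *: "mon P i j \<noteq> 0" "j < J"
  have "wt e i j \<noteq> v"
  proof
    assume "wt e i j = v"
    hence "coeff p j \<noteq> 0" using *(1) coeff_lform_mon[of e i j P] assms(2) by simp
    thus False using order_0_le_if_coeff_nonzero *(2) assms(4) by fastforce
  qed
  thus "wt e i j < wt e I J" using wt_leD[OF assms(1) *(1)] v by simp
qed

lemma lower_vertex_integral:
  fixes P Q :: "'a::field fls poly"
  assumes P: "lform e (of_nat A * w) P = smult cP (r ^ A)" "cP \<noteq> 0"
    and Q: "lform e (of_nat C * w) Q = smult cQ (r ^ C)" "cQ \<noteq> 0"
    and "r \<noteq> 0" "coprime A C"
  obtains \<alpha> where "w + e * of_nat (order 0 r) = of_int \<alpha>"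
proof -
  have nz: "smult cP (r ^ A) \<noteq> 0" "smult cQ (r ^ C) \<noteq> 0" using assms by simp_all
  have ord: "order 0 (smult cP (r ^ A)) = A * order 0 r" "order 0 (smult cQ (r ^ C)) = C * order 0 r"
    using assms by (simp_all add: order_smult order_power)
  have "coeff (lform e (of_nat A * w) P) (A * order 0 r) \<noteq> 0" "coeff (lform e (of_nat C * w) Q) (C * order 0 r) \<noteq> 0"
    using coeff_order_0_nonzero[OF nz(1)] coeff_order_0_nonzero[OF nz(2)] unfolding P(1) Q(1) ord by simp_all
  hence "of_nat A * (w + e * of_nat (order 0 r)) \<in> \<int>" "of_nat C * (w + e * of_nat (order 0 r)) \<in> \<int>"
    by (auto simp: coeff_lform algebra_simps split: if_splits)
  hence "w + e * of_nat (order 0 r) \<in> \<int>" using integral_if_coprime_multiples assms(6) by blast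
  thus ?thesis using that by (auto elim: Ints_cases)
qed

text \<open>
  Since \<open>w1 < (1 - e1) m\<close>, the lower vertex \<open>(\<alpha>, m)\<close> of the edge is above the diagonal, so there is a next
  edge, at \<open>e2\<close>. On it a reduced combination \<open>G\<close> has the weight of \<open>r2\<^sup>\<gamma>\<close> with a \<open>\<gamma>\<close> that is no natural
  number. The same \<open>G\<close> is then so heavy at \<open>e1\<close> that its leading form commutes with \<open>r1\<close> there, hence is
  an integral power \<open>r1\<^sup>s\<close>, as \<open>r1\<close> is no square. The lowest term of \<open>r1\<^sup>s\<close> is \<open>s\<close> times the common
  vertex of the two edges; comparing weights at \<open>e1\<close> and \<open>e2\<close> gives \<open>s \<ge> \<gamma>\<close> and \<open>s \<le> \<gamma>\<close>.
\<close>
lemma no_edge_with_large_root_at_0: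
  fixes P Q :: "'a::{alg_closed_field,field_char_0} fls poly"
  assumes keller: "keller P Q c" "c \<noteq> 0"
    and AC: "coprime A C" "A \<ge> 1" "C \<ge> 1"
    and P: "wt_le e1 (of_nat A * w1) P" "lform e1 (of_nat A * w1) P = smult cP (r1 ^ A)" "cP \<noteq> 0"
    and Q: "wt_le e1 (of_nat C * w1) Q" "lform e1 (of_nat C * w1) Q = smult cQ (r1 ^ C)" "cQ \<noteq> 0"
    and deg: "degree r1 = 2 * b" "b \<ge> 1" and w1: "w1 > 0" and e1: "0 \<le> e1" "e1 < 1"
    and prim: "2 * of_int a = w1 + e1 * of_nat (2 * b)" "coprime a (int b)"
    and nonsquare: "\<And>\<sigma> c. r1 \<noteq> smult c (\<sigma> ^ 2)"
    and above: "w1 < (1 - e1) * of_nat (order 0 r1)"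
  shows False
proof -
  define m where "m = order 0 r1"
  have r10: "r1 \<noteq> 0" using deg by auto
  have m1: "m \<ge> 1"
  proof (rule ccontr)
    assume "\<not> m \<ge> 1"
    hence "order 0 r1 = 0" by (simp add: m_def)
    thus False using above w1 by simp
  qed
  have ordA: "order 0 (smult cP (r1 ^ A)) = A * m" "order 0 (smult cQ (r1 ^ C)) = C * m"
    using P(3) Q(3) r10 by (simp_all add: order_smult order_power m_def)
  have nz: "smult cP (r1 ^ A) \<noteq> 0" "smult cQ (r1 ^ C) \<noteq> 0" using P(3) Q(3) r10 by simp_all
  obtain \<alpha> where \<alpha>: "w1 + e1 * of_nat m = of_int \<alpha>"
    using lower_vertex_integral[OF P(2,3) Q(2,3) r10 AC(1)] unfolding m_def by blast
  have vP: "vertex_from e1 P (int A * \<alpha>) (A * m)"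
    by (rule vertex_from_order[OF P(1,2) nz(1) ordA(1)]) (simp add: \<alpha>[symmetric] algebra_simps)
  have vQ: "vertex_from e1 Q (int C * \<alpha>) (C * m)"
    by (rule vertex_from_order[OF Q(1,2) nz(2) ordA(2)]) (simp add: \<alpha>[symmetric] algebra_simps)
  have "of_int \<alpha> < (of_int (int m) :: rat)" using above \<alpha> by (simp add: m_def[symmetric] algebra_simps)
  hence \<alpha>m: "\<alpha> \<le> int m" by simp
  obtain e2 w2 r2 cP2 cQ2 where e2: "e1 < e2" "e2 < 1" "w2 = wt e2 \<alpha> m" "w2 > 0"
    and P2: "wt_le e2 (of_nat A * w2) P" "lform e2 (of_nat A * w2) P = smult cP2 (r2 ^ A)" "cP2 \<noteq> 0"
    and Q2: "wt_le e2 (of_nat C * w2) Q" "lform e2 (of_nat C * w2) Q = smult cQ2 (r2 ^ C)" "cQ2 \<noteq> 0"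
    and r2: "degree r2 = m" "order 0 r2 < m"
    by (rule ex_next_edge[OF keller AC vP vQ e1(2) _ \<alpha>m m1]) (use e1(1) in blast)+
  have r20: "r2 \<noteq> 0" "degree r2 \<ge> 1" using r2 m1 by auto
  have w12: "w1 = w2 + (e2 - e1) * of_nat m" using e2(3) \<alpha> by (simp add: algebra_simps)
  have many: "\<not> card (roots r2) \<le> 1"
  proof
    assume *: "card (roots r2) \<le> 1"
    have "e2 \<in> \<int>" by (rule one_root_integral[OF P2(2,3) AC(2) *]) (use r2 in auto)
    thus False using e1 e2 by (auto elim!: Ints_cases)
  qed
  have P2': "wt_le e2 (of_nat (1 * A) * w2) P" "lform e2 (of_nat (1 * A) * w2) P = smult cP2 (r2 ^ (1 * A))"
    and Q2': "wt_le e2 (of_nat (1 * C) * w2) Q" "lform e2 (of_nat (1 * C) * w2) Q = smult cQ2 (r2 ^ (1 * C))"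
    using P2 Q2 by simp_all
  define t where "t = C * (A - 1)"
  obtain G v c2 where G: "wt_le e2 v G" "lform e2 v G \<noteq> 0"
    "wt_le e2 (of_nat t * w2 + 1) (jac P G)"
    "lform e2 (of_nat t * w2 + 1) (jac P G) = smult c2 (r2 ^ t)" "c2 \<noteq> 0"
    "\<And>s. v = of_nat s * w2 \<Longrightarrow> degree (lform e2 v G) \<noteq> s * m"
    "wt_le e1 (of_nat t * w1 + 1) (jac P G)"
  proof (rule ex_reduced_combination[OF keller AC order_refl P2' P2(3) Q2' Q2(3) r20(2) e2(4,2)])
    fix v G c2 assume *: "wt_le e2 v G" "lform e2 v G \<noteq> 0"
      "wt_le e2 (of_nat (1 * C * (A - 1)) * w2 + 1) (jac P G)"
      "lform e2 (of_nat (1 * C * (A - 1)) * w2 + 1) (jac P G) = smult c2 (r2 ^ (1 * C * (A - 1)))" "c2 \<noteq> 0"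
      "\<And>s. v = of_nat (1 * s) * w2 \<Longrightarrow> degree (lform e2 v G) \<noteq> 1 * s * degree r2"
      "\<And>e1 w1. w1 > 0 \<Longrightarrow> wt_le e1 (of_nat (1 * A) * w1) P \<Longrightarrow> wt_le e1 (of_nat (1 * C) * w1) Q \<Longrightarrow>
        wt_le e1 (of_nat (1 * C * (A - 1)) * w1 + 1) (jac P G)"
    show ?thesis
      using that[of v G c2] *(1-5) *(6) *(7)[of w1 e1] w1 P(1) Q(1) by (simp add: t_def r2(1))
  qed
  define j where "j = degree (lform e2 v G)"
  have top: "w2 * of_nat j = v * of_nat m"
    unfolding j_def
  proof (rule jac_alternative[OF P2 AC(2) r20(2) G(1,3,4,5)])
    fix N c3 assume *: "c3 \<noteq> 0" "wron w2 v r2 (lform e2 v G) = smult c3 (r2 ^ N)" "v + w2 = of_nat N * w2 + (1 - e2)"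
    show "w2 * of_nat (degree (lform e2 v G)) = v * of_nat m"
      using one_root_solution[OF r20(1) G(2) *(2,1) e2(4) _ *(3)] many e2(2) r2(1) by auto
  next
    assume "wron w2 v r2 (lform e2 v G) = 0"
    thus "w2 * of_nat (degree (lform e2 v G)) = v * of_nat m"
      using degree_commuting[OF r20(1) G(2)] r2(1) by simp
  qed
  have thr2: "of_nat t * w2 + 1 \<le> of_nat A * w2 + v + e2"
    using jac_threshold[OF P2(1) G(1), of t] G(4,5) r20 by simp
  have "coeff (lform e2 v G) j \<noteq> 0" using G(2) by (simp add: j_def)
  then obtain i where i: "of_int i = v + e2 * of_nat j" "mon G i j \<noteq> 0" by (metis coeff_lform_nonzero)
  have "G \<noteq> 0" using G(2) by auto
  then obtain v1 where v1: "wt_le e1 v1 G" "lform e1 v1 G \<noteq> 0" using ex_weight by blast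
  define g1 where "g1 = lform e1 v1 G"
  have "v + (e2 - e1) * of_nat j \<le> v1" using wt_leD[OF v1(1) i(2)] i(1) by (simp add: algebra_simps)
  hence "(v + (e2 - e1) * of_nat j) * w2 \<le> v1 * w2" using e2(4) by (intro mult_right_mono) auto
  moreover have "(v + (e2 - e1) * of_nat j) * w2 = v * w2 + (e2 - e1) * (w2 * of_nat j)" by (simp add: algebra_simps)
  hence "(v + (e2 - e1) * of_nat j) * w2 = v * w1" unfolding top w12 by (simp add: algebra_simps)
  ultimately have vv1: "v * w1 \<le> v1 * w2" by simp
  \<comment> \<open>the ratio \<open>(1 - e) / w\<close> increases from \<open>e1\<close> to \<open>e2\<close> because the slope \<open>m\<close> of \<open>w\<close> is large\<close>
  have steeper: "(1 - e1) * w2 < (1 - e2) * w1"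
  proof -
    have "(e2 - e1) * w1 < (e2 - e1) * ((1 - e1) * of_nat m)"
      using above e2(1) unfolding m_def by (intro mult_strict_left_mono) auto
    thus ?thesis unfolding e2(3) \<alpha>[symmetric] by (simp add: algebra_simps)
  qed
  have "(of_nat t * w1 + 1 - e1 - of_nat A * w1) * w2 < v1 * w2"
  proof -
    have "(of_nat t * w2 + 1 - e2 - of_nat A * w2) * w1 \<le> v * w1" using thr2 w1 by (intro mult_right_mono) auto
    moreover have "(of_nat t * w1 + 1 - e1 - of_nat A * w1) * w2 = (of_nat t * w2 + 1 - e2 - of_nat A * w2) * w1 + ((1 - e1) * w2 - (1 - e2) * w1)"
      by (simp add: algebra_simps)
    ultimately show ?thesis using steeper vv1 by linarith
  qed
  hence "of_nat t * w1 + 1 - e1 - of_nat A * w1 < v1" using e2(4) by (simp only: mult_less_cancel_right_pos)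
  hence "of_nat t * w1 + 1 < of_nat A * w1 + v1 + e1" by linarith
  from lform_eq_0[OF G(7) this] have "wron (of_nat A * w1) v1 (smult cP (r1 ^ A)) g1 = 0"
    unfolding lform_jac[OF P(1) v1(1)] P(2) g1_def .
  hence comm: "wron w1 v1 r1 g1 = 0" using P(3) AC(2) r10 by (simp add: wron_smult wron_power_left)
  have g10: "g1 \<noteq> 0" using v1 by (simp add: g1_def)
  have "(w1 / 2) * of_nat (degree (lform e1 v1 G)) = v1 * of_nat b"
    using degree_commuting[OF r10 g10 comm] deg(1) by (simp add: g1_def)
  moreover have "of_int a = w1 / 2 + e1 * of_nat b" using prim(1) by simp
  ultimately obtain s' where s': "v1 = of_nat s' * (w1 / 2)"
    using parallel_to_primitive[OF v1(2) _ _ prim(2) deg(2)] by blast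
  show False
  proof (cases "even s'")
    case False
    have "2 * v1 = of_nat s' * w1" using s' by simp
    thus False using commuting_odd_square[OF r10 g10 comm _ False w1] nonsquare by metis
  next
    case True
    then obtain s where s: "s' = 2 * s" by (elim evenE)
    have v1s: "v1 = of_nat s * w1" using s' s by simp
    obtain c' where c': "g1 = smult c' (r1 ^ s)" "c' \<noteq> 0" using commuting_power[OF r10 g10 comm v1s w1] .
    have "order 0 g1 = s * m" unfolding c'(1) using c'(2) r10 by (simp add: order_smult order_power m_def)
    hence "coeff (lform e1 v1 G) (s * m) \<noteq> 0" using coeff_order_0_nonzero[OF g10] by (simp add: g1_def)
    then obtain i' where i': "of_int i' = v1 + e1 * of_nat (s * m)" "mon G i' (s * m) \<noteq> 0"
      by (metis coeff_lform_nonzero)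
    have "of_nat s * w2 \<le> v"
      using wt_leD[OF G(1) i'(2)] unfolding i'(1) v1s w12 by (simp add: algebra_simps)
    moreover have "v * w1 \<le> (of_nat s * w2) * w1" using vv1 unfolding v1s by (simp add: mult_ac)
    hence "v \<le> of_nat s * w2" using w1 by (simp only: mult_le_cancel_right_pos)
    ultimately have v: "v = of_nat s * w2" by simp
    hence "w2 * of_nat j = w2 * of_nat (s * m)" using top by (simp add: mult_ac)
    hence "j = s * m" using e2(4) by (simp only: mult_cancel_left of_nat_eq_iff) auto
    thus False using G(6)[OF v] by (simp add: j_def)
  qed
qed

section \<open>Substitutions with fractional exponents\<close>

text \<open>
  The substitution \<open>x = X^q\<close>, \<open>y = s + t \<eta>\<close>, with series \<open>s\<close> and \<open>t\<close> in \<open>X\<close>.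
\<close>
definition laurent_subst :: "nat \<Rightarrow> 'a::field_char_0 fls \<Rightarrow> 'a fls \<Rightarrow> 'a fls poly \<Rightarrow> 'a fls poly" where
  "laurent_subst q s t P = pcompose (map_poly (\<lambda>a. fls_compose_power a q) P) [:s, t:]"

lemma laurent_subst_0 [simp]: "laurent_subst q s t 0 = 0"
  by (simp add: laurent_subst_def)

lemma laurent_subst_pCons: "laurent_subst q s t (pCons a P) = [:fls_compose_power a q:] + [:s, t:] * laurent_subst q s t P"
  by (simp add: laurent_subst_def map_poly_pCons pcompose_pCons)

lemma laurent_subst_add: "laurent_subst q s t (P + Q) = laurent_subst q s t P + laurent_subst q s t Q"
proof -
  have "map_poly (\<lambda>a. fls_compose_power a q) (P + Q) =
      map_poly (\<lambda>a. fls_compose_power a q) P + map_poly (\<lambda>a. fls_compose_power a q) Q"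
    by (rule poly_eqI) (simp add: coeff_map_poly)
  thus ?thesis by (simp add: laurent_subst_def pcompose_add)
qed

lemma laurent_subst_diff: "laurent_subst q s t (P - Q) = laurent_subst q s t P - laurent_subst q s t Q"
  using laurent_subst_add[of q s t "P - Q" Q] by simp

lemma laurent_subst_const_mult: "laurent_subst q s t (smult a P) = [:fls_compose_power a q:] * laurent_subst q s t P"
proof -
  have "map_poly (\<lambda>a. fls_compose_power a q) (smult a P) =
      smult (fls_compose_power a q) (map_poly (\<lambda>a. fls_compose_power a q) P)"
    by (rule poly_eqI) (simp add: coeff_map_poly)
  thus ?thesis by (simp add: laurent_subst_def pcompose_smult)
qed

lemma laurent_subst_mult: "laurent_subst q s t (P * Q) = laurent_subst q s t P * laurent_subst q s t Q"
proof (induction P)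
  case (pCons a P)
  have "laurent_subst q s t (pCons a P * Q) = [:fls_compose_power a q:] * laurent_subst q s t Q + [:s, t:] * (laurent_subst q s t P * laurent_subst q s t Q)"
    by (simp only: mult_pCons_left laurent_subst_add laurent_subst_const_mult laurent_subst_pCons pCons.IH fls_compose_power_0_left) simp
  thus ?case by (simp only: laurent_subst_pCons distrib_right mult.assoc)
qed simp

lemma fls_xd_compose_power: "q \<ge> 1 \<Longrightarrow> fls_xd (fls_compose_power a q) = of_nat q * fls_compose_power (fls_xd a) q"
  by (intro fls_eqI) (auto simp: fls_xd_nth fls_nth_compose_power fls_of_nat)

lemma xd_subst:
  assumes "q \<ge> 1"
  shows "xd (laurent_subst q s t P) = of_nat q * laurent_subst q s t (xd P) + laurent_subst q s t (pderiv P) * [:fls_xd s, fls_xd t:]"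
proof (induction P)
  case (pCons a P)
  define Y where "Y = [:s, t:]"
  have Y': "[:fls_xd s, fls_xd t:] = xd Y" by (simp add: Y_def)
  have R: "laurent_subst q s t (pCons b R) = [:fls_compose_power b q:] + Y * laurent_subst q s t R" for b R
    by (simp only: laurent_subst_pCons Y_def)
  have c: "[:fls_xd (fls_compose_power a q):] = of_nat q * [:fls_compose_power (fls_xd a) q:]"
    using fls_xd_compose_power[OF assms, of a] by (simp add: of_nat_poly)
  have z: "[:fls_compose_power 0 q:] = 0" by simp
  show ?case
    unfolding Y' by (simp only: R z c xd_simps(1,2,5) xd_mult pCons.IH[unfolded Y'] pderiv_pCons laurent_subst_add)
      (simp only: algebra_simps mult_zero_left add_0_left)
qed simp

lemma pderiv_subst: "pderiv (laurent_subst q s t P) = laurent_subst q s t (pderiv P) * [:t:]"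
proof (induction P)
  case (pCons a P)
  define Y where "Y = [:s, t:]"
  have R: "laurent_subst q s t (pCons b R) = [:fls_compose_power b q:] + Y * laurent_subst q s t R" for b R
    by (simp only: laurent_subst_pCons Y_def)
  have Y': "pderiv Y = [:t:]" by (simp add: Y_def pderiv_pCons)
  have z: "[:fls_compose_power 0 q:] = 0" "pderiv [:fls_compose_power a q:] = 0" by simp_all
  show ?case
    by (simp only: R z pderiv_add pderiv_mult pCons.IH pderiv_pCons[of a P] laurent_subst_add Y')
       (simp only: algebra_simps mult_zero_left add_0_left)
qed simp

text \<open>
  In the chain rule the derivatives of \<open>s\<close> and \<open>t\<close> contribute only multiples of \<open>pderiv P * pderiv Q\<close>, which
  cancel in the determinant.
\<close>
lemma jac_subst:
  assumes "q \<ge> 1" "keller P Q c" "fls_compose_power fls_X_inv q * t = fls_X_inv"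
  shows "jac (laurent_subst q s t P) (laurent_subst q s t Q) = [:fls_const (of_nat q * c) * fls_X_inv:]"
proof -
  have "jac (laurent_subst q s t P) (laurent_subst q s t Q) = of_nat q * (laurent_subst q s t (jac P Q) * [:t:])"
    by (simp only: jac_def xd_subst[OF assms(1)] pderiv_subst laurent_subst_diff laurent_subst_mult) (simp only: algebra_simps)
  also have "laurent_subst q s t (jac P Q) * [:t:] = [:fls_const c * fls_X_inv:]"
    using assms(1,3) by (simp add: assms(2) laurent_subst_pCons mult.assoc mult.commute[of t])
  finally show ?thesis by (simp add: of_nat_poly fls_of_nat mult.commute[of c] flip: mult.assoc)
qed

lemma pcompose_eq_sum: "degree p \<le> n \<Longrightarrow> pcompose p q = (\<Sum>j\<le>n. [:coeff p j:] * q ^ j)"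
proof -
  assume n: "degree p \<le> n"
  have "pcompose p q = (\<Sum>j\<le>degree (map_poly (\<lambda>x. [:x:]) p). [:coeff p j:] * q ^ j)"
    unfolding pcompose_altdef poly_altdef by (simp add: coeff_map_poly)
  also have "\<dots> = (\<Sum>j\<le>n. [:coeff p j:] * q ^ j)"
  proof (rule sum.mono_neutral_left)
    show "{..degree (map_poly (\<lambda>x. [:x:]) p)} \<subseteq> {..n}" using n map_poly_degree_leq[of "\<lambda>x. [:x:]" p] by auto
    show "\<forall>i\<in>{..n} - {..degree (map_poly (\<lambda>x. [:x:]) p)}. [:coeff p i:] * q ^ i = 0"
    proof
      fix i assume "i \<in> {..n} - {..degree (map_poly (\<lambda>x. [:x:]) p)}"
      hence "coeff (map_poly (\<lambda>x. [:x:]) p) i = 0" by (intro coeff_eq_0) auto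
      thus "[:coeff p i:] * q ^ i = 0" by (simp add: coeff_map_poly)
    qed
  qed simp
  finally show ?thesis .
qed

lemma
  assumes q: "q \<ge> 1" and P: "wt_le e v P"
    and y: "wt_le e' (- (of_nat q * e)) [:s, t:]" "lform e' (- (of_nat q * e)) [:s, t:] = [:z, 1:]"
  shows wt_le_subst: "wt_le e' (of_nat q * v) (laurent_subst q s t P)"
    and lform_subst: "lform e' (of_nat q * v) (laurent_subst q s t P) = pcompose (lform e v P) [:z, 1:]"
proof -
  define F where "F j = [:fls_compose_power (coeff P j) q:]" for j
  have S: "laurent_subst q s t P = (\<Sum>j\<le>degree P. F j * [:s, t:] ^ j)"
    unfolding laurent_subst_def using map_poly_degree_leq[of "\<lambda>a. fls_compose_power a q" P]
    by (subst pcompose_eq_sum[of _ "degree P"]) (auto simp: coeff_map_poly F_def)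
  have monF: "mon (F j) i 0 = (if int q dvd i then mon P (i div int q) j else 0)" for i j
    using q by (auto simp: F_def mon_def fls_nth_compose_power dvd_neg_div)
  have monF': "mon (F j) i k = 0" if "k \<noteq> 0" for i j k
    using that by (simp add: F_def mon_const)
  have 1: "wt_le e' (of_nat q * (v + e * of_nat j)) (F j)" for j
    unfolding wt_le_def
  proof (intro allI impI)
    fix i k assume nz: "mon (F j) i k \<noteq> 0"
    hence k: "k = 0" using monF' by blast
    with nz have d: "int q dvd i" "mon P (i div int q) j \<noteq> 0" by (auto simp: monF split: if_splits)
    hence "wt e (i div int q) j \<le> v" using P wt_leD by blast
    hence "of_nat q * of_int (i div int q) \<le> of_nat q * (v + e * of_nat j)" by (intro mult_left_mono) auto
    moreover have "of_nat q * of_int (i div int q) = (of_int (int q * (i div int q)) :: rat)" by simp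
    hence "of_nat q * of_int (i div int q) = (of_int i :: rat)" using d(1) by simp
    ultimately show "of_int i - e' * of_nat k \<le> of_nat q * (v + e * of_nat j)" by (simp add: k)
  qed
  have 2: "lform e' (of_nat q * (v + e * of_nat j)) (F j) = [:coeff (lform e v P) j:]" for j
  proof (rule poly_eqI)
    fix k
    show "coeff (lform e' (of_nat q * (v + e * of_nat j)) (F j)) k = coeff [:coeff (lform e v P) j:] k"
    proof (cases "k = 0")
      case False
      thus ?thesis by (simp add: coeff_lform monF' coeff_pCons split: nat.splits)
    next
      case True
      show ?thesis
      proof (cases "v + e * of_nat j \<in> \<int>")
        case int: True
        then obtain i where i: "v + e * of_nat j = of_int i" by (auto elim: Ints_cases)
        have "of_nat q * of_int i = (of_int (int q * i) :: rat)" by simp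
        moreover have "mon (F j) (int q * i) 0 = mon P i j" using q by (simp add: monF)
        ultimately show ?thesis using True int i
          by (simp add: coeff_lform del: of_int_mult flip: of_int_mult)
      next
        case nint: False
        have "coeff (lform e' (of_nat q * (v + e * of_nat j)) (F j)) 0 = 0"
        proof (rule ccontr)
          assume "\<not> ?thesis"
          then obtain i where i: "of_int i = of_nat q * (v + e * of_nat j)" "mon (F j) i 0 \<noteq> 0"
            using coeff_lform_nonzero by (metis mult_zero_right of_nat_0 add.right_neutral)
          hence "int q dvd i" by (auto simp: monF split: if_splits)
          then obtain i' where "i = int q * i'" by (elim dvdE)
          hence "of_nat q * of_int i' = of_nat q * (v + e * of_nat j)" using i(1) by simp
          hence "v + e * of_nat j = of_int i'" using q by simp
          thus False using nint by simp
        qed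
        thus ?thesis using True nint by (simp add: coeff_lform[of e v])
      qed
    qed
  qed
  have eq: "of_nat q * v = of_nat q * (v + e * of_nat j) + of_nat j * (- (of_nat q * e))" for j
    by (simp add: algebra_simps)
  show "wt_le e' (of_nat q * v) (laurent_subst q s t P)" unfolding S
  proof (rule wt_le_sum)
    fix j assume "j \<in> {..degree P}"
    show "wt_le e' (of_nat q * v) (F j * [:s, t:] ^ j)"
      unfolding eq[of j] by (rule wt_le_mult[OF 1 wt_le_power[OF y(1)]])
  qed
  have "lform e' (of_nat q * v) (F j * [:s, t:] ^ j) = [:coeff (lform e v P) j:] * [:z, 1:] ^ j" for j
    unfolding eq[of j] lform_mult[OF 1 wt_le_power[OF y(1)]] 2 lform_power[OF y(1)] y(2) ..
  thus "lform e' (of_nat q * v) (laurent_subst q s t P) = pcompose (lform e v P) [:z, 1:]"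
    unfolding S lform_sum by (subst pcompose_eq_sum[OF degree_lform]) simp
qed

lemma pcompose_power: "pcompose (p ^ n) q = pcompose p q ^ n"
  by (induction n) (simp_all add: pcompose_mult pcompose_1)

lemma order_0_translate:
  fixes p :: "'a::field poly"
  assumes "p \<noteq> 0"
  shows "order 0 (pcompose p [:z, 1:]) = order z p"
proof -
  obtain p1 where p1: "p = [:-z, 1:] ^ order z p * p1" "\<not> [:-z, 1:] dvd p1" using order_decomp[OF assms] by blast
  have nz: "poly (pcompose p1 [:z, 1:]) 0 \<noteq> 0" using p1(2) by (simp add: poly_pcompose poly_eq_0_iff_dvd)
  have "pcompose p [:z, 1:] = [:-0, 1:] ^ order z p * pcompose p1 [:z, 1:]"
    by (subst p1(1)) (simp add: pcompose_mult pcompose_power pcompose_pCons)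
  moreover have "order 0 ([:-0, 1:] ^ order z p * pcompose p1 [:z, 1:]) = order z p"
    using nz by (subst order_mult) (auto simp del: minus_zero simp add: order_power_n_n order_0I)
  ultimately show ?thesis by simp
qed

lemma pcompose_translate_inverse: "pcompose (pcompose p [:z, 1:]) [:-z, 1:] = p"
  for p :: "'a::comm_ring_1 poly"
proof -
  have "pcompose [:z, 1:] [:-z, 1:] = [:0, 1:]" by (simp add: pcompose_pCons)
  thus ?thesis by (simp flip: pcompose_assoc)
qed

text \<open>
  For \<open>j = 0\<close> this is a shear \<open>y + z x\<^sup>n\<close>; for \<open>e = 0\<close> it is \<open>(y + z) x\<^sup>n\<close>, which centres coordinates at a root.
\<close>
lemma homogeneous_binomial:
  fixes z :: "'a::field_char_0"
  defines "L n j \<equiv> [:fls_shift n (fls_const z), fls_shift j 1:]"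
  assumes "e * 1 = of_int (j - n)"
  shows "wt_le e (of_int n) (L n j)" "lform e (of_int n) (L n j) = [:z, 1:]"
proof -
  have m: "mon (L n j) i k = (if k = 0 \<and> i = n then z else if k = 1 \<and> i = j then 1 else 0)" for i k
    unfolding L_def mon_def by (auto simp: coeff_pCons split: nat.splits)
  show "wt_le e (of_int n) (L n j)" using assms(2) by (auto simp: wt_le_def m split: if_splits)
  have "of_int n + e * 1 = of_int j" using assms(2) by simp
  hence c: "coeff (lform e (of_int n) (L n j)) k = (if k = 0 then z else if k = 1 then 1 else 0)" for k
  proof (cases "k \<le> 1")
    case True
    thus ?thesis using \<open>of_int n + e * 1 = of_int j\<close> by (cases k) (auto simp: coeff_lform m)
  qed (auto simp: coeff_lform m)
  show "lform e (of_int n) (L n j) = [:z, 1:]"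
    by (rule poly_eqI) (auto simp: c coeff_pCons split: nat.splits)
qed

section \<open>Jacobian pairs of Laurent polynomials\<close>

text \<open>
  The average multiplicity of the roots is at least \<open>2 / k\<close>, and no multiplicity is equal to \<open>2 / k\<close>.
\<close>
lemma ex_large_root:
  fixes r :: "'a::alg_closed_field poly"
  assumes "degree r = 2 * b" "b \<ge> 1" "odd k" "card (roots r) \<le> k * b"
    and "\<And>z. poly r z = 0 \<Longrightarrow> k * order z r \<noteq> 2"
  obtains z where "poly r z = 0" "k * order z r > 2"
proof -
  have r0: "r \<noteq> 0" using assms(1,2) by auto
  have k: "k \<ge> 1" using assms(3) by (cases k) auto
  have "\<exists>z. poly r z = 0 \<and> k * order z r > 2"
  proof (rule ccontr)
    assume "\<not> ?thesis"
    hence le: "k * order z r \<le> 1" if "poly r z = 0" for z using assms(5)[OF that] that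
      by (metis One_nat_def Suc_1 less_2_cases_iff linorder_neqE_nat not_less_eq_eq less_Suc_eq_le)
    have "k * (2 * b) = (\<Sum>z | poly r z = 0. k * order z r)"
      by (simp only: assms(1)[symmetric] sum_order_eq_degree[OF r0, symmetric] sum_distrib_left)
    also have "\<dots> \<le> card (roots r) * 1" 
      using sum_bounded_above[of "roots r" "\<lambda>z. k * order z r" 1] le by simp
    also have "\<dots> \<le> k * b" using assms(4) by simp
    finally show False using k assms(2) by simp
  qed
  thus ?thesis using that by blast
qed

text \<open>
  The lower vertex \<open>(\<alpha>, m)\<close> is a lattice point, and \<open>k \<alpha> = 2 - e (2 - k m)\<close>. As \<open>2 - k m\<close> is \<open>1\<close> or \<open>2\<close>, the
  number \<open>2 e\<close> is an integer. The number \<open>q\<close> is the denominator of \<open>e\<close>.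
\<close>
lemma half_integral_cases:
  fixes e w :: rat and a :: int
  assumes "0 \<le> e" "e < 1" "odd k" "of_nat k * w = 2 * (1 - e)" "2 * of_int a = w + e * of_nat (2 * b)"
    and "w + e * of_nat m = of_int \<alpha>" "k * m \<le> 1"
  obtains q :: nat where "q \<ge> 1" "of_nat q * e = of_nat q - 1" "of_nat q * w = 2" "k = 1"
proof -
  have "of_int (int k * \<alpha>) = of_nat k * (w + e * of_nat m)" using assms(6) by simp
  also have "\<dots> = 2 * (1 - e) + e * of_nat (k * m)" using assms(4) by (simp add: algebra_simps)
  finally have "e * of_nat (2 - k * m) = of_int (2 - int k * \<alpha>)"
    using assms(7) by (simp add: of_nat_diff algebra_simps)
  moreover have "k * m = 0 \<or> k * m = 1" using assms(7) by linarith
  ultimately have "e * 2 = of_int (2 - int k * \<alpha>) \<or> e * 2 = of_int (2 * (2 - int k * \<alpha>))" by auto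
  then obtain z :: int where z: "e * 2 = of_int z" by blast
  have "0 \<le> (of_int z :: rat)" "of_int z < (of_int 2 :: rat)" using z assms(1,2) by simp_all
  hence z01: "z = 0 \<or> z = 1" by (simp only: of_int_0_le_iff of_int_less_iff) auto
  have w: "w = of_int (2 * a - z * int b)" using assms(5) by (simp flip: z)
  have "of_int (int k * (2 * a - z * int b)) = of_nat k * w" by (simp add: w)
  also have "\<dots> = of_int (2 - z)" unfolding assms(4) using z by simp
  finally have "int k * (2 * a - z * int b) = 2 - z" by (simp only: of_int_eq_iff)
  hence "int k dvd 2 - z" by (metis dvd_triv_left)
  hence "int k dvd 2" using z01 by auto
  hence "k dvd 2" by presburger
  hence "k \<le> 2" by (rule dvd_imp_le) simp
  hence k1: "k = 1" using assms(3) by (cases "k = 2"; cases "k = 0") auto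
  hence w': "w = 2 * (1 - e)" using assms(4) by simp
  show ?thesis
  proof (cases "z = 0")
    case True
    thus ?thesis using that[of 1] z w' k1 by simp
  next
    case False
    hence "e = 1 / 2" using z01 z by simp
    thus ?thesis using that[of 2] w' k1 by simp
  qed
qed

text \<open>
  Induction over the integers between \<open>e\<close> and \<open>0\<close>: an edge with a single root \<open>z\<close> occurs at an integral
  \<open>e1 \<le> 0\<close> and is removed by a shear. Any other edge is of the type of \<open>doubled_edge_roots\<close>. It occurs at
  \<open>e1 \<ge> 0\<close>, and coordinates centred at a root of large multiplicity lead to
  \<open>no_edge_with_large_root_at_0\<close>.
\<close>
lemma no_laurent_pair:
  fixes P Q :: "'a::{alg_closed_field,field_char_0} fls poly"
  assumes "keller P Q c" "c \<noteq> 0"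
    and AC: "coprime A C" "A \<ge> 1" "C \<ge> 1"
    and ab: "coprime a (int b)" "1 \<le> a" "a \<le> int b" and d: "d = 1 \<or> d = 2"
    and "vertex_from e P (int A * (int d * a)) (A * (d * b))" "vertex_from e Q (int C * (int d * a)) (C * (d * b))"
    and "e < 1"
  shows False
  using assms(1,2) assms(10-12)
proof (induction "nat \<lceil>- e\<rceil>" arbitrary: P Q c e rule: less_induct)
  case less
  note keller = less.prems(1,2)
  have b1: "b \<ge> 1" using ab by linarith
  have d\<alpha>: "int d * a \<ge> 1" "int d * a \<le> int (d * b)" "d * b \<ge> 1" using ab d b1 by auto
  obtain e1 w r cP cQ where e1: "e < e1" "e1 < 1" "w = wt e1 (int d * a) (d * b)" "w > 0"
    and P: "wt_le e1 (of_nat A * w) P" "lform e1 (of_nat A * w) P = smult cP (r ^ A)" "cP \<noteq> 0"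
    and Q: "wt_le e1 (of_nat C * w) Q" "lform e1 (of_nat C * w) Q = smult cQ (r ^ C)" "cQ \<noteq> 0"
    and r: "degree r = d * b" "order 0 r < d * b"
    by (rule ex_next_edge[OF keller AC less.prems(3,4,5) _ d\<alpha>(2,3)]) (use d\<alpha>(1) in blast)+
  have r0: "r \<noteq> 0" "degree r \<ge> 1" using r d\<alpha>(3) by auto
  have nz: "smult cP (r ^ A) \<noteq> 0" "smult cQ (r ^ C) \<noteq> 0" using P(3) Q(3) r0 by simp_all
  have ordP: "order z (smult cP (r ^ A)) = A * order z r"
    and ordQ: "order z (smult cQ (r ^ C)) = C * order z r" for z
    using P(3) Q(3) r0 by (simp_all add: order_smult order_power)
  show False
  proof (cases "card (roots r) \<le> 1")
    case True
    obtain z where z: "e1 \<in> \<int>" "r = smult (lead_coeff r) ([:-z, 1:] ^ degree r)"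
      by (rule one_root_integral[OF P(2,3) AC(2) True]) (use r in auto)
    then obtain n where n: "e1 = - of_int n" by (metis Ints_cases minus_minus of_int_minus)
    have "of_int (- 1) < (of_int n :: rat)" using e1(2) n by simp
    hence n0: "0 \<le> n" by (simp only: of_int_less_iff)
    define s where "s = fls_shift n (fls_const z)"
    have y: "wt_le e1 (- (of_nat 1 * e1)) [:s, 1:]" "lform e1 (- (of_nat 1 * e1)) [:s, 1:] = [:z, 1:]"
      using homogeneous_binomial[of e1 0 n z] n by (simp_all add: s_def)
    have "order z r = order z (smult (lead_coeff r) ([:-z, 1:] ^ degree r))" by (rule arg_cong[OF z(2)])
    also have "\<dots> = degree r" using r0(1) by (subst order_smult) (simp_all add: order_power_n_n)
    finally have ord: "order z r = d * b" by (simp only: r(1))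
    note one = order_refl[of "1::nat"]
    have keller': "jac (laurent_subst 1 s 1 P) (laurent_subst 1 s 1 Q) = [:fls_const (of_nat 1 * c) * fls_X_inv:]"
      by (rule jac_subst[OF one keller(1)]) (simp add: fls_X_inv_conv_shift_1)
    have ints: "of_int (int n * (int d * a)) = of_nat n * w + e1 * of_nat (n * (d * b))" for n
      by (simp add: e1(3) algebra_simps)
    have vP: "vertex_from e1 (laurent_subst 1 s 1 P) (int A * (int d * a)) (A * (d * b))"
    proof (rule vertex_from_order)
      show "wt_le e1 (of_nat 1 * (of_nat A * w)) (laurent_subst 1 s 1 P)" by (rule wt_le_subst[OF one P(1) y])
      show "lform e1 (of_nat 1 * (of_nat A * w)) (laurent_subst 1 s 1 P) = pcompose (smult cP (r ^ A)) [:z, 1:]"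
        unfolding lform_subst[OF one P(1) y] P(2) ..
      show "pcompose (smult cP (r ^ A)) [:z, 1:] \<noteq> 0" using nz by (subst pcompose_eq_0_iff) auto
      show "order 0 (pcompose (smult cP (r ^ A)) [:z, 1:]) = A * (d * b)"
        unfolding order_0_translate[OF nz(1)] ordP ord ..
    qed (use ints in simp)
    have vQ: "vertex_from e1 (laurent_subst 1 s 1 Q) (int C * (int d * a)) (C * (d * b))"
    proof (rule vertex_from_order)
      show "wt_le e1 (of_nat 1 * (of_nat C * w)) (laurent_subst 1 s 1 Q)" by (rule wt_le_subst[OF one Q(1) y])
      show "lform e1 (of_nat 1 * (of_nat C * w)) (laurent_subst 1 s 1 Q) = pcompose (smult cQ (r ^ C)) [:z, 1:]"
        unfolding lform_subst[OF one Q(1) y] Q(2) ..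
      show "pcompose (smult cQ (r ^ C)) [:z, 1:] \<noteq> 0" using nz by (subst pcompose_eq_0_iff) auto
      show "order 0 (pcompose (smult cQ (r ^ C)) [:z, 1:]) = C * (d * b)"
        unfolding order_0_translate[OF nz(2)] ordQ ord ..
    qed (use ints in simp)
    have "of_int n < - e" using e1(1) n by simp
    hence "n < \<lceil>- e\<rceil>" by (simp add: less_ceiling_iff)
    moreover have "\<lceil>- e1\<rceil> = n" by (simp add: n)
    ultimately have "nat \<lceil>- e1\<rceil> < nat \<lceil>- e\<rceil>" using n0 by (simp only: nat_less_eq_zless)
    thus False using less.hyps[OF _ keller' _ vP vQ e1(2)] keller(2) by simp
  next
    case many: False
    have "\<not> d = 1"
    proof
      assume d1: "d = 1"
      have "of_int a = w + e1 * of_nat (degree r)" using e1(3) r(1) d1 by simp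
      moreover have "coprime a (int (degree r))" using ab(1) r(1) d1 by simp
      ultimately show False
        using primitive_edge_one_root[OF keller AC, of 1 e1 w cP r cQ a] P Q r0(2) e1(2,4) many by simp
    qed
    hence d2: "d = 2" using d by simp
    have deg: "degree r = 2 * b" using r(1) d2 by simp
    have prim: "2 * of_int a = w + e1 * of_nat (2 * b)" using e1(3) d2 by simp
    \<comment> \<open>if \<open>r\<close> were a square, the vertex of its square root would be primitive\<close>
    have nonsquare: "r \<noteq> smult k (\<sigma> ^ 2)" for k \<sigma>
    proof
      assume sq: "r = smult k (\<sigma> ^ 2)"
      hence k: "k \<noteq> 0" "\<sigma> \<noteq> 0" using r0 by auto
      have "degree r = 2 * degree \<sigma>" using k by (simp add: sq degree_power_eq)
      hence ds: "degree \<sigma> = b" using deg by simp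
      have "of_nat (2 * n) * (w / 2) = of_nat n * w" for n by simp
      moreover have "smult c0 (r ^ n) = smult (c0 * k ^ n) (\<sigma> ^ (2 * n))" for c0 n
        unfolding sq by (simp add: smult_power power_mult)
      moreover have "of_int a = w / 2 + e1 * of_nat (degree \<sigma>)" using prim ds by simp
      ultimately have "card (roots \<sigma>) \<le> 1"
        using primitive_edge_one_root[OF keller AC, of 2 e1 "w / 2" "cP * k ^ A" \<sigma> "cQ * k ^ C" a]
          P Q b1 ds k(1) e1(2,4) ab(1) by simp
      moreover have "roots \<sigma> = roots r" using k by (simp add: sq)
      ultimately show False using many by simp
    qed
    obtain k where k: "odd k" "of_nat k * w = 2 * (1 - e1)" "card (roots r) \<le> k * b"
      "\<And>z. poly r z = 0 \<Longrightarrow> k * order z r \<noteq> 2"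
      by (rule doubled_edge_roots[OF keller AC P Q deg b1 e1(4,2) prim ab(1) nonsquare]) (use many in auto)
    have k1: "k \<ge> 1" using k(1) by (cases k) auto
    \<comment> \<open>for \<open>e1 < 0\<close> the equation \<open>k (a - e1 b) = 1 - e1\<close> leaves only \<open>k = b = 1\<close>, hence at most one root\<close>
    have e10: "0 \<le> e1"
    proof (rule ccontr)
      assume neg: "\<not> 0 \<le> e1"
      define x where "x = wt e1 a b"
      have "w = 2 * x" using prim by (simp add: x_def)
      hence kx: "of_nat k * x = 1 - e1" using k(2) by simp
      have a1: "1 \<le> (of_int a :: rat)" using ab(2) by simp
      have eb: "e1 * of_nat b \<le> e1 * 1" using b1 neg by (intro mult_left_mono_neg) auto
      have x: "1 - e1 \<le> x" using a1 eb by (simp add: x_def)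
      have "k = 1"
      proof (rule ccontr)
        assume "k \<noteq> 1"
        hence "2 * x \<le> of_nat k * x" using k1 x e1(2) by (intro mult_right_mono) auto
        thus False using kx x e1(2) by linarith
      qed
      hence "x = 1 - e1" using kx by simp
      hence "e1 * of_nat b = e1 * 1" using a1 eb unfolding x_def by linarith
      hence "b = 1" using neg by (simp only: mult_cancel_left) auto
      thus False using k(3) many \<open>k = 1\<close> by simp
    qed
    have above: "w < (1 - e1) * of_nat (order z r)" if "k * order z r > 2" for z
    proof -
      have "of_nat 2 * w < of_nat (k * order z r) * w" using that e1(4) by (intro mult_strict_right_mono) (simp_all only: of_nat_less_iff)
      also have "\<dots> = (of_nat k * w) * of_nat (order z r)" by (simp add: mult_ac)
      finally have "2 * w < 2 * ((1 - e1) * of_nat (order z r))"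
        unfolding k(2) by (simp only: of_nat_numeral mult.assoc)
      thus ?thesis by (simp only: mult_less_cancel_left_pos zero_less_numeral)
    qed
    show False
    proof (cases "k * order 0 r > 2")
      case True
      show False by (rule no_edge_with_large_root_at_0[OF keller AC P Q deg b1 e1(4) e10 e1(2) prim ab(1) nonsquare above[OF True]])
    next
      case False
      have "k * order 0 r \<noteq> 2" using k(4)[of 0] r0(1) by (cases "order 0 r = 0") (auto simp: order_root)
      hence le1: "k * order 0 r \<le> 1" using False by simp
      obtain \<alpha> where \<alpha>: "w + e1 * of_nat (order 0 r) = of_int \<alpha>"
        using lower_vertex_integral[OF P(2,3) Q(2,3) r0(1) AC(1)] .
      obtain q :: nat where q: "q \<ge> 1" "of_nat q * e1 = of_nat q - 1" "of_nat q * w = 2" "k = 1"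
        using half_integral_cases[OF e10 e1(2) k(1,2) prim \<alpha> le1] .
      obtain z where z: "poly r z = 0" "k * order z r > 2" using ex_large_root[OF deg b1 k(1,3,4)] .
      \<comment> \<open>\<open>y = (\<eta> + z) X^(1 - q)\<close> moves the edge to the parameter \<open>0\<close>\<close>
      define j where "j = 1 - int q"
      define s where "s = fls_shift j (fls_const z)"
      define t :: "'a fls" where "t = fls_shift j 1"
      have y: "wt_le 0 (- (of_nat q * e1)) [:s, t:]" "lform 0 (- (of_nat q * e1)) [:s, t:] = [:z, 1:]"
        using homogeneous_binomial[of 0 j j z] q(2) by (simp_all add: s_def t_def j_def)
      have "fls_compose_power fls_X_inv q * t = fls_X_inv"
        using q(1) by (simp add: t_def j_def fls_X_inv_conv_shift_1 fls_shifted_times_simps)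
      note keller' = jac_subst[OF q(1) keller(1) this]
      define r' where "r' = pcompose r [:z, 1:]"
      have wts: "of_nat q * (of_nat n * w) = of_nat n * 2" for n using q(3) by (simp add: mult.left_commute)
      have P': "wt_le 0 (of_nat A * 2) (laurent_subst q s t P)" "lform 0 (of_nat A * 2) (laurent_subst q s t P) = smult cP (r' ^ A)"
        using wt_le_subst[OF q(1) P(1) y] lform_subst[OF q(1) P(1) y] unfolding P(2) wts r'_def
        by (simp_all add: pcompose_smult pcompose_power)
      have Q': "wt_le 0 (of_nat C * 2) (laurent_subst q s t Q)" "lform 0 (of_nat C * 2) (laurent_subst q s t Q) = smult cQ (r' ^ C)"
        using wt_le_subst[OF q(1) Q(1) y] lform_subst[OF q(1) Q(1) y] unfolding Q(2) wts r'_def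
        by (simp_all add: pcompose_smult pcompose_power)
      have nonsquare': "r' \<noteq> smult k (\<sigma> ^ 2)" for k \<sigma>
      proof
        assume "r' = smult k (\<sigma> ^ 2)"
        hence "pcompose r' [:-z, 1:] = smult k (pcompose \<sigma> [:-z, 1:] ^ 2)" by (simp add: pcompose_smult pcompose_power)
        thus False using nonsquare unfolding r'_def pcompose_translate_inverse by blast
      qed
      have "degree r' = 2 * b" using deg by (simp add: r'_def degree_pcompose)
      moreover have "order 0 r' > 2" using z(2) q(4) order_0_translate[OF r0(1), of z] by (simp add: r'_def)
      moreover have "of_nat q * c \<noteq> 0" using q(1) keller(2) by simp
      ultimately show False
        using no_edge_with_large_root_at_0[OF keller' _ AC P' P(3) Q' Q(3) _ b1, of 1] nonsquare' by simp
    qed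
  qed
qed

section \<open>Embedding the polynomial ring\<close>

text \<open>
  The two homomorphisms from \<open>k[x,y]\<close> used below, \<open>x \<mapsto> x, y \<mapsto> y\<close> and \<open>x \<mapsto> y, y \<mapsto> x\<close>, are instances of
  one evaluation map with arbitrary images \<open>X\<close> and \<open>Y\<close> of the variables.
\<close>
definition eval_x :: "'k::field_char_0 alg_closure fls poly \<Rightarrow> 'k poly \<Rightarrow> 'k alg_closure fls poly" where
  "eval_x X a = poly (map_poly (\<lambda>c. [:fls_const (to_ac c):]) a) X"

definition eval_xy :: "'k::field_char_0 alg_closure fls poly \<Rightarrow> 'k alg_closure fls poly \<Rightarrow> 'k poly_xy \<Rightarrow> 'k alg_closure fls poly" where
  "eval_xy X Y P = poly (map_poly (eval_x X) P) Y"

lemma eval_x_pCons: "eval_x X (pCons c a) = [:fls_const (to_ac c):] + X * eval_x X a"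
  by (simp add: eval_x_def map_poly_pCons)

lemma eval_x_0 [simp]: "eval_x X 0 = 0"
  by (simp add: eval_x_def)

lemma eval_xy_0 [simp]: "eval_xy X Y 0 = 0"
  by (simp add: eval_xy_def)

lemma eval_xy_pCons: "eval_xy X Y (pCons a P) = eval_x X a + Y * eval_xy X Y P"
  by (simp add: eval_xy_def map_poly_pCons)

lemma eval_x_add: "eval_x X (a + b) = eval_x X a + eval_x X b"
proof (induction a b rule: poly_induct2)
  case (pCons c a d b)
  thus ?case by (simp only: add_pCons eval_x_pCons to_ac_add fls_plus_const[symmetric]) (simp add: algebra_simps)
qed simp

lemma eval_x_smult: "eval_x X (smult c a) = [:fls_const (to_ac c):] * eval_x X a"
proof (induction a)
  case (pCons d a)
  have "[:fls_const (to_ac (c * d)):] = [:fls_const (to_ac c):] * [:fls_const (to_ac d):]"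
    by (simp add: mult.commute)
  thus ?case by (simp only: smult_pCons eval_x_pCons pCons.IH) (simp only: algebra_simps)
qed simp

lemma eval_x_mult: "eval_x X (a * b) = eval_x X a * eval_x X b"
proof (induction a)
  case (pCons c a)
  have "eval_x X (pCons c a * b) = [:fls_const (to_ac c):] * eval_x X b + X * (eval_x X a * eval_x X b)"
    by (simp only: mult_pCons_left eval_x_add eval_x_smult eval_x_pCons pCons.IH) simp
  thus ?case by (simp only: eval_x_pCons distrib_right mult.assoc)
qed simp

lemma eval_xy_add: "eval_xy X Y (P + Q) = eval_xy X Y P + eval_xy X Y Q"
proof (induction P Q rule: poly_induct2)
  case (pCons a P b Q)
  thus ?case by (simp only: add_pCons eval_xy_pCons eval_x_add) (simp only: algebra_simps)
qed simp

lemma eval_xy_diff: "eval_xy X Y (P - Q) = eval_xy X Y P - eval_xy X Y Q"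
  using eval_xy_add[of X Y "P - Q" Q] by simp

lemma eval_xy_smult: "eval_xy X Y (smult a P) = eval_x X a * eval_xy X Y P"
proof (induction P)
  case (pCons b P)
  thus ?case by (simp only: smult_pCons eval_xy_pCons eval_x_mult) (simp only: algebra_simps)
qed simp

lemma eval_xy_mult: "eval_xy X Y (P * Q) = eval_xy X Y P * eval_xy X Y Q"
proof (induction P)
  case (pCons a P)
  have "eval_xy X Y (pCons a P * Q) = eval_x X a * eval_xy X Y Q + Y * (eval_xy X Y P * eval_xy X Y Q)"
    by (simp only: mult_pCons_left eval_xy_add eval_xy_smult eval_xy_pCons pCons.IH) simp
  thus ?case by (simp only: eval_xy_pCons distrib_right mult.assoc)
qed simp

lemma deriv_x_pCons: "deriv_x (pCons a P) = pCons (pderiv a) (deriv_x P)"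
  by (simp add: deriv_x_def map_poly_pCons)

lemma chain_rule:
  assumes add: "\<And>f g. \<delta> (f + g) = \<delta> f + \<delta> g" and mult: "\<And>f g. \<delta> (f * g) = f * \<delta> g + \<delta> f * g"
    and const: "\<And>c. \<delta> [:fls_const c:] = 0"
  shows "\<delta> (eval_xy X Y P) = eval_xy X Y (deriv_x P) * \<delta> X + eval_xy X Y (deriv_y P) * \<delta> Y"
proof -
  have z: "\<delta> 0 = 0" using const[of 0] by simp
  have x: "\<delta> (eval_x X a) = eval_x X (pderiv a) * \<delta> X" for a
  proof (induction a)
    case (pCons c a)
    have "eval_x X (pCons 0 (pderiv a)) = X * eval_x X (pderiv a)" by (simp add: eval_x_pCons)
    thus ?case
      by (simp only: eval_x_pCons[of X c a] add mult const pderiv_pCons eval_x_add pCons.IH) (simp add: algebra_simps)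
  qed (simp add: z)
  show ?thesis
  proof (induction P)
    case (pCons a P)
    have "eval_xy X Y (pCons 0 (deriv_y P)) = Y * eval_xy X Y (deriv_y P)" by (simp add: eval_xy_pCons)
    moreover have "deriv_y (pCons a P) = P + pCons 0 (deriv_y P)" by (simp add: deriv_y_def pderiv_pCons)
    ultimately show ?case
      by (simp only: eval_xy_pCons[of X Y a P] eval_xy_pCons[of X Y "pderiv a"] add mult x deriv_x_pCons eval_xy_add pCons.IH)
        (simp only: algebra_simps)
  qed (simp add: z deriv_x_def deriv_y_def)
qed

lemma jac_eval_xy: "jac (eval_xy X Y P) (eval_xy X Y Q) = eval_xy X Y (Jac P Q) * jac X Y"
proof -
  have c1: "xd (eval_xy X Y P) = eval_xy X Y (deriv_x P) * xd X + eval_xy X Y (deriv_y P) * xd Y" for P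
    by (rule chain_rule) (simp_all add: xd_mult)
  have c2: "pderiv (eval_xy X Y P) = eval_xy X Y (deriv_x P) * pderiv X + eval_xy X Y (deriv_y P) * pderiv Y" for P
    by (rule chain_rule) (simp_all add: pderiv_add pderiv_mult)
  show ?thesis
    by (simp only: jac_def c1 c2 Jac_def eval_xy_diff eval_xy_mult) (simp only: algebra_simps)
qed

lemma eval_xy_const_xy: "eval_xy X Y (const_xy c) = [:fls_const (to_ac c):]"
  by (simp add: const_xy_def eval_xy_pCons eval_x_pCons)

lemma mon_eval_xy:
  "mon (eval_xy [:fls_X_inv:] [:0, 1:] P) i j = (if i \<ge> 0 then to_ac (coeff (coeff P j) (nat i)) else 0)"
proof -
  have g: "\<exists>g. eval_x [:fls_X_inv:] a = [:g:] \<and> (\<forall>n. g $$ n = (if n \<le> 0 then to_ac (coeff a (nat (- n))) else 0))" for a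
  proof (induction a)
    case 0
    show ?case by (rule exI[of _ 0]) simp
  next
    case (pCons c a)
    then obtain g where g: "eval_x [:fls_X_inv:] a = [:g:]" "\<And>n. g $$ n = (if n \<le> 0 then to_ac (coeff a (nat (- n))) else 0)" by blast
    have "(fls_const (to_ac c) + fls_X_inv * g) $$ n = (if n \<le> 0 then to_ac (coeff (pCons c a) (nat (- n))) else 0)" for n
    proof -
      consider "n > 0" | "n = 0" | "n < 0" by linarith
      thus ?thesis
      proof cases
        case 3
        hence "nat (- n) = Suc (nat (- (n + 1)))" by simp
        thus ?thesis using 3 by (simp add: fls_X_inv_times_conv_shift g(2))
      qed (simp_all add: fls_X_inv_times_conv_shift g(2))
    qed
    thus ?case using g(1) by (intro exI[of _ "fls_const (to_ac c) + fls_X_inv * g"]) (simp add: eval_x_pCons)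
  qed
  have "coeff (eval_xy [:fls_X_inv:] [:0, 1:] P) j $$ n = (if n \<le> 0 then to_ac (coeff (coeff P j) (nat (- n))) else 0)" for n
  proof (induction P arbitrary: j)
    case (pCons a P)
    obtain h where h: "eval_x [:fls_X_inv:] a = [:h:]" "\<And>n. h $$ n = (if n \<le> 0 then to_ac (coeff a (nat (- n))) else 0)"
      using g by blast
    show ?case using pCons.IH by (cases j) (simp_all add: eval_xy_pCons h)
  qed simp
  thus ?thesis by (simp add: mon_def)
qed

lemma mon_eval_yx:
  "mon (eval_xy [:0, 1:] [:fls_X_inv:] P) i j = (if i \<ge> 0 then to_ac (coeff (coeff P (nat i)) j) else 0)"
proof -
  have e: "coeff (eval_x [:0, 1:] a) j = fls_const (to_ac (coeff a j))" for a :: "'a poly" and j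
  proof (induction a arbitrary: j)
    case (pCons c a)
    thus ?case by (cases j) (simp_all add: eval_x_pCons)
  qed simp
  have "coeff (eval_xy [:0, 1:] [:fls_X_inv:] P) j $$ n = (if n \<le> 0 then to_ac (coeff (coeff P (nat (- n))) j) else 0)" for n
  proof (induction P arbitrary: n)
    case (pCons a P)
    consider "n > 0" | "n = 0" | "n < 0" by linarith
    thus ?case
    proof cases
      case 3
      hence "nat (- n) = Suc (nat (- (n + 1)))" by simp
      thus ?thesis using 3 pCons.IH[of "n + 1"] by (simp add: eval_xy_pCons e fls_X_inv_times_conv_shift)
    qed (use pCons.IH[of "n + 1"] in \<open>simp_all add: eval_xy_pCons e fls_X_inv_times_conv_shift\<close>)
  qed simp
  thus ?thesis by (simp add: mon_def)
qed

text \<open>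
  In the direction \<open>(1, N)\<close> with \<open>N\<close> above all degrees in \<open>x\<close>, the only heaviest monomial is the corner
  formed by the leading coefficients.
\<close>
lemma corner_dominates:
  fixes P :: "'k::zero poly poly"
  assumes "coeff (coeff P j) i \<noteq> 0" "\<And>j. degree (coeff P j) < N"
  shows "i + N * j \<le> degree (lead_coeff P) + N * degree P"
    and "j < degree P \<or> i < degree (lead_coeff P) \<Longrightarrow> i + N * j < degree (lead_coeff P) + N * degree P"
proof -
  have j: "j \<le> degree P" using assms(1) by (intro le_degree) auto
  have i: "i \<le> degree (coeff P j)" using assms(1) by (intro le_degree)
  have lt: "i + N * j < degree (lead_coeff P) + N * degree P" if "j < degree P"
  proof -
    have "i + N * j < N * Suc j" using i assms(2)[of j] by simp
    also have "\<dots> \<le> N * degree P" using that by (intro mult_le_mono2) simp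
    finally show ?thesis by simp
  qed
  show "i + N * j \<le> degree (lead_coeff P) + N * degree P" using lt i j by (cases "j = degree P") auto
  show "j < degree P \<or> i < degree (lead_coeff P) \<Longrightarrow> i + N * j < degree (lead_coeff P) + N * degree P"
    using lt i j by (cases "j = degree P") auto
qed

lemma vertex_eval_xy:
  assumes "P \<noteq> 0" "\<And>j. degree (coeff P j) < N"
  shows "vertex_from (- of_nat N) (eval_xy [:fls_X_inv:] [:0, 1:] P) (int (degree (lead_coeff P))) (degree P)"
proof -
  have *: "of_int i - (- of_nat N) * of_nat j = (of_nat (nat i + N * j) :: rat)" if "i \<ge> 0" for i :: int and j
    using that by simp
  show ?thesis
    unfolding vertex_from_def wt_le_def
  proof (intro conjI allI impI)
    show "mon (eval_xy [:fls_X_inv:] [:0, 1:] P) (int (degree (lead_coeff P))) (degree P) \<noteq> 0"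
      using assms(1) by (simp add: mon_eval_xy)
    fix i j assume nz: "mon (eval_xy [:fls_X_inv:] [:0, 1:] P) i j \<noteq> 0"
    hence i: "i \<ge> 0" "coeff (coeff P j) (nat i) \<noteq> 0" by (auto simp: mon_eval_xy split: if_splits)
    note D = corner_dominates[OF i(2) assms(2)]
    show "of_int i - (- of_nat N) * of_nat j \<le> of_int (int (degree (lead_coeff P))) - (- of_nat N) * (of_nat (degree P) :: rat)"
      unfolding *[OF i(1)] *[OF of_nat_0_le_iff] of_nat_le_iff using D(1) by simp
    assume "j < degree P"
    thus "of_int i - (- of_nat N) * of_nat j < of_int (int (degree (lead_coeff P))) - (- of_nat N) * (of_nat (degree P) :: rat)"
      unfolding *[OF i(1)] *[OF of_nat_0_le_iff] of_nat_less_iff using D(2) by simp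
  qed
qed

text \<open>
  After exchanging the variables, the direction \<open>(1, N)\<close> corresponds to the parameter \<open>- 1 / N\<close>.
\<close>
lemma vertex_eval_yx:
  assumes "P \<noteq> 0" "\<And>j. degree (coeff P j) < N" "N \<ge> 1"
  shows "vertex_from (- (1 / of_nat N)) (eval_xy [:0, 1:] [:fls_X_inv:] P) (int (degree P)) (degree (lead_coeff P))"
proof -
  have *: "of_int i - (- (1 / of_nat N)) * of_nat j = (of_nat (j + N * nat i) / of_nat N :: rat)" if "i \<ge> 0" for i :: int and j
  proof -
    have 1: "(of_int i :: rat) = of_nat (nat i)" using that by simp
    have 2: "(of_nat N :: rat) \<noteq> 0" using assms(3) by simp
    have "(of_nat (j + N * m) / of_nat N :: rat) = of_nat j / of_nat N + of_nat m" for m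
      unfolding of_nat_add of_nat_mult add_divide_distrib using 2 by simp
    thus ?thesis unfolding 1 by simp
  qed
  have N: "(0::rat) < of_nat N" using assms(3) by simp
  show ?thesis
    unfolding vertex_from_def wt_le_def
  proof (intro conjI allI impI)
    show "mon (eval_xy [:0, 1:] [:fls_X_inv:] P) (int (degree P)) (degree (lead_coeff P)) \<noteq> 0"
      using assms(1) by (simp add: mon_eval_yx)
    fix i j assume nz: "mon (eval_xy [:0, 1:] [:fls_X_inv:] P) i j \<noteq> 0"
    hence i: "i \<ge> 0" "coeff (coeff P (nat i)) j \<noteq> 0" by (auto simp: mon_eval_yx split: if_splits)
    note D = corner_dominates[OF i(2) assms(2)]
    show "of_int i - (- (1 / of_nat N)) * of_nat j \<le> of_int (int (degree P)) - (- (1 / of_nat N)) * (of_nat (degree (lead_coeff P)) :: rat)"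
      unfolding *[OF i(1)] *[OF of_nat_0_le_iff] divide_le_cancel of_nat_le_iff using D(1) N by simp
    assume "j < degree (lead_coeff P)"
    thus "of_int i - (- (1 / of_nat N)) * of_nat j < of_int (int (degree P)) - (- (1 / of_nat N)) * (of_nat (degree (lead_coeff P)) :: rat)"
      unfolding *[OF i(1)] *[OF of_nat_0_le_iff] divide_less_cancel of_nat_less_iff using D(2) N by simp
  qed
qed

lemma ex_degree_bound:
  fixes P Q :: "'k::zero poly poly"
  obtains N where "\<And>j. degree (coeff P j) < N" "\<And>j. degree (coeff Q j) < N" "N \<ge> 1"
proof -
  have fin: "finite (range (\<lambda>j. degree (coeff P j)))" for P :: "'k poly poly"
  proof (rule finite_subset)
    show "range (\<lambda>j. degree (coeff P j)) \<subseteq> insert 0 ((\<lambda>j. degree (coeff P j)) ` {..degree P})"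
      by (auto simp: image_iff) (metis atMost_iff coeff_eq_0 degree_0 not_le)
  qed simp
  define N where "N = Suc (Max (range (\<lambda>j. degree (coeff P j)) \<union> range (\<lambda>j. degree (coeff Q j))))"
  show ?thesis
  proof (rule that[of N])
    show "degree (coeff P j) < N" for j unfolding N_def less_Suc_eq_le using fin by (intro Max_ge) auto
    show "degree (coeff Q j) < N" for j unfolding N_def less_Suc_eq_le using fin by (intro Max_ge) auto
  qed (simp add: N_def)
qed

text \<open>
  The corner \<open>d (a, b)\<close> or its mirror image is on or above the diagonal. In the second case the polygon is
  traversed in the opposite sense, starting from the same corner.
\<close>
lemma no_jacobian_pair:
  fixes P Q :: "'k::field_char_0 poly_xy"
  assumes J: "Jac P Q = const_xy c" "c \<noteq> 0"
    and AC: "coprime A C" "A \<ge> 1" "C \<ge> 1" and ab: "coprime a b" "a \<ge> 1" "b \<ge> 1" and d: "d = 1 \<or> d = 2"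
    and P: "degree P = A * d * b" "degree (lead_coeff P) = A * d * a"
    and Q: "degree Q = C * d * b" "degree (lead_coeff Q) = C * d * a"
  shows False
proof -
  obtain N where N: "\<And>j. degree (coeff P j) < N" "\<And>j. degree (coeff Q j) < N" "N \<ge> 1" using ex_degree_bound[of P Q] by blast
  have nz: "P \<noteq> 0" "Q \<noteq> 0" using P(1) Q(1) AC ab d by auto
  have xd_x: "fls_xd fls_X_inv = fls_X_inv" by (intro fls_eqI) (simp add: fls_xd_nth)
  have "(0::rat) < of_nat N" "(0::rat) < 1 / of_nat N" using N(3) by simp_all
  hence lt1: "- of_nat N < (1::rat)" "- (1 / of_nat N) < (1::rat)" by linarith+
  have e: "int A * (int d * int a) = int (degree (lead_coeff P))" "int C * (int d * int a) = int (degree (lead_coeff Q))"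
    "A * (d * a) = degree (lead_coeff P)" "C * (d * a) = degree (lead_coeff Q)" unfolding P(2) Q(2) by simp_all
  have e': "int A * (int d * int b) = int (degree P)" "int C * (int d * int b) = int (degree Q)"
    "A * (d * b) = degree P" "C * (d * b) = degree Q" unfolding P(1) Q(1) by simp_all
  show False
  proof (cases "a \<le> b")
    case True
    have "jac [:fls_X_inv :: 'k alg_closure fls:] [:0, 1:] = [:fls_X_inv:]" by (simp add: jac_def xd_x pderiv_pCons)
    hence keller: "jac (eval_xy [:fls_X_inv:] [:0, 1:] P) (eval_xy [:fls_X_inv:] [:0, 1:] Q) = [:fls_const (to_ac c) * fls_X_inv:]"
      by (simp add: jac_eval_xy J eval_xy_const_xy)
    show False
    proof (rule no_laurent_pair[OF keller _ AC _ _ _ d _ _ lt1(1)])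
      show "vertex_from (- of_nat N) (eval_xy [:fls_X_inv:] [:0, 1:] P) (int A * (int d * int a)) (A * (d * b))"
        unfolding e e' by (rule vertex_eval_xy[OF nz(1) N(1)])
      show "vertex_from (- of_nat N) (eval_xy [:fls_X_inv:] [:0, 1:] Q) (int C * (int d * int a)) (C * (d * b))"
        unfolding e e' by (rule vertex_eval_xy[OF nz(2) N(2)])
    qed (use ab True J(2) in auto)
  next
    case False
    have "jac [:0, 1:] [:fls_X_inv :: 'k alg_closure fls:] = - [:fls_X_inv:]" by (simp add: jac_def xd_x pderiv_pCons)
    hence keller: "jac (eval_xy [:0, 1:] [:fls_X_inv:] P) (eval_xy [:0, 1:] [:fls_X_inv:] Q) = [:fls_const (- to_ac c) * fls_X_inv:]"
      by (simp add: jac_eval_xy J eval_xy_const_xy)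
    show False
    proof (rule no_laurent_pair[OF keller _ AC _ _ _ d _ _ lt1(2)])
      show "vertex_from (- (1 / of_nat N)) (eval_xy [:0, 1:] [:fls_X_inv:] P) (int A * (int d * int b)) (A * (d * a))"
        unfolding e e' by (rule vertex_eval_yx[OF nz(1) N(1,3)])
      show "vertex_from (- (1 / of_nat N)) (eval_xy [:0, 1:] [:fls_X_inv:] Q) (int C * (int d * int b)) (C * (d * a))"
        unfolding e e' by (rule vertex_eval_yx[OF nz(2) N(2,3)])
    qed (use ab False J(2) in \<open>auto simp: coprime_commute\<close>)
  qed
qed

section \<open>Reduction to small common divisors\<close>

lemma coeff_deriv_x: "coeff (deriv_x P) j = pderiv (coeff P j)"
  by (simp add: deriv_x_def coeff_map_poly)

lemma deriv_x_mult: "deriv_x (P * Q) = P * deriv_x Q + deriv_x P * Q"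
proof (rule poly_eqI)
  fix n
  have "pderiv (\<Sum>i\<in>S. h i) = (\<Sum>i\<in>S. pderiv (h i))" for S and h :: "nat \<Rightarrow> 'a poly"
    by (induction S rule: infinite_finite_induct) (simp_all add: pderiv_add)
  thus "coeff (deriv_x (P * Q)) n = coeff (P * deriv_x Q + deriv_x P * Q) n"
    by (simp add: coeff_deriv_x coeff_mult pderiv_mult sum.distrib) (simp add: mult.commute)
qed

lemma deriv_x_diff: "deriv_x (P - Q) = deriv_x P - deriv_x Q"
  by (rule poly_eqI) (simp add: coeff_deriv_x pderiv_diff)

lemma Jac_swap: "Jac Q P = - Jac P Q"
  by (simp add: Jac_def algebra_simps)

lemma Jac_mult_right: "Jac P (Q * R) = Q * Jac P R + Jac P Q * R"
  by (simp add: Jac_def deriv_x_mult deriv_y_def pderiv_mult algebra_simps)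

lemma Jac_const_xy [simp]: "Jac P (const_xy c) = 0"
  by (simp add: Jac_def const_xy_def deriv_x_def deriv_y_def map_poly_pCons)

lemma Jac_power_self [simp]: "Jac P (P ^ n) = 0"
proof (induction n)
  case 0
  show ?case using Jac_const_xy[of P 1] by (simp add: const_xy_def flip: one_pCons)
next
  case (Suc n)
  have "Jac P P = 0" by (simp add: Jac_def)
  thus ?case using Suc by (simp add: Jac_mult_right)
qed

lemma coeff_mult_degree_le:
  assumes "degree p \<le> n" "degree q \<le> m"
  shows "coeff (p * q) (n + m) = coeff p n * coeff q m"
proof -
  have "coeff (p * q) (n + m) = (\<Sum>i\<le>n + m. if i = n then coeff p n * coeff q m else 0)"
    unfolding coeff_mult
  proof (intro sum.cong refl)
    fix i
    show "coeff p i * coeff q (n + m - i) = (if i = n then coeff p n * coeff q m else 0)"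
      using assms coeff_eq_0[of p i] coeff_eq_0[of q "n + m - i"] by (cases i n rule: linorder_cases) auto
  qed
  thus ?thesis by simp
qed

text \<open>
  The left side is the coefficient of the highest possible power of \<open>y\<close> in \<open>y Jac P Q\<close>, up to sign.
\<close>
lemma wron_lead_coeffs:
  fixes P Q :: "'k::field_char_0 poly_xy"
  assumes "Jac P Q = const_xy c" "degree P + degree Q \<ge> 2"
  shows "wron (of_nat (degree P)) (of_nat (degree Q)) (lead_coeff P) (lead_coeff Q) = 0"
proof -
  let ?n = "degree P" and ?r = "degree Q"
  define y where "y = pCons 0 (1 :: 'k poly poly)"
  have ey: "coeff (y * deriv_y R) j = of_nat j * coeff R j" for R :: "'k poly_xy" and j
    by (cases j) (simp_all add: y_def deriv_y_def coeff_pderiv)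
  have dy: "degree (y * deriv_y R) \<le> degree R" for R :: "'k poly_xy"
    by (rule degree_le) (auto simp: ey coeff_eq_0)
  have dx: "degree (deriv_x R) \<le> degree R" for R :: "'k poly_xy"
    by (rule degree_le) (auto simp: coeff_deriv_x coeff_eq_0)
  have "y * Jac P Q = deriv_x P * (y * deriv_y Q) - (y * deriv_y P) * deriv_x Q"
    by (simp add: Jac_def algebra_simps)
  hence "coeff (y * Jac P Q) (?n + ?r) = pderiv (lead_coeff P) * (of_nat ?r * lead_coeff Q) - of_nat ?n * lead_coeff P * pderiv (lead_coeff Q)"
    by (simp only: coeff_diff coeff_mult_degree_le[OF dx dy] coeff_mult_degree_le[OF dy dx] ey coeff_deriv_x)
  moreover have "coeff (y * Jac P Q) (?n + ?r) = 0"
    using assms(2) by (simp add: assms(1) y_def const_xy_def coeff_pCons split: nat.splits)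
  ultimately have "of_nat ?n * (lead_coeff P * pderiv (lead_coeff Q)) = of_nat ?r * (pderiv (lead_coeff P) * lead_coeff Q)"
    by (simp add: algebra_simps)
  thus ?thesis by (simp add: wron_def of_nat_poly)
qed

text \<open>
  If the gcd of \<open>A\<close> and \<open>C\<close> exceeds \<open>2\<close>, it is \<open>A\<close>. Then the leading coefficient of \<open>Q\<close> is a multiple of a
  power of that of \<open>P\<close>, and subtracting this power of \<open>P\<close> from \<open>Q\<close> keeps the Jacobian. The new corner of
  \<open>Q\<close> is on the same ray, by \<open>wron_lead_coeffs\<close>, but closer to the origin.
\<close>
lemma no_jacobian_pair_prime_or_4:
  fixes P Q :: "'k::field_char_0 poly_xy"
  assumes "Jac P Q = const_xy c" "c \<noteq> 0" and A: "A = 1 \<or> A = 4 \<or> prime A" and "C \<ge> 1"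
    and ab: "coprime a b" "a \<ge> 1" "b \<ge> 1"
    and P: "degree P = A * b" "degree (lead_coeff P) = A * a"
    and "degree Q = C * b" "degree (lead_coeff Q) = C * a"
  shows False
  using assms(1,4) assms(10,11)
proof (induction C arbitrary: Q rule: less_induct)
  case (less C)
  note J = less.prems(1) and Q = less.prems(3,4)
  have A1: "A \<ge> 1" using A prime_ge_1_nat[of A] by auto
  define g where "g = gcd A C"
  have g1: "g \<ge> 1" using A1 unfolding g_def by (simp add: Suc_le_eq)
  obtain A' C' where AC': "A = A' * g" "C = C' * g" "coprime A' C'"
    using gcd_coprime_exists[of A C] g1 unfolding g_def by (metis not_one_le_zero)
  show False
  proof (cases "g = 1 \<or> g = 2")
    case True
    have "A' \<ge> 1" "C' \<ge> 1" using AC' A1 less.prems(2) by (auto simp: Suc_le_eq)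
    thus False using no_jacobian_pair[OF J assms(2) AC'(3) _ _ ab True] P Q AC' by simp
  next
    case False
    have "g dvd A" by (simp add: g_def)
    have "g = A"
    proof (cases "A = 4")
      case True
      hence "g dvd 2 ^ 2" using \<open>g dvd A\<close> by simp
      then obtain i where "i \<le> 2" "g = 2 ^ i" by (metis divides_primepow_nat two_is_prime_nat)
      thus ?thesis using False True by (cases "i = 0"; cases "i = 1"; cases "i = 2") auto
    next
      case nA: False
      thus ?thesis using A \<open>g dvd A\<close> False by (metis One_nat_def nat_dvd_1_iff_1 prime_nat_iff)
    qed
    hence "A dvd C" by (metis g_def gcd_dvd2)
    then obtain m where m: "C = A * m" by (elim dvdE)
    have A3: "A \<ge> 3" using \<open>g = A\<close> False g1 by simp
    have m1: "m \<ge> 1" using m less.prems(2) by (cases m) auto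
    have nP: "degree P \<ge> 3" using P A3 ab mult_le_mono[of 3 A 1 b] by simp
    have "degree Q \<noteq> 0" using less.prems(2) ab(3) unfolding Q(1) by simp
    hence "P \<noteq> 0" "Q \<noteq> 0" using nP by auto
    hence nz: "P \<noteq> 0" "lead_coeff P \<noteq> 0" "lead_coeff Q \<noteq> 0" by simp_all
    have "wron (of_nat (degree P)) (of_nat (degree Q)) (lead_coeff P) (lead_coeff Q) = 0"
      using wron_lead_coeffs[OF J] nP by simp
    moreover have "of_nat (degree Q) = of_nat m * (of_nat (degree P) :: rat)" by (simp add: P Q m)
    ultimately obtain \<mu> where \<mu>: "lead_coeff Q = smult \<mu> (lead_coeff P ^ m)"
      using commuting_power[OF nz(2,3), of "of_nat (degree P)" "of_nat (degree Q)" m] nP by auto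
    define Q' where "Q' = Q - const_xy \<mu> * P ^ m"
    have J': "Jac P Q' = const_xy c"
    proof -
      have "Jac P Q' = Jac P Q - Jac P (const_xy \<mu> * P ^ m)"
        by (simp add: Q'_def Jac_def deriv_x_diff deriv_y_def pderiv_diff algebra_simps)
      thus ?thesis using J by (simp add: Jac_mult_right)
    qed
    have eq: "const_xy \<mu> * P ^ m = smult [:\<mu>:] (P ^ m)" by (simp add: const_xy_def)
    have dPm: "degree (P ^ m) = C * b" using nz(1) by (simp add: degree_power_eq P m)
    have "coeff (P ^ m) (C * b) = lead_coeff P ^ m"
      using lead_coeff_power[of P m] unfolding dPm .
    hence c0: "coeff Q' (C * b) = 0" using \<mu> by (simp add: Q'_def eq Q)
    have "degree Q' \<le> C * b" unfolding Q'_def eq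
      using dPm Q(1) by (intro degree_diff_le) (auto intro: order_trans[OF degree_smult_le])
    moreover have Q'0: "Q' \<noteq> 0" using J' assms(2) by (auto simp: Jac_def deriv_x_def deriv_y_def const_xy_def)
    ultimately have lt: "degree Q' < C * b" using c0 by (metis leading_coeff_0_iff le_neq_implies_less)
    have "wron (of_nat (degree P)) (of_nat (degree Q')) (lead_coeff P) (lead_coeff Q') = 0"
      using wron_lead_coeffs[OF J'] nP by simp
    hence "of_nat (degree P) * of_nat (degree (lead_coeff Q')) = of_nat (degree Q') * (of_nat (degree (lead_coeff P)) :: rat)"
      using nz(2) Q'0 by (intro degree_commuting) auto
    hence "degree P * degree (lead_coeff Q') = degree Q' * degree (lead_coeff P)" by (metis of_nat_eq_iff of_nat_mult)
    hence "A * (b * degree (lead_coeff Q')) = A * (degree Q' * a)"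
      unfolding P(2) unfolding P(1) by (simp only: mult_ac)
    hence par: "b * degree (lead_coeff Q') = degree Q' * a" using A1 by simp
    hence "b dvd degree Q' * a" by (metis dvd_triv_left)
    hence "b dvd degree Q'" using ab(1) by (simp add: coprime_commute coprime_dvd_mult_left_iff)
    then obtain C2 where C2: "degree Q' = C2 * b" by (metis dvdE mult.commute)
    hence lead2: "degree (lead_coeff Q') = C2 * a" using par ab(3) by (simp add: mult_ac)
    have "C2 < C" using lt C2 by simp
    moreover have "C2 \<ge> 1"
    proof (rule ccontr)
      assume "\<not> C2 \<ge> 1"
      hence "C2 = 0" by simp
      hence "degree Q' = 0" "degree (coeff Q' 0) = 0" using C2 lead2 by simp_all
      then obtain k where "Q' = const_xy k" unfolding const_xy_def by (metis degree_eq_zeroE coeff_pCons_0)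
      hence "const_xy c = 0" using J' by simp
      thus False using assms(2) by (simp add: const_xy_def)
    qed
    ultimately show False using less.IH J' C2 lead2 by blast
  qed
qed

theorem theorem2p6:
  fixes f :: "'k::field_char_0 poly_xy \<Rightarrow> 'k poly_xy"
    and p q :: "'k poly_xy"
    and n r u v A C n' u' r' v' :: nat
  assumes "algebra_endomorphism f"
    and "f var_x = p" and "f var_y = q"
    and "\<exists>c. c \<noteq> 0 \<and> Jac p q = const_xy c"
    and "n = degree p" and "r = degree q"
    and "u = degree (coeff p n)" and "v = degree (coeff q r)"
    and "A = gcd n u" and "C = gcd r v"
    and "n = A * n'" and "u = A * u'"
    and "r = C * r'" and "v = C * v'"
    and "u * v \<noteq> 0"
    and "u' = v'" and "n' = r'"
    and "A \<in> {1, 4} \<union> {l. prime l} \<or> C \<in> {1, 4} \<union> {l. prime l} \<or> gcd A C \<in> {1, 2}"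
  shows "algebra_automorphism f"
proof -
  obtain c where c: "c \<noteq> 0" "Jac p q = const_xy c" using assms(4) by blast
  have A1: "A \<ge> 1" "u' \<ge> 1" using assms(12,15) by (cases A; cases u'; simp)+
  have C1: "C \<ge> 1" using assms(14,15) by (cases C) auto
  have P: "degree p = A * n'" "degree (lead_coeff p) = A * u'" using assms(5,7,11,12) by simp_all
  have Q: "degree q = C * n'" "degree (lead_coeff q) = C * u'" using assms(6,8,13,14,16,17) by simp_all
  have n1: "n' \<ge> 1"
  proof (rule ccontr)
    assume "\<not> n' \<ge> 1"
    hence "n' = 0" by simp
    hence "degree p = 0" "degree q = 0" unfolding P Q by simp_all
    hence "deriv_y p = 0" "deriv_y q = 0" by (simp_all add: deriv_y_def pderiv_eq_0_iff)
    thus False using c by (simp add: Jac_def const_xy_def)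
  qed
  have "A * gcd n' u' = A" using assms(9,11,12) by (metis gcd_mult_distrib_nat)
  hence cop: "coprime u' n'" using A1 by (simp add: coprime_iff_gcd_eq_1 gcd.commute)
  have c': "Jac q p = const_xy (- c)" "- c \<noteq> 0" using c by (simp_all add: Jac_swap[of q p] const_xy_def)
  consider "A = 1 \<or> A = 4 \<or> prime A" | "C = 1 \<or> C = 4 \<or> prime C" | "gcd A C = 1 \<or> gcd A C = 2"
    using assms(18) by blast
  hence False
  proof cases
    case 1
    thus ?thesis using no_jacobian_pair_prime_or_4[OF c(2,1) _ C1 cop A1(2) n1 P Q] by blast
  next
    case 2
    thus ?thesis using no_jacobian_pair_prime_or_4[OF c' _ A1(1) cop A1(2) n1 Q P] by blast
  next
    case 3
    obtain A' C' where AC': "A = A' * gcd A C" "C = C' * gcd A C" "coprime A' C'"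
      using gcd_coprime_exists[of A C] A1 by (metis gcd_eq_0_iff not_one_le_zero)
    have "A' \<ge> 1" "C' \<ge> 1" using AC'(1,2) A1 C1 by (cases A'; cases C'; simp)+
    thus ?thesis using no_jacobian_pair[OF c(2,1) AC'(3) _ _ cop A1(2) n1 3] P Q AC'(1,2) by metis
  qed
  thus ?thesis ..
qed

end
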